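(* Let $k$ be an algebraically closed field. Let $f,f':\mathbb{P}^1\to\mathbb{P}^1$ be surjective morphisms over $k$ having the same degree, and let $\mathcal{E}$ be any vector bundle on $\mathbb{P}^1$. Then $f_*\mathcal{E}\cong f'_*\mathcal{E}$; that is, the direct image of a vector bundle with respect to a map $\mathbb{P}^1\to\mathbb{P}^1$ depends only on the degree of the map.
   Context: $\mathbb{P}^1$ is the projective line over $k$. Vector bundles are algebraic vector bundles (locally free sheaves) of finite rank. *)

theory Defs
  imports
    "HOL-Algebra.Module"
    "HOL-Algebra.Embedded_Algebras"
    "HOL-Computational_Algebra.Polynomial"
begin

text \<open>
  Since the ground field is algebraically closed, \<open>\<P>\<^sup>1\<close> is treated as a classical variety: its points
  are the closed points, and its structure sheaf consists of the regular \<open>k\<close>-valued functions.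
  The closed points of the scheme \<open>\<P>\<^sup>1\<close> determine its lattice of open sets, so sheaves of modules,
  morphisms over \<open>k\<close> and direct images are the same in both settings.
\<close>

section \<open>The projective line\<close>

text \<open>
  \<open>form d c x y\<close> is the value at \<open>(x, y)\<close> of the homogeneous polynomial of degree \<open>d\<close> in two
  variables with coefficients \<open>c\<close>; the values \<open>c i\<close> for \<open>i > d\<close> are irrelevant.
\<close>

definition form :: "nat \<Rightarrow> (nat \<Rightarrow> 'k::comm_ring_1) \<Rightarrow> 'k \<Rightarrow> 'k \<Rightarrow> 'k" where
  "form d c x y = (\<Sum>i\<le>d. c i * x ^ i * y ^ (d - i))"

definition proj_rel :: "'k::field \<times> 'k \<Rightarrow> 'k \<times> 'k \<Rightarrow> bool" where
  "proj_rel v w \<longleftrightarrow> v \<noteq> (0, 0) \<and> w \<noteq> (0, 0) \<and> (\<exists>c. c \<noteq> 0 \<and> w = (c * fst v, c * snd v))"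

lemma part_equivp_proj_rel: "part_equivp (proj_rel :: 'k::field \<times> 'k \<Rightarrow> _)"
proof (rule part_equivpI)
  have "proj_rel (1, 1) (1, 1 :: 'k)"
    by (auto simp: proj_rel_def intro!: exI[of _ 1])
  then show "\<exists>v :: 'k \<times> 'k. proj_rel v v" by blast
  show "symp (proj_rel :: 'k \<times> 'k \<Rightarrow> _)"
  proof (rule sympI)
    fix v w :: "'k \<times> 'k" assume "proj_rel v w"
    then obtain c where c: "c \<noteq> 0" "w = (c * fst v, c * snd v)" "v \<noteq> (0, 0)" "w \<noteq> (0, 0)"
      unfolding proj_rel_def by blast
    then have "v = (inverse c * fst w, inverse c * snd w)"
      by (simp add: mult.assoc[symmetric])
    with c show "proj_rel w v"
      unfolding proj_rel_def by (metis nonzero_imp_inverse_nonzero)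
  qed
  show "transp (proj_rel :: 'k \<times> 'k \<Rightarrow> _)"
  proof (rule transpI)
    fix u v w :: "'k \<times> 'k" assume "proj_rel u v" "proj_rel v w"
    then obtain c c' where "c \<noteq> 0" "v = (c * fst u, c * snd u)" "u \<noteq> (0, 0)"
      "c' \<noteq> 0" "w = (c' * fst v, c' * snd v)" "w \<noteq> (0, 0)"
      unfolding proj_rel_def by blast
    then have "c' * c \<noteq> 0" "w = (c' * c * fst u, c' * c * snd u)" "u \<noteq> (0, 0)" "w \<noteq> (0, 0)"
      by (auto simp: mult.assoc)
    then show "proj_rel u w"
      unfolding proj_rel_def by blast
  qed
qed

quotient_type (overloaded) 'k proj1 = "'k::field \<times> 'k" / partial: proj_rel
  by (rule part_equivp_proj_rel)

lemma form_scale: "form d c (t * x) (t * y) = t ^ d * form d c x y"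
  unfolding form_def sum_distrib_left
proof (rule sum.cong)
  fix i assume "i \<in> {..d}"
  then have "t ^ d = t ^ i * t ^ (d - i)"
    by (simp add: power_add[symmetric])
  then show "c i * (t * x) ^ i * (t * y) ^ (d - i) = t ^ d * (c i * x ^ i * y ^ (d - i))"
    by (simp add: power_mult_distrib algebra_simps)
qed simp

lift_definition form_vanishes :: "nat \<Rightarrow> (nat \<Rightarrow> 'k::field) \<Rightarrow> 'k proj1 \<Rightarrow> bool" is
  "\<lambda>d c (x, y). form d c x y = 0"
  by (auto simp: proj_rel_def form_scale)

text \<open>The quotient of two forms of the same degree; only meaningful where the second does not vanish.\<close>

lift_definition form_quotient ::
    "nat \<Rightarrow> (nat \<Rightarrow> 'k::field) \<Rightarrow> (nat \<Rightarrow> 'k) \<Rightarrow> 'k proj1 \<Rightarrow> 'k" is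
  "\<lambda>d a b (x, y). form d a x y / form d b x y"
  by (auto simp: proj_rel_def form_scale)

lemma form_mult_ex: "\<exists>c. \<forall>x y :: 'k::comm_ring_1. form (d + e) c x y = form d a x y * form e b x y"
proof -
  define c where "c k = (\<Sum>(i, j) | (i, j) \<in> {..d} \<times> {..e} \<and> i + j = k. a i * b j)" for k
  have "form (d + e) c x y = form d a x y * form e b x y" for x y
  proof -
    let ?P = "{..d} \<times> {..e}"
    let ?g = "\<lambda>(i, j). (a i * x ^ i * y ^ (d - i)) * (b j * x ^ j * y ^ (e - j))"
    have "form d a x y * form e b x y = sum ?g ?P"
      unfolding form_def sum_product by (simp add: sum.cartesian_product)
    also have "\<dots> = (\<Sum>k\<le>d + e. sum ?g {p \<in> ?P. (case p of (i, j) \<Rightarrow> i + j) = k})"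
      by (rule sum.group[symmetric]) auto
    also have "\<dots> = form (d + e) c x y"
      unfolding form_def c_def sum_distrib_right
    proof (intro sum.cong refl, goal_cases)
      case (2 k p)
      obtain i j where p: "p = (i, j)" by force
      with 2 have ij: "i \<le> d" "j \<le> e" "k = i + j" by auto
      have "y ^ (d - i) * y ^ (e - j) = y ^ (d + e - k)"
        using ij by (simp add: power_add[symmetric])
      then show ?case
        using ij by (simp add: p power_add algebra_simps)
    qed auto
    finally show ?thesis by simp
  qed
  then show ?thesis by blast
qed

text \<open>
  The Zariski topology: closed sets are the common zero sets of arbitrary sets of homogeneous
  polynomials, a pair \<open>(d, c)\<close> standing for the form of degree \<open>d\<close> with coefficients \<open>c\<close>.
\<close>

instantiation proj1 :: (field) topological_space
begin

definition open_proj1 :: "'a proj1 set \<Rightarrow> bool" where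
  "open_proj1 U \<longleftrightarrow> (\<exists>S. - U = {p. \<forall>(d, c) \<in> S. form_vanishes d c p})"

instance
proof
  have "- UNIV = {p :: 'a proj1. \<forall>(d, c) \<in> {(0, \<lambda>_. 1)}. form_vanishes d c p}"
    by (simp, transfer, auto simp: form_def)
  then show "open (UNIV :: 'a proj1 set)"
    unfolding open_proj1_def by blast
next
  fix U V :: "'a proj1 set" assume "open U" "open V"
  then obtain S T where S: "- U = {p. \<forall>(d, c) \<in> S. form_vanishes d c p}"
    and T: "- V = {p. \<forall>(d, c) \<in> T. form_vanishes d c p}"
    unfolding open_proj1_def by blast
  define R where "R = {(d + e, c) | d e c a b. (d, a) \<in> S \<and> (e, b) \<in> T \<and>
    (\<forall>x y. form (d + e) c x y = form d a x y * form e b x y)}"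
  have prod: "form_vanishes (d + e) c p \<longleftrightarrow> form_vanishes d a p \<or> form_vanishes e b p"
    if "\<forall>x y. form (d + e) c x y = form d a x y * form e b x y" for d e a b p and c :: "nat \<Rightarrow> 'a"
    using that by (transfer fixing: d e a b c) auto
  have "- (U \<inter> V) = {p. \<forall>(d, c) \<in> R. form_vanishes d c p}"
  proof (intro Set.set_eqI iffI)
    fix p assume "p \<in> - (U \<inter> V)"
    then have "(\<forall>(d, c) \<in> S. form_vanishes d c p) \<or> (\<forall>(d, c) \<in> T. form_vanishes d c p)"
      using S T by auto
    then have *: "form_vanishes d a p \<or> form_vanishes e b p"
      if "(d, a) \<in> S" "(e, b) \<in> T" for d a e b
      using that by auto
    have "form_vanishes n c p" if "(n, c) \<in> R" for n c
    proof -
      from that obtain d a e b where n: "n = d + e" and ab: "(d, a) \<in> S" "(e, b) \<in> T"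
        and c: "\<forall>x y. form (d + e) c x y = form d a x y * form e b x y"
        by (auto simp: R_def)
      show ?thesis
        unfolding n prod[OF c] using ab by (rule *)
    qed
    then show "p \<in> {p. \<forall>(d, c) \<in> R. form_vanishes d c p}" by auto
  next
    fix p assume p: "p \<in> {p. \<forall>(d, c) \<in> R. form_vanishes d c p}"
    show "p \<in> - (U \<inter> V)"
    proof (rule ccontr)
      assume "p \<notin> - (U \<inter> V)"
      then have "p \<notin> - U" "p \<notin> - V" by auto
      then obtain d a e b where *: "(d, a) \<in> S" "\<not> form_vanishes d a p"
        "(e, b) \<in> T" "\<not> form_vanishes e b p"
        unfolding S T by auto
      obtain c where c: "\<forall>x y. form (d + e) c x y = form d a x y * form e b x y"
        using form_mult_ex[of d e a b] by auto
      then have "(d + e, c) \<in> R" using *(1,3) by (auto simp: R_def)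
      then have "form_vanishes (d + e) c p" using p by auto
      then show False using prod[OF c] *(2,4) by simp
    qed
  qed
  then show "open (U \<inter> V)"
    unfolding open_proj1_def by blast
next
  fix K :: "'a proj1 set set" assume "\<forall>U\<in>K. open U"
  then have "\<forall>U\<in>K. \<exists>S. - U = {p. \<forall>(d, c) \<in> S. form_vanishes d c p}"
    unfolding open_proj1_def .
  from bchoice[OF this] obtain S
    where S: "\<forall>U\<in>K. - U = {p. \<forall>(d, c) \<in> S U. form_vanishes d c p}" ..
  have "- \<Union> K = (\<Inter>U\<in>K. - U)"
    by auto
  also have "\<dots> = (\<Inter>U\<in>K. {p. \<forall>(d, c) \<in> S U. form_vanishes d c p})"
    using S by (intro INF_cong) auto
  also have "\<dots> = {p. \<forall>(d, c) \<in> (\<Union>U\<in>K. S U). form_vanishes d c p}"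
    by auto
  finally show "open (\<Union> K)"
    unfolding open_proj1_def by blast
qed

end


section \<open>Regular functions and the function field\<close>

definition regular_on :: "'k::alg_closed_field proj1 set \<Rightarrow> ('k proj1 \<Rightarrow> 'k) \<Rightarrow> bool" where
  "regular_on U g \<longleftrightarrow> (\<forall>p\<in>U. \<exists>V d a b. open V \<and> p \<in> V \<and> V \<subseteq> U \<and>
     (\<forall>q\<in>V. \<not> form_vanishes d b q \<and> g q = form_quotient d a b q))"

text \<open>
  The structure sheaf. Functions on \<open>U\<close> are \<^emph>\<open>extensional\<close>, so that they are determined by their
  values on \<open>U\<close>; restriction to \<open>V \<subseteq> U\<close> is \<^term>\<open>\<lambda>g. restrict g V\<close>.
\<close>

definition structure_ring :: "'k::alg_closed_field proj1 set \<Rightarrow> ('k proj1 \<Rightarrow> 'k) ring" where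
  "structure_ring U =
     \<lparr>carrier = {g \<in> extensional U. regular_on U g},
      monoid.mult = (\<lambda>g h. \<lambda>p\<in>U. g p * h p),
      one = (\<lambda>p\<in>U. 1),
      ring.zero = (\<lambda>p\<in>U. 0),
      add = (\<lambda>g h. \<lambda>p\<in>U. g p + h p)\<rparr>"

text \<open>
  Rational functions are equivalence classes of pairs \<open>(U, g)\<close> with \<open>U\<close> open and non-empty and \<open>g\<close>
  regular on \<open>U\<close>, two pairs being equivalent if the functions agree on the overlap.
\<close>

definition rational_reps :: "('k::alg_closed_field proj1 set \<times> ('k proj1 \<Rightarrow> 'k)) set" where
  "rational_reps = {(U, g). open U \<and> U \<noteq> {} \<and> g \<in> carrier (structure_ring U)}"

definition rational_rel ::
    "(('k::alg_closed_field proj1 set \<times> ('k proj1 \<Rightarrow> 'k)) \<times> ('k proj1 set \<times> ('k proj1 \<Rightarrow> 'k))) set" where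
  "rational_rel = {((U, g), (V, h)). (U, g) \<in> rational_reps \<and> (V, h) \<in> rational_reps \<and>
     (\<forall>p\<in>U \<inter> V. g p = h p)}"

definition function_field ::
    "('k::alg_closed_field proj1 set \<times> ('k proj1 \<Rightarrow> 'k)) set ring" where
  "function_field =
     \<lparr>carrier = rational_reps // rational_rel,
      monoid.mult = (\<lambda>A B. \<Union>(U, g)\<in>A. \<Union>(V, h)\<in>B. rational_rel `` {(U \<inter> V, \<lambda>p\<in>U \<inter> V. g p * h p)}),
      one = rational_rel `` {(UNIV, \<lambda>p. 1)},
      ring.zero = rational_rel `` {(UNIV, \<lambda>p. 0)},
      add = (\<lambda>A B. \<Union>(U, g)\<in>A. \<Union>(V, h)\<in>B. rational_rel `` {(U \<inter> V, \<lambda>p\<in>U \<inter> V. g p + h p)})\<rparr>"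


section \<open>Morphisms and their degree\<close>

definition is_morphism :: "('k::alg_closed_field proj1 \<Rightarrow> 'k proj1) \<Rightarrow> bool" where
  "is_morphism f \<longleftrightarrow> continuous_on UNIV f \<and>
     (\<forall>V g. open V \<longrightarrow> regular_on V g \<longrightarrow> regular_on (f -` V) (g \<circ> f))"

text \<open>
  The homomorphism \<open>f\<^sup>*\<close> on rational functions (for dominant \<open>f\<close>), and
  the degree \<open>[K(\<P>\<^sup>1) : f\<^sup>* K(\<P>\<^sup>1)]\<close> of the induced field extension.
\<close>

definition pullback_rational ::
    "('k::alg_closed_field proj1 \<Rightarrow> 'k proj1) \<Rightarrow>
     ('k proj1 set \<times> ('k proj1 \<Rightarrow> 'k)) set \<Rightarrow> ('k proj1 set \<times> ('k proj1 \<Rightarrow> 'k)) set" where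
  "pullback_rational f A = (\<Union>(U, g)\<in>A. rational_rel `` {(f -` U, \<lambda>p\<in>f -` U. g (f p))})"

definition morphism_degree :: "('k::alg_closed_field proj1 \<Rightarrow> 'k proj1) \<Rightarrow> nat" where
  "morphism_degree f =
     ring.dim function_field (pullback_rational f ` carrier function_field) (carrier function_field)"


section \<open>Sheaves of modules and vector bundles\<close>

text \<open>
  Data of a presheaf of modules: \<open>sections E U\<close> is the module of sections over \<open>U\<close>, and
  \<open>restr E U V\<close> the restriction map to \<open>V \<subseteq> U\<close>. Only open \<open>U\<close> and \<open>V\<close> matter, and the fields
  \<^const>\<open>monoid.mult\<close> and \<^const>\<open>one\<close> of the module records are unused.
\<close>

record (overloaded) ('k, 'm) module_presheaf =
  sections :: "'k proj1 set \<Rightarrow> ('k proj1 \<Rightarrow> 'k, 'm) module"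
  restr :: "'k proj1 set \<Rightarrow> 'k proj1 set \<Rightarrow> 'm \<Rightarrow> 'm"

definition is_module_presheaf :: "('k::alg_closed_field, 'm) module_presheaf \<Rightarrow> bool" where
  "is_module_presheaf E \<longleftrightarrow>
     (\<forall>U. open U \<longrightarrow> module (structure_ring U) (sections E U)) \<and>
     (\<forall>U V. open U \<longrightarrow> open V \<longrightarrow> V \<subseteq> U \<longrightarrow>
        restr E U V \<in> hom (add_monoid (sections E U)) (add_monoid (sections E V)) \<and>
        (\<forall>r\<in>carrier (structure_ring U). \<forall>s\<in>carrier (sections E U).
           restr E U V (r \<odot>\<^bsub>sections E U\<^esub> s) = restrict r V \<odot>\<^bsub>sections E V\<^esub> restr E U V s)) \<and>
     (\<forall>U. open U \<longrightarrow> (\<forall>s\<in>carrier (sections E U). restr E U U s = s)) \<and>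
     (\<forall>U V W. open U \<longrightarrow> open V \<longrightarrow> open W \<longrightarrow> W \<subseteq> V \<longrightarrow> V \<subseteq> U \<longrightarrow>
        (\<forall>s\<in>carrier (sections E U). restr E V W (restr E U V s) = restr E U W s))"

definition is_module_sheaf :: "('k::alg_closed_field, 'm) module_presheaf \<Rightarrow> bool" where
  "is_module_sheaf E \<longleftrightarrow> is_module_presheaf E \<and>
     (\<forall>\<U> s. (\<forall>U\<in>\<U>. open U \<and> s U \<in> carrier (sections E U)) \<longrightarrow>
        (\<forall>U\<in>\<U>. \<forall>V\<in>\<U>. restr E U (U \<inter> V) (s U) = restr E V (U \<inter> V) (s V)) \<longrightarrow>
        (\<exists>!t. t \<in> carrier (sections E (\<Union>\<U>)) \<and> (\<forall>U\<in>\<U>. restr E (\<Union>\<U>) U t = s U)))"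

text \<open>Isomorphism of the restrictions of two sheaves of modules to the open set \<open>U\<close>.\<close>

definition isomorphic_on ::
    "'k::alg_closed_field proj1 set \<Rightarrow> ('k, 'm) module_presheaf \<Rightarrow> ('k, 'n) module_presheaf \<Rightarrow> bool" where
  "isomorphic_on U E F \<longleftrightarrow> (\<exists>\<phi>.
     (\<forall>V. open V \<longrightarrow> V \<subseteq> U \<longrightarrow>
        \<phi> V \<in> iso (add_monoid (sections E V)) (add_monoid (sections F V)) \<and>
        (\<forall>r\<in>carrier (structure_ring V). \<forall>s\<in>carrier (sections E V).
           \<phi> V (r \<odot>\<^bsub>sections E V\<^esub> s) = r \<odot>\<^bsub>sections F V\<^esub> \<phi> V s)) \<and>
     (\<forall>V W. open V \<longrightarrow> open W \<longrightarrow> W \<subseteq> V \<longrightarrow> V \<subseteq> U \<longrightarrow>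
        (\<forall>s\<in>carrier (sections E V). \<phi> W (restr E V W s) = restr F V W (\<phi> V s))))"

abbreviation isomorphic ::
    "('k::alg_closed_field, 'm) module_presheaf \<Rightarrow> ('k, 'n) module_presheaf \<Rightarrow> bool" where
  "isomorphic \<equiv> isomorphic_on UNIV"

definition free_sheaf :: "nat \<Rightarrow> ('k::alg_closed_field, nat \<Rightarrow> 'k proj1 \<Rightarrow> 'k) module_presheaf" where
  "free_sheaf n =
     \<lparr>sections = (\<lambda>U.
        \<lparr>carrier = {..<n} \<rightarrow>\<^sub>E carrier (structure_ring U),
         monoid.mult = undefined,
         one = undefined,
         ring.zero = (\<lambda>i\<in>{..<n}. \<zero>\<^bsub>structure_ring U\<^esub>),
         add = (\<lambda>s t. \<lambda>i\<in>{..<n}. s i \<oplus>\<^bsub>structure_ring U\<^esub> t i),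
         module.smult = (\<lambda>r s. \<lambda>i\<in>{..<n}. r \<otimes>\<^bsub>structure_ring U\<^esub> s i)\<rparr>),
      restr = (\<lambda>U V s. \<lambda>i\<in>{..<n}. restrict (s i) V)\<rparr>"

definition is_vector_bundle :: "('k::alg_closed_field, 'm) module_presheaf \<Rightarrow> bool" where
  "is_vector_bundle E \<longleftrightarrow> is_module_sheaf E \<and>
     (\<forall>p. \<exists>U n. open U \<and> p \<in> U \<and> isomorphic_on U E (free_sheaf n))"

text \<open>
  The direct image: \<open>(f\<^sub>* E)(U) = E(f\<^sup>-\<^sup>1 U)\<close>, on which a regular function on \<open>U\<close> acts through its
  pullback along \<open>f\<close>.
\<close>

definition direct_image ::
    "('k::alg_closed_field proj1 \<Rightarrow> 'k proj1) \<Rightarrow> ('k, 'm) module_presheaf \<Rightarrow> ('k, 'm) module_presheaf" where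
  "direct_image f E =
     \<lparr>sections = (\<lambda>U. (sections E (f -` U))
        \<lparr>module.smult := (\<lambda>r s. (\<lambda>p\<in>f -` U. r (f p)) \<odot>\<^bsub>sections E (f -` U)\<^esub> s)\<rparr>),
      restr = (\<lambda>U V. restr E (f -` U) (f -` V))\<rparr>"

end

(*
  Write f = [P : Q] with forms P, Q of degree d without common zeros; then d is the degree of f.

  A bundle E splits as a sum of line bundles O(a_i). Among all families of sections e_i of E(-a_i) that
  are generically a frame, choose one with maximal sum of the a_i, which is bounded because det(e_1, ..., e_n)
  becomes a form of degree N - sum a_i for a fixed N. It is a frame everywhere: if a combination of the e_i
  vanishes at a point, then, after multiplication by powers of a linear form, it is divisible by
  the linear form of that point, and the section with the smallest a_i in the relation can be replaced by the quotient.

  For a = d q + r with 0 <= r < d, the direct image of O(a) is the sum of r + 1 copies of O(q) and d - 1 - r copies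
  of O(q - 1), because the forms of degree congruent to r mod d are a free module over k[P, Q], on the monomials of degree r
  and d - 1 - r forms of degree r + d. Hence the direct image of E depends only on d and the a_i.
*)

theory Submission
  imports Defs "HOL-Library.Function_Algebras" "Jordan_Normal_Form.Determinant"
begin

text \<open>A section of O(a) over U is taken as a homogeneous function of degree a on the preimage
  of U in k^2 minus the origin, so f acts by substituting (P, Q). Two direct images are compared
  through a common target, the families of such functions of prescribed degrees, without building
  the sheaves O(a). The degree is defined by an extension of function fields, so d must be recovered
  from it. For a = d - 1 all summands of the direct image are O(0); the d generators, divided by
  y^(d-1), are a basis of the function field over its pullback. Two obstacles shape the rest. A
  section over the preimage of U has a denominator G that need not be a pullback: the product of the
  linear forms of the images of the zeros of G pulls back to a multiple of G and has no zeros in U.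
  And a bundle is an abstract sheaf, locally isomorphic to free ones: a finite cover, which exists
  because nonempty open sets are cofinite, turns it into a cocycle of matrices, for which common
  denominators and determinants are available.\<close>

section \<open>Forms in two variables\<close>

text \<open>Over a finite field the product of all x - a, increased by 1, would be a polynomial of
  positive degree taking only the value 1. Infinitude is what lets forms be identified with the
  functions they define.\<close>

lemma infinite_alg_closed: "infinite (UNIV :: 'k::alg_closed_field set)"
proof
  assume fin: "finite (UNIV :: 'k set)"
  let ?p = "(\<Prod>a\<in>(UNIV :: 'k set). [:-a, 1:]) + 1 :: 'k poly"
  have "\<And>x. poly ?p x = 1"
    using fin by (simp add: poly_prod)
  moreover have "degree (\<Prod>a\<in>(UNIV :: 'k set). [:-a, 1:] :: 'k poly) = card (UNIV :: 'k set)"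
    by (subst degree_prod_eq_sum_degree) auto
  then have "degree ?p > 0"
    using fin by (subst degree_add_eq_left) (auto simp: card_gt_0_iff)
  then obtain x where "poly ?p x = 0"
    using alg_closed_imp_poly_has_root by blast
  ultimately show False by simp
qed

text \<open>
  Forms are identified with the functions they define on \<open>k\<^sup>2\<close> (the field is infinite); integer degrees make
  the multiplication of forms total, the only form of negative degree being zero.
\<close>

definition Form :: "int \<Rightarrow> ('k::comm_ring_1 \<times> 'k \<Rightarrow> 'k) set" where
  "Form m = {F. (0 \<le> m \<and> (\<exists>c. F = (\<lambda>(x, y). form (nat m) c x y))) \<or> F = (\<lambda>_. 0)}"

lemma form_in_Form: "(\<lambda>(x, y). form m c x y) \<in> Form (int m)"
  by (auto simp: Form_def)

lemma Form_zero [simp]: "(\<lambda>_. 0) \<in> Form m"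
  by (simp add: Form_def)

lemma form_0: "form m (\<lambda>_. 0) = (\<lambda>x y. 0)"
  by (simp add: form_def fun_eq_iff)

lemma Form_E:
  assumes "F \<in> Form (int m)"
  obtains c where "F = (\<lambda>(x, y). form m c x y)"
proof (cases "F = (\<lambda>_. 0)")
  case True
  then show thesis using that[of "\<lambda>_. 0"] by (simp add: form_0 case_prod_unfold)
next
  case False
  then show thesis using assms that by (auto simp: Form_def)
qed

lemma Form_neg: "F \<in> Form m \<Longrightarrow> m < 0 \<Longrightarrow> F = (\<lambda>_. 0)"
  by (auto simp: Form_def)

lemma Form_cases:
  assumes "F \<in> Form m"
  obtains "F = (\<lambda>_. 0)" | n where "m = int n" "F \<in> Form (int n)"
proof (cases "m < 0")
  case True
  then show thesis using that(1) Form_neg[OF assms] by simp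
next
  case False
  then show thesis using that(2)[of "nat m"] assms by simp
qed

lemma Form_mult:
  assumes "F \<in> Form m" "G \<in> Form n"
  shows "(\<lambda>v. F v * G v) \<in> Form (m + n)"
  using assms(1)
proof (cases rule: Form_cases)
  case F: (2 i)
  show ?thesis using assms(2)
  proof (cases rule: Form_cases)
    case G: (2 j)
    obtain c where c: "F = (\<lambda>(x, y). form i c x y)" using Form_E[OF F(2)] .
    obtain d where d: "G = (\<lambda>(x, y). form j d x y)" using Form_E[OF G(2)] .
    obtain e where "\<forall>x y. form (i + j) e x y = form i c x y * form j d x y"
      using form_mult_ex by metis
    then have "(\<lambda>v. F v * G v) = (\<lambda>(x, y). form (i + j) e x y)"
      using c d by auto
    then show ?thesis
      using F G form_in_Form[of "i + j" e] by simp
  qed simp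
qed simp

lemma Form_scale:
  assumes "F \<in> Form m"
  shows "(\<lambda>v. a * F v) \<in> Form m"
  using assms
proof (cases rule: Form_cases)
  case F: (2 i)
  obtain c where c: "F = (\<lambda>(x, y). form i c x y)" using Form_E[OF F(2)] .
  have "(\<lambda>v. a * F v) = (\<lambda>(x, y). form i (\<lambda>k. a * c k) x y)"
    unfolding c by (auto simp: form_def sum_distrib_left mult.assoc)
  then show ?thesis using F form_in_Form by metis
qed simp

lemma Form_add:
  assumes "F \<in> Form m" "G \<in> Form m"
  shows "(\<lambda>v. F v + G v) \<in> Form m"
  using assms(1)
proof (cases rule: Form_cases)
  case F: (2 i)
  obtain c where c: "F = (\<lambda>(x, y). form i c x y)" using Form_E[OF F(2)] .
  obtain d where d: "G = (\<lambda>(x, y). form i d x y)" using Form_E[OF assms(2)[unfolded F(1)]] .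
  have "(\<lambda>v. F v + G v) = (\<lambda>(x, y). form i (\<lambda>k. c k + d k) x y)"
    unfolding c d by (auto simp: form_def sum.distrib[symmetric] algebra_simps)
  then show ?thesis using F form_in_Form by metis
qed (use assms in simp)

lemma Form_sum: "(\<And>i. i \<in> I \<Longrightarrow> F i \<in> Form m) \<Longrightarrow> (\<lambda>v. \<Sum>i\<in>I. F i v) \<in> Form m"
  by (induction I rule: infinite_finite_induct) (auto intro: Form_add)

lemma Form_diff:
  assumes "F \<in> Form m" "G \<in> Form m"
  shows "(\<lambda>v. F v - G v) \<in> Form m"
  using Form_add[OF assms(1) Form_scale[OF assms(2), of "-1"]] by simp

lemma Form_const [simp]: "(\<lambda>_. a) \<in> Form 0"
  using form_in_Form[of 0 "\<lambda>_. a"] by (simp add: form_def case_prod_unfold)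

lemma Form_fst: "fst \<in> Form 1"
proof -
  have "fst = (\<lambda>(x :: 'a, y :: 'a). form 1 (\<lambda>i. if i = 1 then 1 else 0) x y)"
    by (auto simp: form_def)
  then show ?thesis by (metis form_in_Form of_nat_1)
qed

lemma Form_snd: "snd \<in> Form 1"
proof -
  have "snd = (\<lambda>(x :: 'a, y :: 'a). form 1 (\<lambda>i. if i = 0 then 1 else 0) x y)"
    by (auto simp: form_def)
  then show ?thesis by (metis form_in_Form of_nat_1)
qed

lemma Form_power:
  assumes "F \<in> Form m"
  shows "(\<lambda>v. F v ^ n) \<in> Form (int n * m)"
proof (induction n)
  case (Suc n)
  show ?case using Form_mult[OF assms Suc] by (simp add: algebra_simps)
qed simp

lemma Form_prod:
  assumes "\<And>i. i \<in> I \<Longrightarrow> F i \<in> Form (m i)"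
  shows "(\<lambda>v. \<Prod>i\<in>I. F i v) \<in> Form (\<Sum>i\<in>I. m i)"
  using assms by (induction I rule: infinite_finite_induct) (auto intro: Form_mult)

lemma Form_scale_arg:
  assumes "F \<in> Form (int m)"
  shows "F (t * x, t * y) = t ^ m * F (x, y)"
proof -
  obtain c where "F = (\<lambda>(x, y). form m c x y)" using Form_E[OF assms] .
  then show ?thesis by (simp add: form_scale)
qed

lemma Form_compose:
  assumes F: "F \<in> Form m" and P: "P \<in> Form d" and Q: "Q \<in> Form d"
  shows "(\<lambda>v. F (P v, Q v)) \<in> Form (d * m)"
  using F
proof (cases rule: Form_cases)
  case (2 i)
  obtain c where c: "F = (\<lambda>(x, y). form i c x y)" using Form_E[OF 2(2)] .
  have "(\<lambda>v. c k * P v ^ k * Q v ^ (i - k)) \<in> Form (d * m)" if "k \<le> i" for k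
  proof -
    have "int k * d + int (i - k) * d = d * m"
      using that 2 by (simp add: of_nat_diff algebra_simps)
    then show ?thesis
      using Form_mult[OF Form_scale[OF Form_power[OF P]] Form_power[OF Q], of "c k" k "i - k"] by simp
  qed
  then show ?thesis
    unfolding c form_def by (auto intro!: Form_sum)
qed simp

section \<open>Restriction to the affine line and absence of zero divisors\<close>

lemma Form_poly:
  assumes "F \<in> Form (int m)"
  obtains c where "F = (\<lambda>(x, y). form m c x y)"
    "\<And>x. F (x, 1) = poly (\<Sum>i\<le>m. monom (c i) i) x"
    "\<And>i. coeff (\<Sum>i\<le>m. monom (c i) i) i = (if i \<le> m then c i else 0)"
proof -
  obtain c where c: "F = (\<lambda>(x, y). form m c x y)" using Form_E[OF assms] .
  show thesis
  proof (rule that[OF c])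
    show "F (x, 1) = poly (\<Sum>i\<le>m. monom (c i) i) x" for x
      by (simp add: c form_def poly_sum poly_monom)
    show "coeff (\<Sum>i\<le>m. monom (c i) i) i = (if i \<le> m then c i else 0)" for i
      by (simp add: coeff_sum)
  qed
qed

lemma poly_zero_fun:
  assumes "\<And>x. poly (p :: 'k::alg_closed_field poly) x = 0"
  shows "p = 0"
  using assms infinite_alg_closed poly_roots_finite[of p] by auto

text \<open>On y = 1 the monomial x^i y^(m-i) becomes x^i, so no coefficient is lost, and a
  polynomial in one variable vanishing on an infinite field is zero.\<close>

lemma Form_eq_zero:
  fixes F :: "'k::alg_closed_field \<times> 'k \<Rightarrow> 'k"
  assumes "F \<in> Form m" and "\<And>x. F (x, 1) = 0"
  shows "F = (\<lambda>_. 0)"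
  using assms(1)
proof (cases rule: Form_cases)
  case (2 n)
  obtain c where c: "F = (\<lambda>(x, y). form n c x y)"
    "\<And>x. F (x, 1) = poly (\<Sum>i\<le>n. monom (c i) i) x"
    "\<And>i. coeff (\<Sum>i\<le>n. monom (c i) i) i = (if i \<le> n then c i else 0)"
    by (rule Form_poly[OF 2(2)]) (rule that)
  have "(\<Sum>i\<le>n. monom (c i) i) = 0"
    by (rule poly_zero_fun) (simp only: c(2)[symmetric] assms(2))
  then have "c i = 0" if "i \<le> n" for i
    using c(3)[of i] that by simp
  then show ?thesis by (auto simp: c(1) form_def)
qed simp

text \<open>Inherited from polynomials in one variable through restriction to y = 1.\<close>

lemma Form_no_zero_divisors:
  fixes F :: "'k::alg_closed_field \<times> 'k \<Rightarrow> 'k"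
  assumes F: "F \<in> Form m" and G: "G \<in> Form n" and 0: "\<And>v. F v * G v = 0"
  shows "F = (\<lambda>_. 0) \<or> G = (\<lambda>_. 0)"
proof (rule ccontr)
  assume *: "\<not> ?thesis"
  with F obtain i where i: "F \<in> Form (int i)" by (meson Form_cases)
  from * G obtain j where j: "G \<in> Form (int j)" by (meson Form_cases)
  obtain p where p: "\<And>x. F (x, 1) = poly p x" by (rule Form_poly[OF i]) (rule that)
  obtain q where q: "\<And>x. G (x, 1) = poly q x" by (rule Form_poly[OF j]) (rule that)
  have "poly (p * q) x = 0" for x
    using 0[of "(x, 1)"] p q by simp
  then have "p * q = 0" by (rule poly_zero_fun)
  then have "p = 0 \<or> q = 0" by simp
  then show False
    using * Form_eq_zero[OF F] Form_eq_zero[OF G] p q by auto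
qed

lemma Form_cancel:
  fixes F :: "'k::alg_closed_field \<times> 'k \<Rightarrow> 'k"
  assumes "F \<in> Form m" "A \<in> Form n" "B \<in> Form n" "F \<noteq> (\<lambda>_. 0)" "\<And>v. F v * A v = F v * B v"
  shows "A = B"
proof -
  have "(\<lambda>v. A v - B v) = (\<lambda>_. 0)"
    using Form_no_zero_divisors[OF assms(1) Form_diff[OF assms(2,3)]] assms(4,5)
    by (auto simp: algebra_simps)
  then show ?thesis by (metis (no_types, lifting) eq_iff_diff_eq_0 ext)
qed

lemma Form_nonzero_point:
  fixes F :: "'k::alg_closed_field \<times> 'k \<Rightarrow> 'k"
  assumes "F \<in> Form m" "F \<noteq> (\<lambda>_. 0)"
  obtains v where "v \<noteq> (0, 0)" "F v \<noteq> 0"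
proof -
  obtain x where "F (x, 1) \<noteq> 0" using Form_eq_zero[OF assms(1)] assms(2) by blast
  then show thesis using that[of "(x, 1)"] by simp
qed

lemma Form_mult_nonzero:
  fixes F :: "'k::alg_closed_field \<times> 'k \<Rightarrow> 'k"
  assumes "F \<in> Form m" "G \<in> Form n" "F \<noteq> (\<lambda>_. 0)" "G \<noteq> (\<lambda>_. 0)"
  shows "(\<lambda>v. F v * G v) \<noteq> (\<lambda>_. 0)"
proof
  assume *: "(\<lambda>v. F v * G v) = (\<lambda>_. 0)"
  have "F v * G v = 0" for v using fun_cong[OF *] .
  then show False using Form_no_zero_divisors[OF assms(1,2)] assms(3,4) by blast
qed

lemma Form_prod_nonzero:
  fixes F :: "'i \<Rightarrow> 'k::alg_closed_field \<times> 'k \<Rightarrow> 'k"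
  assumes "\<And>i. i \<in> I \<Longrightarrow> F i \<in> Form (m i)" "\<And>i. i \<in> I \<Longrightarrow> F i \<noteq> (\<lambda>_. 0)"
  shows "(\<lambda>v. \<Prod>i\<in>I. F i v) \<noteq> (\<lambda>_. 0)"
  using assms
proof (induction I rule: infinite_finite_induct)
  case (insert i I)
  then show ?case
    using Form_mult_nonzero[of "F i" "m i" "\<lambda>v. \<Prod>i\<in>I. F i v" "\<Sum>i\<in>I. m i"]
    by (auto intro: Form_prod)
qed (auto simp: fun_eq_iff)

text \<open>The determinant of \<open>w\<close> and \<open>v\<close> as a linear form in
  \<open>w\<close>: for nonzero \<open>v\<close> its only zero on the projective line is the point
  of \<open>v\<close> (\<open>lin_eq_0_iff\<close>).\<close>

definition lin :: "'k::comm_ring_1 \<times> 'k \<Rightarrow> 'k \<times> 'k \<Rightarrow> 'k" where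
  "lin v w = snd v * fst w - fst v * snd w"

lemma lin_Form [simp]: "lin v \<in> Form 1"
  unfolding lin_def by (intro Form_diff Form_scale Form_fst Form_snd)

lemma lin_self [simp]: "lin v v = 0"
  by (simp add: lin_def)

lemma lin_nonzero:
  fixes v :: "'k::field \<times> 'k"
  assumes "v \<noteq> (0, 0)" shows "lin v \<noteq> (\<lambda>_. 0)"
proof
  assume "lin v = (\<lambda>_. 0)"
  then have "lin v (1, 0) = 0" "lin v (0, 1) = 0" by simp_all
  then show False using assms by (cases v) (auto simp: lin_def)
qed

lemma lin_eq_0_iff:
  fixes v w :: "'k::field \<times> 'k"
  assumes "v \<noteq> (0, 0)" "w \<noteq> (0, 0)"
  shows "lin v w = 0 \<longleftrightarrow> proj_rel v w"
proof
  obtain a b where v: "v = (a, b)" by force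
  obtain x y where w: "w = (x, y)" by force
  assume "lin v w = 0"
  then have eq: "b * x = a * y" by (simp add: lin_def v w)
  show "proj_rel v w"
  proof (cases "b = 0")
    case True
    then have "a \<noteq> 0" "y = 0" "x \<noteq> 0" using assms v w eq by auto
    then show ?thesis using True assms
      unfolding proj_rel_def v w by (auto intro!: exI[of _ "x / a"])
  next
    case False
    then have "x = (y / b) * a" "y = (y / b) * b" using eq by (simp_all add: field_simps)
    moreover then have "y / b \<noteq> 0" using assms w by auto
    ultimately show ?thesis using assms unfolding proj_rel_def v w
      by (metis fst_conv snd_conv)
  qed
next
  assume "proj_rel v w"
  then show "lin v w = 0" by (auto simp: proj_rel_def lin_def)
qed

lemma linear_form_at:
  fixes v :: "'k::field \<times> 'k"
  assumes "v \<noteq> (0, 0)"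
  obtains L where "L \<in> Form 1" "L v = 1"
proof -
  obtain a b where v: "v = (a, b)" by force
  show thesis
  proof (cases "a = 0")
    case True
    then show thesis using assms v that[OF Form_scale[OF Form_snd, of "1 / b"]] by auto
  next
    case False
    then show thesis using assms v that[OF Form_scale[OF Form_fst, of "1 / a"]] by auto
  qed
qed

section \<open>Zeros and linear factors of forms\<close>

lemma Form_monomials:
  assumes "F \<in> Form (int m)"
  obtains c where "\<And>v. F v = (\<Sum>i\<le>m. c i * fst v ^ i * snd v ^ (m - i))"
proof -
  obtain c where "F = (\<lambda>(x, y). form m c x y)" using Form_E[OF assms] .
  then show thesis using that[of c] by (simp add: form_def case_prod_unfold)
qed

lemma monomial_Form: "i \<le> m \<Longrightarrow> (\<lambda>v. fst v ^ i * snd v ^ (m - i)) \<in> Form (int m)"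
  using Form_mult[OF Form_power[OF Form_fst, of i] Form_power[OF Form_snd, of "m - i"]]
  by (simp add: of_nat_diff)

text \<open>The factor theorem for forms. Degrees are integers, so a constant that vanishes has its
  quotient, zero, in degree - 1.\<close>

lemma Form_zero_divisible:
  fixes F :: "'k::field \<times> 'k \<Rightarrow> 'k"
  assumes F: "F \<in> Form m" and v: "v \<noteq> (0, 0)" "F v = 0"
  obtains G where "G \<in> Form (m - 1)" "\<And>w. F w = lin v w * G w"
proof -
  have "\<exists>G\<in>Form (m - 1). \<forall>w. F w = lin v w * G w"
    using F
  proof (cases rule: Form_cases)
    case 1
    then show ?thesis by (intro bexI[of _ "\<lambda>_. 0"]) auto
  next
    case (2 n)
    obtain c where c: "\<And>v. F v = (\<Sum>i\<le>n. c i * fst v ^ i * snd v ^ (n - i))"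
      by (rule Form_monomials[OF 2(2)]) (rule that)
    obtain a b where ab: "v = (a, b)" by force
    show ?thesis
    proof (cases n)
      case 0
      then show ?thesis using v c by (intro bexI[of _ "\<lambda>_. 0"]) auto
    next
      case (Suc n')
      text \<open>Since \<open>x\<^sup>i b\<^sup>i - a\<^sup>i y\<^sup>i\<close> is divisible by \<open>b x - a y\<close>, so is \<open>b\<^sup>n F\<close>, and likewise \<open>a\<^sup>n F\<close>.\<close>
      have "\<exists>G\<in>Form (m - 1). \<forall>w. b ^ n * F w = lin v w * G w"
      proof -
        \<comment> \<open>\<open>K i\<close> is the quotient of (b x)^i - (a y)^i by b x - a y; for
          \<open>i = 0\<close> the empty sum gives 0.\<close>
        define K where "K i = (\<lambda>w :: 'k \<times> 'k. \<Sum>j<i. (a * snd w) ^ (i - Suc j) * (b * fst w) ^ j)" for i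
        define G where "G = (\<lambda>w. \<Sum>i\<le>n. c i * b ^ (n - i) * (K i w * snd w ^ (n - i)))"
        have K: "K i \<in> Form (int i - 1)" if "i > 0" for i
          unfolding K_def
        proof (intro Form_sum)
          fix j assume "j \<in> {..<i}"
          then have "int (i - Suc j) * 1 + int j * 1 = int i - 1" by (simp add: of_nat_diff)
          moreover have "(\<lambda>w. (a * snd w) ^ (i - Suc j)) \<in> Form (int (i - Suc j) * 1)"
            by (rule Form_power[OF Form_scale[OF Form_snd]])
          moreover have "(\<lambda>w. (b * fst w) ^ j) \<in> Form (int j * 1)"
            by (rule Form_power[OF Form_scale[OF Form_fst]])
          ultimately show "(\<lambda>w. (a * snd w) ^ (i - Suc j) * (b * fst w) ^ j) \<in> Form (int i - 1)"
            using Form_mult by metis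
        qed
        have "(\<lambda>w. K i w * snd w ^ (n - i)) \<in> Form (m - 1)" if "i \<le> n" for i
        proof (cases "i = 0")
          case True
          then show ?thesis by (simp add: K_def)
        next
          case False
          then show ?thesis
            using that 2 Form_mult[OF K Form_power[OF Form_snd], of i "n - i"]
            by (simp add: of_nat_diff algebra_simps)
        qed
        then have "G \<in> Form (m - 1)"
          unfolding G_def by (intro Form_sum Form_scale) auto
        moreover have "b ^ n * F w = lin v w * G w" for w
        proof -
          have "b ^ n * F w = (\<Sum>i\<le>n. c i * b ^ (n - i) * snd w ^ (n - i) * (b * fst w) ^ i)"
            unfolding c sum_distrib_left
          proof (intro sum.cong refl)
            fix i assume "i \<in> {..n}"
            then have "b ^ n = b ^ (n - i) * b ^ i" by (simp add: power_add[symmetric])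
            then show "b ^ n * (c i * fst w ^ i * snd w ^ (n - i)) =
                c i * b ^ (n - i) * snd w ^ (n - i) * (b * fst w) ^ i"
              by (simp add: power_mult_distrib)
          qed
          also have "\<dots> = (\<Sum>i\<le>n. c i * b ^ (n - i) * snd w ^ (n - i) * ((b * fst w) ^ i - (a * snd w) ^ i))
              + (\<Sum>i\<le>n. c i * b ^ (n - i) * snd w ^ (n - i) * (a * snd w) ^ i)"
            by (simp add: sum.distrib[symmetric] algebra_simps)
          also have "(\<Sum>i\<le>n. c i * b ^ (n - i) * snd w ^ (n - i) * (a * snd w) ^ i) = snd w ^ n * F v"
            unfolding c ab sum_distrib_left
          proof (intro sum.cong refl)
            fix i assume "i \<in> {..n}"
            then have "snd w ^ n = snd w ^ (n - i) * snd w ^ i" by (simp add: power_add[symmetric])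
            then show "c i * b ^ (n - i) * snd w ^ (n - i) * (a * snd w) ^ i =
                snd w ^ n * (c i * fst (a, b) ^ i * snd (a, b) ^ (n - i))"
              by (simp add: power_mult_distrib)
          qed
          also have "(\<Sum>i\<le>n. c i * b ^ (n - i) * snd w ^ (n - i) * ((b * fst w) ^ i - (a * snd w) ^ i))
              = lin v w * G w"
            unfolding G_def sum_distrib_left K_def lin_def ab
            by (intro sum.cong refl, subst power_diff_sumr2) (simp add: algebra_simps)
          finally show ?thesis using v by simp
        qed
        ultimately show ?thesis by blast
      qed
      then obtain G1 where G1: "G1 \<in> Form (m - 1)" "\<And>w. b ^ n * F w = lin v w * G1 w" by blast
      show ?thesis
      proof (cases "b = 0")
        case False
        then show ?thesis
          using G1 by (intro bexI[of _ "\<lambda>w. (1 / b ^ n) * G1 w"] Form_scale) (auto simp: field_simps)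
      next
        case True
        then have a: "a \<noteq> 0" using v ab by simp
        \<comment> \<open>With \<open>b = 0\<close> the linear form of \<open>v\<close> is - a y,
          and y divides the form as soon as its coefficient of x^n vanishes; the value at (a, 0) is
          that coefficient times a^n.\<close>
        have "c n * a ^ n = 0"
        proof -
          have "0 = (\<Sum>i\<le>n. c i * a ^ i * 0 ^ (n - i))"
            using v(2) by (simp add: c ab True)
          also have "\<dots> = c n * a ^ n"
            by (subst sum.remove[of _ n]) (auto intro!: sum.neutral)
          finally show ?thesis by simp
        qed
        then have cn: "c n = 0" using a by simp
        define G where "G = (\<lambda>w. \<Sum>i\<le>n'. c i * (fst w ^ i * snd w ^ (n' - i)))"
        have "G \<in> Form (int n')"
          unfolding G_def by (intro Form_sum Form_scale monomial_Form) auto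
        then have G: "G \<in> Form (m - 1)" using 2 Suc by simp
        have "F w = snd w * G w" for w
          unfolding c G_def Suc using cn Suc
          by (auto simp: sum_distrib_left Suc_diff_le algebra_simps intro!: sum.cong)
        then show ?thesis
          using a by (intro bexI[OF _ Form_scale[OF G, of "- 1 / a"]]) (auto simp: lin_def ab True)
      qed
    qed
  qed
  then show thesis using that by blast
qed

lemma Form_has_zero:
  fixes F :: "'k::alg_closed_field \<times> 'k \<Rightarrow> 'k"
  assumes F: "F \<in> Form m" and m: "m > 0"
  obtains v where "v \<noteq> (0, 0)" "F v = 0"
proof -
  obtain n where n: "m = int n" "n > 0" using m by (metis zero_less_imp_eq_int)
  obtain c where c: "F = (\<lambda>(x, y). form n c x y)"
    "\<And>x. F (x, 1) = poly (\<Sum>i\<le>n. monom (c i) i) x"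
    "\<And>i. coeff (\<Sum>i\<le>n. monom (c i) i) i = (if i \<le> n then c i else 0)"
    by (rule Form_poly[OF F[unfolded n(1)]]) (rule that)
  show thesis
  proof (cases "degree (\<Sum>i\<le>n. monom (c i) i) > 0")
    case True
    then obtain x where "poly (\<Sum>i\<le>n. monom (c i) i) x = 0"
      using alg_closed_imp_poly_has_root by blast
    then show thesis using that[of "(x, 1)"] c(2) by simp
  next
    case False
    \<comment> \<open>The form has positive degree, so a constant restriction to y = 1 has lost its
      leading coefficient, which is the value at the point at infinity (1, 0).\<close>
    then have "c n = 0" using c(3)[of n] n by (metis coeff_eq_0 gr0I order_refl)
    then have "F (1, 0) = 0"
      by (auto simp: c(1) form_def intro!: sum.neutral)
    then show thesis using that[of "(1, 0)"] by simp
  qed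
qed

lemma Form_0_const:
  assumes "F \<in> Form 0"
  shows "F v = F w"
proof -
  have F: "F \<in> Form (int 0)" using assms by simp
  obtain c where "F = (\<lambda>(x, y). form 0 c x y)" using Form_E[OF F] .
  then show ?thesis by (simp add: form_def case_prod_unfold)
qed

text \<open>A form of positive degree has a zero and one of negative degree is zero. This makes the
  denominators of global sections constant.\<close>

lemma Form_nowhere_zero:
  fixes G :: "'k::alg_closed_field \<times> 'k \<Rightarrow> 'k"
  assumes "G \<in> Form m" "\<And>v. v \<noteq> (0, 0) \<Longrightarrow> G v \<noteq> 0"
  shows "m = 0"
proof (rule ccontr)
  assume "m \<noteq> 0"
  then consider "m > 0" | "m < 0" by linarith
  then show False
  proof cases
    case 1
    show False by (rule Form_has_zero[OF assms(1) 1]) (use assms(2) in blast)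
  next
    case 2
    then show False using Form_neg[OF assms(1)] assms(2)[of "(1, 0)"] by simp
  qed
qed

text \<open>The proof splits off the linear factors of \<open>Q\<close> one by one.\<close>

lemma Form_coprime_divides:
  fixes P :: "'k::alg_closed_field \<times> 'k \<Rightarrow> 'k"
  assumes "P \<in> Form p" "Q \<in> Form (int d)" "Q \<noteq> (\<lambda>_. 0)" "A \<in> Form a" "B \<in> Form (p + a - int d)"
    and "\<And>v. v \<noteq> (0, 0) \<Longrightarrow> Q v = 0 \<Longrightarrow> P v \<noteq> 0"
    and "\<And>v. P v * A v = Q v * B v"
  obtains C where "C \<in> Form (a - int d)" "\<And>v. A v = Q v * C v"
proof -
  have "\<exists>C \<in> Form (a - int d). \<forall>v. A v = Q v * C v"
    using assms(2-)
  proof (induction d arbitrary: Q A B a)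
    case 0
    define q where "q = Q (0, 0)"
    have "Q v = q" for v unfolding q_def using 0(1) by (intro Form_0_const) simp
    then have q: "Q = (\<lambda>_. q)" "q \<noteq> 0" using 0(2) by auto
    show ?case
      using q 0(3) Form_scale[of A a "1 / q"] by (intro bexI[of _ "\<lambda>v. 1 / q * A v"]) auto
  next
    case (Suc d)
    obtain v where v: "v \<noteq> (0, 0)" "Q v = 0" 
      by (rule Form_has_zero[OF Suc(2)]) (simp, rule that)
    obtain Q' where Q': "Q' \<in> Form (int d)" "\<And>w. Q w = lin v w * Q' w"
      by (rule Form_zero_divisible[OF Suc(2) v]) (rule that, simp, assumption)
    \<comment> \<open>At a zero of \<open>Q\<close> the factor \<open>P\<close> is nonzero, so
      \<open>A\<close> vanishes there as well and the linear factor cancels from the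
      relation.\<close>
    have "A v = 0" using Suc(6)[OF v] Suc(7)[of v] v by simp
    then obtain A' where A': "A' \<in> Form (a - 1)" "\<And>w. A w = lin v w * A' w"
      by (rule Form_zero_divisible[OF Suc(4) v(1)]) (rule that)
    have 1: "(\<lambda>v. P v * A' v) \<in> Form (p + (a - 1))" by (rule Form_mult[OF assms(1) A'(1)])
    have 2: "(\<lambda>v. Q' v * B v) \<in> Form (p + (a - 1))"
      using Form_mult[OF Q'(1) Suc(5)] by (simp add: algebra_simps)
    have "(\<lambda>v. P v * A' v) = (\<lambda>v. Q' v * B v)"
      using Suc(7) A'(2) Q'(2)
      by (intro Form_cancel[OF lin_Form 1 2 lin_nonzero[OF v(1)]]) (simp add: algebra_simps)
    then have eq: "P v * A' v = Q' v * B v" for v by (rule fun_cong)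
    have ne: "Q' \<noteq> (\<lambda>_. 0)"
    proof
      assume "Q' = (\<lambda>_. 0)"
      then have "Q = (\<lambda>_. 0)" using Q'(2) by (simp add: fun_eq_iff)
      then show False using Suc(3) by blast
    qed
    have B: "B \<in> Form (p + (a - 1) - int d)" using Suc(5) by (simp add: algebra_simps)
    have "\<exists>C\<in>Form (a - 1 - int d). \<forall>v. A' v = Q' v * C v"
      by (rule Suc(1)[OF Q'(1) ne A'(1) B _ eq]) (use Suc(6) Q'(2) in simp)
    then obtain C where "C \<in> Form (a - 1 - int d)" "\<forall>v. A' v = Q' v * C v" by blast
    then show ?case using A'(2) Q'(2)
      by (intro bexI[of _ C]) (simp_all add: mult.assoc algebra_simps)
  qed
  then show thesis using that by blast
qed

section \<open>Points and open sets of the projective line\<close>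

abbreviation pt :: "'k::field \<times> 'k \<Rightarrow> 'k proj1" where "pt \<equiv> abs_proj1"

text \<open>The preimage in the punctured plane. Homogeneous functions of every degree live here,
  whereas only those of degree 0 descend to the projective line.\<close>

definition cone :: "'k::field proj1 set \<Rightarrow> ('k \<times> 'k) set" where
  "cone U = {v. v \<noteq> (0, 0) \<and> pt v \<in> U}"

lemma proj_rel_refl: "v \<noteq> (0, 0) \<Longrightarrow> proj_rel v v"
  by (auto simp: proj_rel_def intro!: exI[of _ 1])

lemma pt_surj: obtains v where "v \<noteq> (0, 0)" "p = pt v"
proof -
  have "proj_rel (rep_proj1 p) (rep_proj1 p)"
    using Quotient_rep_reflp[OF Quotient_proj1] .
  then have "rep_proj1 p \<noteq> (0, 0)" by (simp add: proj_rel_def)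
  moreover have "p = pt (rep_proj1 p)" using Quotient_abs_rep[OF Quotient_proj1] by metis
  ultimately show thesis using that by blast
qed

lemma pt_eq_iff: "v \<noteq> (0, 0) \<Longrightarrow> w \<noteq> (0, 0) \<Longrightarrow> pt v = pt w \<longleftrightarrow> proj_rel v w"
  using Quotient_rel[OF Quotient_proj1, of v w] by (simp add: proj_rel_refl)

lemma cone_nonempty: "U \<noteq> {} \<Longrightarrow> cone U \<noteq> {}"
proof -
  assume "U \<noteq> {}"
  then obtain p where p: "p \<in> U" by blast
  obtain v where "v \<noteq> (0, 0)" "p = pt v" using pt_surj .
  then have "v \<in> cone U" using p by (simp add: cone_def)
  then show "cone U \<noteq> {}" by blast
qed

lemma cone_UNIV: "cone UNIV = - {(0, 0)}"
  by (auto simp: cone_def)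

lemma cone_Int: "cone (U \<inter> V) = cone U \<inter> cone V"
  by (auto simp: cone_def)

lemma cone_mono: "U \<subseteq> V \<Longrightarrow> cone U \<subseteq> cone V"
  by (auto simp: cone_def)

lemma form_vanishes_pt [simp]: "v \<noteq> (0, 0) \<Longrightarrow> form_vanishes d c (pt v) \<longleftrightarrow> form d c (fst v) (snd v) = 0"
  using form_vanishes.abs_eq[OF proj_rel_refl] by (simp add: case_prod_unfold)

lemma form_quotient_pt [simp]:
  "v \<noteq> (0, 0) \<Longrightarrow> form_quotient d a b (pt v) = form d a (fst v) (snd v) / form d b (fst v) (snd v)"
  using form_quotient.abs_eq[OF proj_rel_refl] by (simp add: case_prod_unfold)

lemma proj_rel_Form_zero:
  assumes "proj_rel v w" "F \<in> Form m"
  shows "F v = 0 \<longleftrightarrow> F w = 0"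
  using assms(2)
proof (cases rule: Form_cases)
  case (2 n)
  obtain t where "t \<noteq> 0" "w = (t * fst v, t * snd v)" using assms(1) by (auto simp: proj_rel_def)
  then show ?thesis using Form_scale_arg[OF 2(2), of t "fst v" "snd v"] by simp
qed simp

definition nonzero_locus :: "('k::field \<times> 'k \<Rightarrow> 'k) \<Rightarrow> 'k proj1 set" where
  "nonzero_locus F = pt ` {v. v \<noteq> (0, 0) \<and> F v \<noteq> 0}"

lemma cone_nonzero_locus:
  assumes "F \<in> Form m"
  shows "v \<in> cone (nonzero_locus F) \<longleftrightarrow> v \<noteq> (0, 0) \<and> F v \<noteq> 0"
proof
  assume "v \<in> cone (nonzero_locus F)"
  then obtain w where w: "v \<noteq> (0, 0)" "w \<noteq> (0, 0)" "F w \<noteq> 0" "pt v = pt w"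
    by (auto simp: cone_def nonzero_locus_def)
  then show "v \<noteq> (0, 0) \<and> F v \<noteq> 0"
    using proj_rel_Form_zero[OF _ assms] pt_eq_iff by blast
qed (auto simp: cone_def nonzero_locus_def)

lemma open_nonzero_locus:
  fixes F :: "'k::field \<times> 'k \<Rightarrow> 'k"
  assumes "F \<in> Form m"
  shows "open (nonzero_locus F)"
  using assms
proof (cases rule: Form_cases)
  case 1
  then show ?thesis by (simp add: nonzero_locus_def)
next
  case (2 n)
  obtain c where c: "F = (\<lambda>(x, y). form n c x y)" using Form_E[OF 2(2)] .
  have "- nonzero_locus F = {p. \<forall>(d, c) \<in> {(n, c)}. form_vanishes d c p}"
  proof (intro Set.set_eqI)
    fix p :: "'k proj1"
    obtain v where v: "v \<noteq> (0, 0)" "p = pt v" using pt_surj .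
    have "p \<in> nonzero_locus F \<longleftrightarrow> F v \<noteq> 0"
      using cone_nonzero_locus[OF assms, of v] v by (simp add: cone_def)
    then show "p \<in> - nonzero_locus F \<longleftrightarrow> p \<in> {p. \<forall>(d, c) \<in> {(n, c)}. form_vanishes d c p}"
      using v by (simp add: c case_prod_unfold)
  qed
  then show ?thesis unfolding open_proj1_def by blast
qed

text \<open>A point outside a closed set is missed by one of its equations, so the nonvanishing loci
  of single forms are a basis of the topology.\<close>

lemma open_basic:
  fixes U :: "'k::field proj1 set"
  assumes "open U" "v \<in> cone U"
  obtains m F where "F \<in> Form m" "F v \<noteq> 0" "nonzero_locus F \<subseteq> U"
proof -
  obtain S where S: "- U = {p. \<forall>(d, c) \<in> S. form_vanishes d c p}"
    using assms(1) unfolding open_proj1_def by blast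
  have v: "v \<noteq> (0, 0)" "pt v \<notin> - U" using assms(2) by (auto simp: cone_def)
  then obtain d c where dc: "(d, c) \<in> S" "\<not> form_vanishes d c (pt v)"
    unfolding S by auto
  show thesis
  proof (rule that)
    show "(\<lambda>(x, y). form d c x y) \<in> Form (int d)" by (rule form_in_Form)
    show "(\<lambda>(x, y). form d c x y) v \<noteq> 0" using dc v by (simp add: case_prod_unfold)
    show "nonzero_locus (\<lambda>(x, y). form d c x y) \<subseteq> U"
    proof
      fix p assume "p \<in> nonzero_locus (\<lambda>(x, y). form d c x y)"
      moreover obtain w where "w \<noteq> (0, 0)" "p = pt w" using pt_surj .
      ultimately have "w \<noteq> (0, 0)" "p = pt w" "form d c (fst w) (snd w) \<noteq> 0"
        using cone_nonzero_locus[OF form_in_Form, of w d c] by (simp_all add: cone_def case_prod_unfold)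
      then have "p \<notin> - U" unfolding S using dc by auto
      then show "p \<in> U" by simp
    qed
  qed
qed

text \<open>Irreducibility of the projective line, from the absence of zero divisors among
  forms.\<close>

lemma open_Int_nonempty:
  fixes U V :: "'k::alg_closed_field proj1 set"
  assumes "open U" "open V" "U \<noteq> {}" "V \<noteq> {}"
  shows "U \<inter> V \<noteq> {}"
proof -
  obtain v w where vw: "v \<in> cone U" "w \<in> cone V"
    using cone_nonempty[OF assms(3)] cone_nonempty[OF assms(4)] by blast
  obtain m F where F: "F \<in> Form m" "F v \<noteq> 0" "nonzero_locus F \<subseteq> U"
    using open_basic[OF assms(1) vw(1)] .
  obtain n G where G: "G \<in> Form n" "G w \<noteq> 0" "nonzero_locus G \<subseteq> V"
    using open_basic[OF assms(2) vw(2)] .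
  have "F \<noteq> (\<lambda>_. 0)" "G \<noteq> (\<lambda>_. 0)" using F(2) G(2) by auto
  then obtain u where u: "u \<noteq> (0, 0)" "F u * G u \<noteq> 0"
    using Form_nonzero_point[OF Form_mult[OF F(1) G(1)] Form_mult_nonzero[OF F(1) G(1)]] by blast
  then have "pt u \<in> nonzero_locus F" "pt u \<in> nonzero_locus G"
    unfolding nonzero_locus_def by simp_all
  then show ?thesis using F G by blast
qed

text \<open>Multiplied by a form \<open>H\<close> whose nonvanishing locus lies in \<open>U\<close>,
  the form vanishes everywhere; \<open>H\<close> is then cancelled.\<close>

lemma Form_vanishes_on_open:
  fixes F :: "'k::alg_closed_field \<times> 'k \<Rightarrow> 'k"
  assumes F: "F \<in> Form m" and U: "open U" "U \<noteq> {}" and 0: "\<And>v. v \<in> cone U \<Longrightarrow> F v = 0"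
  shows "F = (\<lambda>_. 0)"
proof -
  obtain v where v: "v \<in> cone U" using cone_nonempty[OF U(2)] by blast
  obtain n H where H: "H \<in> Form n" "H v \<noteq> 0" "nonzero_locus H \<subseteq> U"
    using open_basic[OF U(1) v] .
  have "F w * H w = 0" if "w \<noteq> (0, 0)" for w
  proof (cases "H w = 0")
    case False
    then have "w \<in> cone U" using H that by (auto simp: nonzero_locus_def cone_def)
    then show ?thesis using 0 by simp
  qed simp
  then have "(\<lambda>w. F w * H w) = (\<lambda>_. 0)"
    by (intro Form_eq_zero[OF Form_mult[OF F H(1)]]) simp
  then show ?thesis using Form_mult_nonzero[OF F H(1)] H(2) by auto
qed

section \<open>Regular homogeneous functions\<close>

text \<open>
  \<open>hreg a U s\<close>: \<open>s\<close> is a section of \<open>\<O>(a)\<close> over \<open>U\<close>, viewed as a homogeneous function of degree \<open>a\<close> on the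
  cone over \<open>U\<close>. On the projective line one fraction serves for all of \<open>U\<close> (see \<open>hreg_local\<close>).
\<close>

definition hreg :: "int \<Rightarrow> 'k::alg_closed_field proj1 set \<Rightarrow> ('k \<times> 'k \<Rightarrow> 'k) \<Rightarrow> bool" where
  "hreg a U s \<longleftrightarrow> (\<exists>e. \<exists>F\<in>Form (a + e). \<exists>G\<in>Form e. \<forall>v\<in>cone U. G v \<noteq> 0 \<and> s v = F v / G v)"

lemma hregI:
  assumes "F \<in> Form (a + e)" "G \<in> Form e" "\<And>v. v \<in> cone U \<Longrightarrow> G v \<noteq> 0"
    "\<And>v. v \<in> cone U \<Longrightarrow> s v = F v / G v"
  shows "hreg a U s"
  using assms unfolding hreg_def by blast

lemma hregE:
  assumes "hreg a U s"
  obtains e F G where "F \<in> Form (a + e)" "G \<in> Form e" "\<forall>v\<in>cone U. G v \<noteq> 0" "\<forall>v\<in>cone U. s v = F v / G v"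
  using assms unfolding hreg_def by blast

lemma hreg_mono: "hreg a U s \<Longrightarrow> V \<subseteq> U \<Longrightarrow> hreg a V s"
  unfolding hreg_def using cone_mono by (meson subsetD)

lemma hreg_cong: "(\<And>v. v \<in> cone U \<Longrightarrow> s v = t v) \<Longrightarrow> hreg a U s \<longleftrightarrow> hreg a U t"
  unfolding hreg_def by simp

lemma hreg_Form: "F \<in> Form a \<Longrightarrow> hreg a U F"
  by (rule hregI[where e = 0 and F = F and G = "\<lambda>_. 1"]) auto

lemma hreg_zero [simp]: "hreg a U (\<lambda>_. 0)"
  by (rule hreg_Form) simp

lemma hreg_const [simp]: "hreg 0 U (\<lambda>_. c)"
  by (rule hreg_Form) simp

lemma hreg_mult:
  assumes "hreg a U s" "hreg b U t"
  shows "hreg (a + b) U (\<lambda>v. s v * t v)"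
proof -
  obtain e F G where 1: "F \<in> Form (a + e)" "G \<in> Form e" "\<forall>v\<in>cone U. G v \<noteq> 0" "\<forall>v\<in>cone U. s v = F v / G v"
    by (rule hregE[OF assms(1)])
  obtain e' F' G' where 2: "F' \<in> Form (b + e')" "G' \<in> Form e'" "\<forall>v\<in>cone U. G' v \<noteq> 0" "\<forall>v\<in>cone U. t v = F' v / G' v"
    by (rule hregE[OF assms(2)])
  show ?thesis
  proof (rule hregI)
    show "(\<lambda>v. F v * F' v) \<in> Form (a + b + (e + e'))"
      using Form_mult[OF 1(1) 2(1)] by (simp add: algebra_simps)
    show "(\<lambda>v. G v * G' v) \<in> Form (e + e')" by (rule Form_mult[OF 1(2) 2(2)])
  qed (use 1 2 in simp_all)
qed

lemma hreg_add:
  assumes "hreg a U s" "hreg a U t"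
  shows "hreg a U (\<lambda>v. s v + t v)"
proof -
  obtain e F G where 1: "F \<in> Form (a + e)" "G \<in> Form e" "\<forall>v\<in>cone U. G v \<noteq> 0" "\<forall>v\<in>cone U. s v = F v / G v"
    by (rule hregE[OF assms(1)])
  obtain e' F' G' where 2: "F' \<in> Form (a + e')" "G' \<in> Form e'" "\<forall>v\<in>cone U. G' v \<noteq> 0" "\<forall>v\<in>cone U. t v = F' v / G' v"
    by (rule hregE[OF assms(2)])
  show ?thesis
  proof (rule hregI)
    have "(\<lambda>v. F v * G' v) \<in> Form (a + (e + e'))"
      using Form_mult[OF 1(1) 2(2)] by (simp add: algebra_simps)
    moreover have "(\<lambda>v. F' v * G v) \<in> Form (a + (e + e'))"
      using Form_mult[OF 2(1) 1(2)] by (simp add: algebra_simps)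
    ultimately show "(\<lambda>v. F v * G' v + F' v * G v) \<in> Form (a + (e + e'))" by (rule Form_add)
    show "(\<lambda>v. G v * G' v) \<in> Form (e + e')" by (rule Form_mult[OF 1(2) 2(2)])
  qed (use 1 2 in \<open>simp_all add: field_simps\<close>)
qed

lemma hreg_sum: "(\<And>i. i \<in> I \<Longrightarrow> hreg a U (s i)) \<Longrightarrow> hreg a U (\<lambda>v. \<Sum>i\<in>I. s i v)"
  by (induction I rule: infinite_finite_induct) (auto intro: hreg_add)

lemma hreg_prod: "(\<And>i. i \<in> I \<Longrightarrow> hreg (a i) U (s i)) \<Longrightarrow> hreg (\<Sum>i\<in>I. a i) U (\<lambda>v. \<Prod>i\<in>I. s i v)"
  by (induction I rule: infinite_finite_induct) (auto intro: hreg_mult)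

lemma hreg_scale: "hreg a U s \<Longrightarrow> hreg a U (\<lambda>v. c * s v)"
  using hreg_mult[OF hreg_const] by simp

lemma hreg_inverse:
  assumes "hreg a U s" "\<And>v. v \<in> cone U \<Longrightarrow> s v \<noteq> 0"
  shows "hreg (- a) U (\<lambda>v. 1 / s v)"
proof -
  obtain e F G where 1: "F \<in> Form (a + e)" "G \<in> Form e" "\<forall>v\<in>cone U. G v \<noteq> 0" "\<forall>v\<in>cone U. s v = F v / G v"
    by (rule hregE[OF assms(1)])
  show ?thesis
  proof (rule hregI)
    show "G \<in> Form (- a + (a + e))" using 1 by simp
    show "F \<in> Form (a + e)" using 1 by simp
    show "F v \<noteq> 0" if "v \<in> cone U" for v using assms(2)[OF that] 1 that by auto
  qed (use 1 in simp)
qed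

lemma hreg_divide:
  assumes "hreg a U s" "hreg b U t" "\<And>v. v \<in> cone U \<Longrightarrow> t v \<noteq> 0"
  shows "hreg (a - b) U (\<lambda>v. s v / t v)"
  using hreg_mult[OF assms(1) hreg_inverse[OF assms(2,3)]] by simp

text \<open>Identity theorem: after cross-multiplication the difference is a form vanishing on a
  nonempty open set.\<close>

lemma hreg_eqI:
  assumes "hreg a U s" "hreg a U t" "open V" "V \<noteq> {}" "V \<subseteq> U"
    and eq: "\<And>v. v \<in> cone V \<Longrightarrow> s v = t v" and v: "v \<in> cone U"
  shows "s v = t v"
proof -
  obtain e F G where 1: "F \<in> Form (a + e)" "G \<in> Form e" "\<forall>v\<in>cone U. G v \<noteq> 0" "\<forall>v\<in>cone U. s v = F v / G v"
    by (rule hregE[OF assms(1)])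
  obtain e' F' G' where 2: "F' \<in> Form (a + e')" "G' \<in> Form e'" "\<forall>v\<in>cone U. G' v \<noteq> 0" "\<forall>v\<in>cone U. t v = F' v / G' v"
    by (rule hregE[OF assms(2)])
  have "(\<lambda>v. F v * G' v - F' v * G v) = (\<lambda>_. 0)"
  proof (rule Form_vanishes_on_open[OF _ assms(3,4)])
    show "(\<lambda>v. F v * G' v - F' v * G v) \<in> Form (a + e + e')"
      using Form_diff[OF Form_mult[OF 1(1) 2(2)]] Form_mult[OF 2(1) 1(2)] by (simp add: algebra_simps)
    fix w assume w: "w \<in> cone V"
    then have "w \<in> cone U" using cone_mono[OF assms(5)] by blast
    then have "G w \<noteq> 0" "G' w \<noteq> 0" "F w / G w = F' w / G' w"
      using 1 2 eq[OF w] by auto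
    then show "F w * G' w - F' w * G w = 0" by (simp add: field_simps)
  qed
  from fun_cong[OF this, of v] have "F v * G' v = F' v * G v" by simp
  moreover have "G v \<noteq> 0" "G' v \<noteq> 0" using 1 2 v by auto
  ultimately have "F v / G v = F' v / G' v" by (simp add: field_simps)
  then show ?thesis using 1 2 v by auto
qed

text \<open>Common zeros are split off by the factor theorem, and the degree of the denominator
  bounds the number of steps; \<open>K\<close> collects the removed factors.\<close>

lemma Form_reduce_fraction:
  fixes F :: "'k::alg_closed_field \<times> 'k \<Rightarrow> 'k"
  assumes "F \<in> Form (a + e)" "G \<in> Form e" "G \<noteq> (\<lambda>_. 0)"
  shows "\<exists>e'. \<exists>F'\<in>Form (a + e'). \<exists>G'\<in>Form e'. \<exists>K. (\<forall>v. F v = K v * F' v \<and> G v = K v * G' v) \<and>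
    (\<forall>v. v \<noteq> (0, 0) \<longrightarrow> G' v = 0 \<longrightarrow> F' v \<noteq> 0)"
proof -
  obtain n where "e = int n" using assms(2,3) by (meson Form_cases)
  with assms show ?thesis
  proof (induction n arbitrary: e F G)
    case 0
    then obtain v where "G v \<noteq> 0" by (auto simp: fun_eq_iff)
    then have "G w \<noteq> 0" for w using Form_0_const[of G w v] 0 by simp
    then show ?case using 0
      by (intro exI[of _ e] bexI[of _ F] bexI[of _ G] exI[of _ "\<lambda>_. 1"]) auto
  next
    case (Suc n)
    show ?case
    proof (cases "\<exists>v. v \<noteq> (0, 0) \<and> G v = 0 \<and> F v = 0")
      case False
      then show ?thesis using Suc
        by (intro exI[of _ e] bexI[of _ F] bexI[of _ G] exI[of _ "\<lambda>_. 1"]) auto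
    next
      case True
      then obtain v where v: "v \<noteq> (0, 0)" "G v = 0" "F v = 0" by blast
      obtain F1 where F1: "F1 \<in> Form (a + e - 1)" "\<And>w. F w = lin v w * F1 w"
        by (rule Form_zero_divisible[OF Suc.prems(1) v(1,3)]) (rule that)
      obtain G1 where G1: "G1 \<in> Form (e - 1)" "\<And>w. G w = lin v w * G1 w"
        by (rule Form_zero_divisible[OF Suc.prems(2) v(1,2)]) (rule that)
      have "G1 \<noteq> (\<lambda>_. 0)" using Suc.prems(3) G1(2) by (auto simp: fun_eq_iff)
      moreover have "F1 \<in> Form (a + (e - 1))" using F1 by (simp add: algebra_simps)
      ultimately have "\<exists>e'. \<exists>F'\<in>Form (a + e'). \<exists>G'\<in>Form e'. \<exists>K.
          (\<forall>v. F1 v = K v * F' v \<and> G1 v = K v * G' v) \<and>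
          (\<forall>v. v \<noteq> (0, 0) \<longrightarrow> G' v = 0 \<longrightarrow> F' v \<noteq> 0)"
        using Suc.IH[OF _ G1(1)] Suc.prems(4) by simp
      then obtain e' F' G' K where *: "F' \<in> Form (a + e')" "G' \<in> Form e'"
        "\<forall>v. F1 v = K v * F' v \<and> G1 v = K v * G' v"
        "\<forall>v. v \<noteq> (0, 0) \<longrightarrow> G' v = 0 \<longrightarrow> F' v \<noteq> 0" by blast
      show ?thesis
        by (intro exI[of _ e'] bexI[OF _ *(1)] bexI[OF _ *(2)] exI[of _ "\<lambda>w. lin v w * K w"])
          (use * F1 G1 in \<open>simp add: mult.assoc\<close>)
    qed
  qed
qed

text \<open>A fraction in lowest terms found near one point serves everywhere. Against another local
  fraction F1/G1 the identity F1 G0 = F0 G1 holds on the whole plane, so a zero of G0 where G1 is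
  nonzero would be a zero of F0 as well.\<close>

lemma hreg_local:
  assumes U: "open U"
    and loc: "\<And>v. v \<in> cone U \<Longrightarrow> \<exists>V. open V \<and> v \<in> cone V \<and> hreg a V s"
  shows "hreg a U s"
proof (cases "U = {}")
  case True
  then show ?thesis
    by (intro hregI[of "\<lambda>_. 0" a 0 "\<lambda>_. 1"]) (auto simp: cone_def)
next
  case False
  then obtain v0 where v0: "v0 \<in> cone U" using cone_nonempty by blast
  then obtain V0 where V0: "open V0" "v0 \<in> cone V0" "hreg a V0 s" using loc by blast
  obtain e F G where FG: "F \<in> Form (a + e)" "G \<in> Form e"
    "\<forall>v\<in>cone V0. G v \<noteq> 0" "\<forall>v\<in>cone V0. s v = F v / G v"
    by (rule hregE[OF V0(3)])
  then have "G \<noteq> (\<lambda>_. 0)" using V0(2) by auto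
  then obtain e0 F0 G0 K where 0: "F0 \<in> Form (a + e0)" "G0 \<in> Form e0"
    "\<forall>v. F v = K v * F0 v \<and> G v = K v * G0 v" "\<forall>v. v \<noteq> (0, 0) \<longrightarrow> G0 v = 0 \<longrightarrow> F0 v \<noteq> 0"
    using Form_reduce_fraction[OF FG(1,2)] by blast
  have s0: "G0 v \<noteq> 0" "s v = F0 v / G0 v" if "v \<in> cone V0" for v
  proof -
    have "F v = K v * F0 v" "G v = K v * G0 v" using 0(3) by blast+
    moreover have "G v \<noteq> 0" "s v = F v / G v" using FG(3,4) that by blast+
    ultimately show "G0 v \<noteq> 0" "s v = F0 v / G0 v" by auto
  qed
  have "G0 v \<noteq> 0 \<and> s v = F0 v / G0 v" if v: "v \<in> cone U" for v
  proof -
    obtain V where V: "open V" "v \<in> cone V" "hreg a V s" using loc[OF v] by blast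
    obtain e1 F1 G1 where 1: "F1 \<in> Form (a + e1)" "G1 \<in> Form e1"
      "\<forall>v\<in>cone V. G1 v \<noteq> 0" "\<forall>v\<in>cone V. s v = F1 v / G1 v"
      by (rule hregE[OF V(3)])
    have "V \<noteq> {}" "V0 \<noteq> {}" using V V0 by (auto simp: cone_def)
    then have VV: "V \<inter> V0 \<noteq> {}" using open_Int_nonempty V V0 by blast
    have "(\<lambda>v. F1 v * G0 v - F0 v * G1 v) = (\<lambda>_. 0)"
    proof (rule Form_vanishes_on_open[OF _ open_Int[OF V(1) V0(1)] VV])
      show "(\<lambda>v. F1 v * G0 v - F0 v * G1 v) \<in> Form (a + e1 + e0)"
        using Form_diff[OF Form_mult[OF 1(1) 0(2)]] Form_mult[OF 0(1) 1(2)] by (simp add: algebra_simps)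
      fix w assume "w \<in> cone (V \<inter> V0)"
      then have "w \<in> cone V" "w \<in> cone V0" by (auto simp: cone_def)
      then have "G1 w \<noteq> 0" "G0 w \<noteq> 0" "F1 w / G1 w = F0 w / G0 w"
        using 1 s0[of w] by auto
      then show "F1 w * G0 w - F0 w * G1 w = 0" by (simp add: field_simps)
    qed
    from fun_cong[OF this, of v] have eq: "F1 v * G0 v = F0 v * G1 v" by simp
    have G1: "G1 v \<noteq> 0" "s v = F1 v / G1 v" using 1 V by auto
    have "G0 v \<noteq> 0"
    proof
      assume "G0 v = 0"
      then have "F0 v = 0" using eq G1 by simp
      moreover have "v \<noteq> (0, 0)" using v by (simp add: cone_def)
      ultimately show False using 0(4) \<open>G0 v = 0\<close> by blast
    qed
    moreover from this have "F1 v / G1 v = F0 v / G0 v" using eq G1 by (simp add: frac_eq_eq)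
    ultimately show ?thesis using G1 by simp
  qed
  then show ?thesis using hregI[OF 0(1,2)] by blast
qed

text \<open>Local fractions are merged into one by \<open>hreg_local\<close>. Conversely a single
  fraction serves at every point; its degree is a natural number because the denominator is
  nonzero.\<close>

lemma regular_on_iff_hreg:
  assumes "open U"
  shows "regular_on U g \<longleftrightarrow> hreg 0 U (\<lambda>v. g (pt v))"
proof
  assume g: "regular_on U g"
  show "hreg 0 U (\<lambda>v. g (pt v))"
  proof (rule hreg_local[OF assms])
    fix v assume "v \<in> cone U"
    then have v: "v \<noteq> (0, 0)" "pt v \<in> U" by (auto simp: cone_def)
    from bspec[OF g[unfolded regular_on_def] v(2)]
    obtain V d a b where V: "open V" "pt v \<in> V" "V \<subseteq> U"
      "\<forall>q\<in>V. \<not> form_vanishes d b q \<and> g q = form_quotient d a b q"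
      by (elim exE conjE)
    have "hreg 0 V (\<lambda>v. g (pt v))"
    proof (rule hregI[where e = "int d"])
      show "(\<lambda>(x, y). form d a x y) \<in> Form (0 + int d)" "(\<lambda>(x, y). form d b x y) \<in> Form (int d)"
        using form_in_Form by simp_all
    next
      fix w assume "w \<in> cone V"
      then have w: "w \<noteq> (0, 0)" "pt w \<in> V" by (auto simp: cone_def)
      then have *: "\<not> form_vanishes d b (pt w)" "g (pt w) = form_quotient d a b (pt w)"
        using V(4) by auto
      show "(\<lambda>(x, y). form d b x y) w \<noteq> 0"
        using *(1) w(1) by (simp add: case_prod_unfold)
      show "g (pt w) = (\<lambda>(x, y). form d a x y) w / (\<lambda>(x, y). form d b x y) w"
        unfolding *(2) using w(1) by (simp add: case_prod_unfold)
    qed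
    then show "\<exists>V. open V \<and> v \<in> cone V \<and> hreg 0 V (\<lambda>v. g (pt v))"
      using V v by (auto simp: cone_def)
  qed
next
  assume "hreg 0 U (\<lambda>v. g (pt v))"
  then obtain e F G where FG: "F \<in> Form (0 + e)" "G \<in> Form e" "\<forall>v\<in>cone U. G v \<noteq> 0"
    "\<forall>v\<in>cone U. g (pt v) = F v / G v"
    by (rule hregE)
  show "regular_on U g"
    unfolding regular_on_def
  proof
    fix p assume p: "p \<in> U"
    then have "cone U \<noteq> {}" using cone_nonempty by blast
    then have "G \<noteq> (\<lambda>_. 0)" using FG by auto
    then obtain d where d: "e = int d" using FG(2) by (meson Form_cases)
    obtain a where a: "F = (\<lambda>(x, y). form d a x y)" using Form_E[of F d] FG(1) d by auto
    obtain b where b: "G = (\<lambda>(x, y). form d b x y)" using Form_E[of G d] FG(2) d by auto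
    have "\<not> form_vanishes d b q \<and> g q = form_quotient d a b q" if "q \<in> U" for q
    proof -
      obtain v where v: "v \<noteq> (0, 0)" "q = pt v" using pt_surj .
      then have "v \<in> cone U" using that by (simp add: cone_def)
      then have "G v \<noteq> 0" "g (pt v) = F v / G v" using FG by auto
      then show ?thesis using v by (simp add: a b case_prod_unfold)
    qed
    then show "\<exists>V d a b. open V \<and> p \<in> V \<and> V \<subseteq> U \<and> (\<forall>q\<in>V. \<not> form_vanishes d b q \<and> g q = form_quotient d a b q)"
      using assms p by blast
  qed
qed

text \<open>Numerator and denominator pick up the same power of the scaling factor.\<close>

lemma hreg_0_same_point:
  assumes "hreg 0 U s" "v \<in> cone U" "w \<in> cone U" "pt v = pt w"
  shows "s v = s w"
proof -
  obtain e F G where FG: "F \<in> Form (0 + e)" "G \<in> Form e" "\<forall>v\<in>cone U. G v \<noteq> 0" "\<forall>v\<in>cone U. s v = F v / G v"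
    by (rule hregE[OF assms(1)])
  have "G \<noteq> (\<lambda>_. 0)" using FG assms(2) by auto
  then obtain d where d: "e = int d" using FG(2) by (meson Form_cases)
  have "proj_rel v w" using assms pt_eq_iff[of v w] by (simp add: cone_def)
  then obtain t where t: "t \<noteq> 0" "w = (t * fst v, t * snd v)" by (auto simp: proj_rel_def)
  have "F w = t ^ d * F v" "G w = t ^ d * G v"
    using Form_scale_arg[of F d t "fst v" "snd v"] Form_scale_arg[of G d t "fst v" "snd v"] FG(1,2) t(2) d
    by simp_all
  then show ?thesis using FG(4) assms(2,3) t(1) by simp
qed

text \<open>Evaluation at an arbitrary representative, which is well defined in degree 0 by
  \<open>hreg_0_same_point\<close>. The result is extensional because sections of the structure
  sheaf are.\<close>

definition desc :: "'k::field proj1 set \<Rightarrow> ('k \<times> 'k \<Rightarrow> 'k) \<Rightarrow> 'k proj1 \<Rightarrow> 'k" where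
  "desc U s = (\<lambda>p\<in>U. s (SOME v. v \<noteq> (0, 0) \<and> p = pt v))"

lemma desc_extensional [simp]: "desc U s \<in> extensional U"
  by (simp add: desc_def)

lemma desc_pt:
  assumes "hreg 0 U s" "v \<in> cone U"
  shows "desc U s (pt v) = s v"
proof -
  define w where "w = (SOME w. w \<noteq> (0, 0) \<and> pt v = pt w)"
  have "v \<noteq> (0, 0) \<and> pt v = pt v" using assms(2) by (simp add: cone_def)
  from someI[where P = "\<lambda>w. w \<noteq> (0, 0) \<and> pt v = pt w", OF this]
  have w: "w \<noteq> (0, 0)" "pt v = pt w" unfolding w_def by blast+
  then have "w \<in> cone U" using assms(2) by (simp add: cone_def)
  then have "s v = s w" using hreg_0_same_point[OF assms _ w(2)] by blast
  moreover have "pt v \<in> U" using assms(2) by (simp add: cone_def)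
  ultimately show ?thesis by (simp add: desc_def w_def)
qed

lemma desc_regular:
  assumes "open U" "hreg 0 U s"
  shows "regular_on U (desc U s)"
  unfolding regular_on_iff_hreg[OF assms(1)]
  using assms(2) desc_pt[OF assms(2)] hreg_cong[of U "\<lambda>v. desc U s (pt v)" s] by simp

text \<open>A denominator without zeros is a constant form, so the global sections of O(a) are the
  forms of degree a.\<close>

lemma hreg_UNIV:
  fixes s :: "'k::alg_closed_field \<times> 'k \<Rightarrow> 'k"
  assumes "hreg a UNIV s"
  obtains F where "F \<in> Form a" "\<And>v. v \<noteq> (0, 0) \<Longrightarrow> s v = F v"
proof -
  obtain e F G where FG: "F \<in> Form (a + e)" "G \<in> Form e" "\<forall>v\<in>cone UNIV. G v \<noteq> 0"
    "\<forall>v\<in>cone UNIV. s v = F v / G v"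
    by (rule hregE[OF assms])
  have nz: "\<And>v. v \<noteq> (0, 0) \<Longrightarrow> G v \<noteq> 0" using FG(3) by (auto simp: cone_UNIV)
  then have e: "e = 0" using Form_nowhere_zero[OF FG(2)] by blast
  define c where "c = G (1, 0)"
  have c: "G v = c" for v unfolding c_def using FG(2) e by (intro Form_0_const) simp
  show thesis
    by (rule that[OF Form_scale[of F a "1 / c"]]) (use FG e c in \<open>auto simp: cone_UNIV\<close>)
qed

lemma hreg_common_denominator:
  assumes "finite I" "\<And>i. i \<in> I \<Longrightarrow> hreg (a i) U (s i)"
  shows "\<exists>e. \<exists>G\<in>Form e. (\<forall>v\<in>cone U. G v \<noteq> 0) \<and>
    (\<forall>i\<in>I. \<exists>F\<in>Form (a i + e). \<forall>v\<in>cone U. s i v = F v / G v)"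
  using assms
proof (induction I)
  case empty
  then show ?case by (intro exI[of _ 0] bexI[of _ "\<lambda>_. 1"]) auto
next
  case (insert j I)
  then obtain e G where G: "G \<in> Form e" "\<forall>v\<in>cone U. G v \<noteq> 0"
    "\<forall>i\<in>I. \<exists>F\<in>Form (a i + e). \<forall>v\<in>cone U. s i v = F v / G v"
    by auto
  have "hreg (a j) U (s j)" using insert.prems by blast
  then obtain e' F' G' where *: "F' \<in> Form (a j + e')" "G' \<in> Form e'" "\<forall>v\<in>cone U. G' v \<noteq> 0"
    "\<forall>v\<in>cone U. s j v = F' v / G' v"
    by (rule hregE)
  show ?case
  proof (rule exI[of _ "e + e'"], rule bexI[of _ "\<lambda>v. G v * G' v"], intro conjI ballI)
    fix i assume i: "i \<in> insert j I"
    show "\<exists>F\<in>Form (a i + (e + e')). \<forall>v\<in>cone U. s i v = F v / (G v * G' v)"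
    proof (cases "i = j")
      case True
      have "(\<lambda>v. F' v * G v) \<in> Form (a i + (e + e'))"
        using Form_mult[OF *(1) G(1)] True by (simp add: algebra_simps)
      then show ?thesis using * G True by (intro bexI[of _ "\<lambda>v. F' v * G v"]) auto
    next
      case False
      then obtain F where F: "F \<in> Form (a i + e)" "\<forall>v\<in>cone U. s i v = F v / G v" using i G by blast
      have "(\<lambda>v. F v * G' v) \<in> Form (a i + (e + e'))"
        using Form_mult[OF F(1) *(2)] by (simp add: algebra_simps)
      then show ?thesis using * G F by (intro bexI[of _ "\<lambda>v. F v * G' v"]) auto
    qed
  next
    show "G v * G' v \<noteq> 0" if "v \<in> cone U" for v using G(2) *(3) that by simp
    show "(\<lambda>v. G v * G' v) \<in> Form (e + e')" by (rule Form_mult[OF G(1) *(2)])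
  qed
qed

text \<open>The product \<open>H\<close> of all denominators works: \<open>H\<close> times
  \<open>u i\<close> is the numerator of \<open>u i\<close> times the other denominators, hence a
  form. This extends data given over one chart to all charts.\<close>

lemma hreg_clear_poles:
  assumes "finite I" "\<And>i. i \<in> I \<Longrightarrow> hreg 0 (U i \<inter> U0) (u i)" "\<And>i. i \<in> I \<Longrightarrow> U i \<inter> U0 \<noteq> {}"
  shows "\<exists>N. \<exists>H\<in>Form N. H \<noteq> (\<lambda>_. 0) \<and>
    (\<forall>i\<in>I. \<exists>h. hreg N (U i) h \<and> (\<forall>v\<in>cone (U i \<inter> U0). h v = H v * u i v))"
proof -
  have "\<forall>i\<in>I. \<exists>e F G. F \<in> Form e \<and> G \<in> Form e \<and> G \<noteq> (\<lambda>_. 0) \<and>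
    (\<forall>v\<in>cone (U i \<inter> U0). G v * u i v = F v)"
  proof
    fix i assume i: "i \<in> I"
    obtain e F G where FG: "F \<in> Form (0 + e)" "G \<in> Form e" "\<forall>v\<in>cone (U i \<inter> U0). G v \<noteq> 0"
      "\<forall>v\<in>cone (U i \<inter> U0). u i v = F v / G v"
      by (rule hregE[OF assms(2)[OF i]])
    have "cone (U i \<inter> U0) \<noteq> {}" using cone_nonempty[OF assms(3)[OF i]] .
    then have "G \<noteq> (\<lambda>_. 0)" using FG(3) by auto
    then show "\<exists>e F G. F \<in> Form e \<and> G \<in> Form e \<and> G \<noteq> (\<lambda>_. 0) \<and>
        (\<forall>v\<in>cone (U i \<inter> U0). G v * u i v = F v)"
      using FG by (intro exI[of _ e] exI[of _ F] exI[of _ G]) auto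
  qed
  from bchoice[OF this] obtain e where e: "\<forall>i\<in>I. \<exists>F G. F \<in> Form (e i) \<and> G \<in> Form (e i) \<and>
    G \<noteq> (\<lambda>_. 0) \<and> (\<forall>v\<in>cone (U i \<inter> U0). G v * u i v = F v)" by blast
  from bchoice[OF e] obtain F where F: "\<forall>i\<in>I. \<exists>G. F i \<in> Form (e i) \<and> G \<in> Form (e i) \<and>
    G \<noteq> (\<lambda>_. 0) \<and> (\<forall>v\<in>cone (U i \<inter> U0). G v * u i v = F i v)" by blast
  from bchoice[OF F] obtain G where FG': "\<forall>i\<in>I. F i \<in> Form (e i) \<and> G i \<in> Form (e i) \<and>
    G i \<noteq> (\<lambda>_. 0) \<and> (\<forall>v\<in>cone (U i \<inter> U0). G i v * u i v = F i v)" by blast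
  then have FG: "\<And>i. i \<in> I \<Longrightarrow> F i \<in> Form (e i)" "\<And>i. i \<in> I \<Longrightarrow> G i \<in> Form (e i)"
    "\<And>i. i \<in> I \<Longrightarrow> G i \<noteq> (\<lambda>_. 0)"
    "\<And>i. i \<in> I \<Longrightarrow> \<forall>v\<in>cone (U i \<inter> U0). G i v * u i v = F i v"
    by blast+
  define H where "H = (\<lambda>v. \<Prod>i\<in>I. G i v)"
  have H: "H \<in> Form (\<Sum>i\<in>I. e i)" unfolding H_def by (intro Form_prod FG)
  have "\<exists>h. hreg (\<Sum>i\<in>I. e i) (U i) h \<and> (\<forall>v\<in>cone (U i \<inter> U0). h v = H v * u i v)" if i: "i \<in> I" for i
  proof (intro exI conjI ballI)
    have "(\<lambda>v. F i v * (\<Prod>j\<in>I - {i}. G j v)) \<in> Form (e i + (\<Sum>j\<in>I - {i}. e j))"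
      using FG i by (intro Form_mult Form_prod) auto
    moreover have "e i + (\<Sum>j\<in>I - {i}. e j) = (\<Sum>i\<in>I. e i)"
      using sum.remove[OF assms(1) i, of e] by simp
    ultimately show "hreg (\<Sum>i\<in>I. e i) (U i) (\<lambda>v. F i v * (\<Prod>j\<in>I - {i}. G j v))"
      by (intro hreg_Form) simp
    fix v assume "v \<in> cone (U i \<inter> U0)"
    then have "F i v = G i v * u i v" using FG(4)[OF i] by simp
    then show "F i v * (\<Prod>j\<in>I - {i}. G j v) = H v * u i v"
      unfolding H_def using prod.remove[OF assms(1) i, of "\<lambda>i. G i v"] by simp
  qed
  then show ?thesis using H Form_prod_nonzero[of I G e] FG unfolding H_def by blast
qed

section \<open>Linear algebra of forms\<close>

text \<open>Gives access to the exchange lemma for forms viewed as functions.\<close>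

interpretation fun_vs: vector_space "\<lambda>c (F :: 'k::field \<times> 'k \<Rightarrow> 'k) v. c * F v"
  by unfold_locales (simp_all add: fun_eq_iff algebra_simps)

lemma sum_fun_apply: "(\<Sum>i\<in>I. F i) v = (\<Sum>i\<in>I. F i v)"
  by (induction I rule: infinite_finite_induct) simp_all

text \<open>Families instead of sets: a repeated member counts as a dependence, so that counting
  indices counts dimensions.\<close>

definition indep_family :: "'i set \<Rightarrow> ('i \<Rightarrow> 'k::field \<times> 'k \<Rightarrow> 'k) \<Rightarrow> bool" where
  "indep_family I u \<longleftrightarrow> (\<forall>c. (\<forall>v. (\<Sum>i\<in>I. c i * u i v) = 0) \<longrightarrow> (\<forall>i\<in>I. c i = 0))"

lemma indep_familyD:
  assumes "indep_family I u" "\<And>v. (\<Sum>i\<in>I. c i * u i v) = 0" "i \<in> I"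
  shows "c i = 0"
  using assms unfolding indep_family_def by simp

lemma indep_family_iff:
  fixes u :: "'i \<Rightarrow> 'k::field \<times> 'k \<Rightarrow> 'k"
  assumes "finite I"
  shows "indep_family I u \<longleftrightarrow> inj_on u I \<and> fun_vs.independent (u ` I)"
proof
  assume ind: "indep_family I u"
  have inj: "inj_on u I"
  proof (rule inj_onI)
    fix i j assume ij: "i \<in> I" "j \<in> I" "u i = u j"
    show "i = j"
    proof (rule ccontr)
      assume "i \<noteq> j"
      define c where "c k = (if k = i then 1 else if k = j then - 1 else 0 :: 'k)" for k
      have "(\<Sum>k\<in>I. c k * u k v) = 0" for v
      proof -
        have "(\<Sum>k\<in>I. c k * u k v) = (\<Sum>k\<in>{i, j}. c k * u k v)"
          using assms ij by (intro sum.mono_neutral_right) (auto simp: c_def)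
        then show ?thesis using \<open>i \<noteq> j\<close> ij by (simp add: c_def)
      qed
      then have "c i = 0" using indep_familyD[OF ind] ij by blast
      then show False by (simp add: c_def)
    qed
  qed
  moreover have "fun_vs.independent (u ` I)"
  proof (rule fun_vs.independent_if_scalars_zero)
    show "finite (u ` I)" using assms by simp
    fix f x assume f: "(\<Sum>x\<in>u ` I. (\<lambda>v. f x * x v)) = 0" and x: "x \<in> u ` I"
    then obtain i where i: "i \<in> I" "x = u i" by blast
    have "(\<Sum>i\<in>I. f (u i) * u i v) = 0" for v
      using fun_cong[OF f, of v] by (simp add: sum_fun_apply sum.reindex[OF inj])
    then show "f x = 0" using indep_familyD[OF ind, of "\<lambda>i. f (u i)" i] i by simp
  qed
  ultimately show "inj_on u I \<and> fun_vs.independent (u ` I)" by blast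
next
  assume *: "inj_on u I \<and> fun_vs.independent (u ` I)"
  show "indep_family I u"
    unfolding indep_family_def
  proof (intro allI impI ballI)
    fix c i assume c: "\<forall>v. (\<Sum>i\<in>I. c i * u i v) = 0" and i: "i \<in> I"
    define f where "f x = c (inv_into I u x)" for x
    have f: "f (u j) = c j" if "j \<in> I" for j using * that by (simp add: f_def)
    have "(\<Sum>x\<in>u ` I. (\<lambda>v. f x * x v)) = 0"
    proof
      fix v
      have "(\<Sum>x\<in>u ` I. (\<lambda>v. f x * x v)) v = (\<Sum>i\<in>I. f (u i) * u i v)"
        using * by (simp add: sum_fun_apply sum.reindex)
      also have "\<dots> = (\<Sum>i\<in>I. c i * u i v)" using f by (intro sum.cong) auto
      finally show "(\<Sum>x\<in>u ` I. (\<lambda>v. f x * x v)) v = 0 v" using c by simp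
    qed
    then have "f (u i) = 0"
      using * i assms fun_vs.independentD[of "u ` I" "u ` I" f "u i"] by simp
    then show "c i = 0" using f i by simp
  qed
qed

abbreviation mono2 :: "nat \<Rightarrow> nat \<Rightarrow> 'k::comm_ring_1 \<times> 'k \<Rightarrow> 'k" where
  "mono2 n i \<equiv> \<lambda>v. fst v ^ i * snd v ^ (n - i)"

lemma indep_monomials: "indep_family {..n} (mono2 n :: nat \<Rightarrow> 'k::alg_closed_field \<times> 'k \<Rightarrow> 'k)"
  unfolding indep_family_def
proof (intro allI impI ballI)
  fix c :: "nat \<Rightarrow> 'k" and i
  assume c: "\<forall>v. (\<Sum>i\<le>n. c i * mono2 n i v) = 0" and i: "i \<in> {..n}"
  have "(\<Sum>i\<le>n. monom (c i) i) = 0"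
  proof (rule poly_zero_fun)
    fix x show "poly (\<Sum>i\<le>n. monom (c i) i) x = 0"
      using c[rule_format, of "(x, 1)"] by (simp add: poly_sum poly_monom)
  qed
  then have "coeff (\<Sum>i\<le>n. monom (c i) i) i = 0" by simp
  then show "c i = 0" using i by (simp add: coeff_sum)
qed

lemma Form_span_monomials: "Form (int n) \<subseteq> fun_vs.span (mono2 n ` {..n})"
proof
  fix F :: "'a \<times> 'a \<Rightarrow> 'a" assume "F \<in> Form (int n)"
  then obtain c where c: "\<And>v. F v = (\<Sum>i\<le>n. c i * fst v ^ i * snd v ^ (n - i))"
    by (rule Form_monomials) (rule that)
  have "F = (\<Sum>i\<le>n. (\<lambda>v. c i * mono2 n i v))"
    by (rule ext) (simp add: c sum_fun_apply mult.assoc)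
  also have "\<dots> \<in> fun_vs.span (mono2 n ` {..n})"
    by (intro fun_vs.span_sum fun_vs.span_scale fun_vs.span_base) simp
  finally show "F \<in> fun_vs.span (mono2 n ` {..n})" .
qed

text \<open>Exchange against the monomials in both directions gives exactly n + 1 members, the
  dimension of the space of forms of degree n.\<close>

lemma Form_extend_to_basis:
  fixes u :: "'i \<Rightarrow> 'k::alg_closed_field \<times> 'k \<Rightarrow> 'k"
  assumes "finite I" "indep_family I u" "\<And>i. i \<in> I \<Longrightarrow> u i \<in> Form (int n)"
  obtains B where "u ` I \<subseteq> B" "B \<subseteq> Form (int n)" "fun_vs.independent B" "Form (int n) \<subseteq> fun_vs.span B"
    "finite B" "card B = n + 1"
proof -
  have "u ` I \<subseteq> Form (int n)" "fun_vs.independent (u ` I)"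
    using assms indep_family_iff[of I u] by auto
  then obtain B where B: "u ` I \<subseteq> B" "B \<subseteq> Form (int n)" "fun_vs.independent B"
    "Form (int n) \<subseteq> fun_vs.span B"
    by (rule fun_vs.maximal_independent_subset_extend)
  let ?T = "mono2 n ` {..n} :: ('k \<times> 'k \<Rightarrow> 'k) set"
  have T: "inj_on (mono2 n :: nat \<Rightarrow> 'k \<times> 'k \<Rightarrow> 'k) {..n}" "fun_vs.independent ?T"
    using indep_monomials[of n] indep_family_iff[of "{..n}" "mono2 n :: nat \<Rightarrow> 'k \<times> 'k \<Rightarrow> 'k"] by auto
  have cT: "card ?T = n + 1" using card_image[OF T(1)] by simp
  have 1: "finite B \<and> card B \<le> card ?T"
    using B(2) Form_span_monomials[of n] by (intro fun_vs.independent_span_bound[OF _ B(3)]) auto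
  have "?T \<subseteq> Form (int n)" using monomial_Form by auto
  then have "card ?T \<le> card B"
    using fun_vs.independent_span_bound[OF _ T(2), of B] 1 B(4) by auto
  then have "card B = n + 1" using 1 cT by simp
  then show thesis using that B 1 by blast
qed

lemma indep_family_extend:
  fixes u :: "'i \<Rightarrow> 'k::alg_closed_field \<times> 'k \<Rightarrow> 'k"
  assumes I: "finite I" "indep_family I u" "\<And>i. i \<in> I \<Longrightarrow> u i \<in> Form (int n)"
    and J: "finite J" "I \<inter> J = {}" "card I + card J = n + 1"
  shows "\<exists>w. (\<forall>j\<in>J. w j \<in> Form (int n)) \<and> indep_family (I \<union> J) (\<lambda>i. if i \<in> I then u i else w i)"
proof -
  obtain B where B: "u ` I \<subseteq> B" "B \<subseteq> Form (int n)" "fun_vs.independent B"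
    "Form (int n) \<subseteq> fun_vs.span B" "finite B" "card B = n + 1"
    using Form_extend_to_basis[OF I] .
  have inj: "inj_on u I" using I indep_family_iff by blast
  have "card (B - u ` I) = card J"
    using B J card_image[OF inj] I(1) by (simp add: card_Diff_subset)
  then obtain w where w: "bij_betw w J (B - u ` I)"
    using J B by (metis finite_Diff finite_same_card_bij)
  let ?u = "\<lambda>i. if i \<in> I then u i else w i"
  have 1: "bij_betw ?u I (u ` I)"
    using inj_on_imp_bij_betw[OF inj] bij_betw_cong[of I ?u u "u ` I"] by simp
  have "\<And>j. j \<in> J \<Longrightarrow> ?u j = w j" using J(2) by auto
  then have 2: "bij_betw ?u J (B - u ` I)" using w bij_betw_cong[of J ?u w] by simp
  have "bij_betw ?u (I \<union> J) (u ` I \<union> (B - u ` I))"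
    by (rule bij_betw_combine[OF 1 2]) auto
  moreover have "u ` I \<union> (B - u ` I) = B" using B by blast
  ultimately have "inj_on ?u (I \<union> J)" "?u ` (I \<union> J) = B" by (auto simp: bij_betw_def)
  then have "indep_family (I \<union> J) ?u"
    using indep_family_iff[of "I \<union> J" ?u] I J B by simp
  moreover have "\<forall>j\<in>J. w j \<in> Form (int n)"
    using w B by (auto simp: bij_betw_def)
  ultimately show ?thesis by blast
qed

lemma indep_family_spans:
  fixes u :: "'i \<Rightarrow> 'k::alg_closed_field \<times> 'k \<Rightarrow> 'k"
  assumes I: "finite I" "indep_family I u" "\<And>i. i \<in> I \<Longrightarrow> u i \<in> Form (int n)"
    and card: "card I = n + 1" and F: "F \<in> Form (int n)"
  shows "\<exists>c. \<forall>v. F v = (\<Sum>i\<in>I. c i * u i v)"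
proof -
  obtain B where B: "u ` I \<subseteq> B" "B \<subseteq> Form (int n)" "fun_vs.independent B"
    "Form (int n) \<subseteq> fun_vs.span B" "finite B" "card B = n + 1"
    using Form_extend_to_basis[OF I] .
  have inj: "inj_on u I" using I indep_family_iff by blast
  have "u ` I = B" using B card card_image[OF inj] by (intro card_subset_eq) auto
  then have "F \<in> fun_vs.span (u ` I)" using B F by blast
  then obtain c where c: "F = (\<Sum>x\<in>u ` I. (\<lambda>v. c x * x v))"
    using fun_vs.span_finite[of "u ` I"] I(1) by auto
  have "F v = (\<Sum>i\<in>I. c (u i) * u i v)" for v
    unfolding c by (simp add: sum_fun_apply sum.reindex[OF inj])
  then show ?thesis by (intro exI[of _ "\<lambda>i. c (u i)"]) blast
qed

text \<open>The value at (1, 0) is the coefficient of x^k; what remains vanishes at (1, 0) and is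
  therefore divisible by y.\<close>

lemma Form_split_fst:
  assumes "S \<in> Form (int k)"
  obtains c S' where "S' \<in> Form (int k - 1)" "\<forall>x y. S (x, y) = c * x ^ k + y * S' (x, y :: 'k::field)"
proof -
  have "(\<lambda>v. fst v ^ k) \<in> Form (int k)" using Form_power[OF Form_fst, of k] by simp
  then have "(\<lambda>v. S v - S (1, 0) * fst v ^ k) \<in> Form (int k)"
    by (intro Form_diff Form_scale assms)
  then obtain G where G: "G \<in> Form (int k - 1)" "\<And>w. S w - S (1, 0) * fst w ^ k = lin (1, 0) w * G w"
    by (rule Form_zero_divisible[where v = "(1, 0)"]) (simp, simp, rule that)
  show thesis
  \<comment> \<open>The linear form of (1, 0) is - y, whence the sign.\<close>
  proof (rule that[of "\<lambda>v. - 1 * G v" "S (1, 0)"])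
    show "(\<lambda>v. - 1 * G v) \<in> Form (int k - 1)" by (rule Form_scale[OF G(1)])
    show "\<forall>x y. S (x, y) = S (1, 0) * x ^ k + y * (- 1 * G (x, y))"
    proof (intro allI)
      fix x y show "S (x, y) = S (1, 0) * x ^ k + y * (- 1 * G (x, y))"
        using G(2)[of "(x, y)"] by (simp add: lin_def algebra_simps)
    qed
  qed
qed

section \<open>Direct images of line bundles\<close>

text \<open>For a = d q + r the summands j = 0, ..., r of the direct image have degree q and the
  others q - 1; this is the correction to q.\<close>

definition shift :: "nat \<Rightarrow> nat \<Rightarrow> int" where
  "shift r j = (if j \<le> r then 0 else - 1)"

text \<open>Continuity and surjectivity make preimages of nonempty open sets open and nonempty, so
  that rational functions can be pulled back. \<open>no_common_zero\<close> lets the substitution of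
  (P, Q) map the cone over a preimage into the cone.\<close>

locale proj_map =
  fixes f :: "'k::alg_closed_field proj1 \<Rightarrow> 'k proj1" and P Q :: "'k \<times> 'k \<Rightarrow> 'k" and d :: nat
  assumes P: "P \<in> Form (int d)" and Q: "Q \<in> Form (int d)" and d_pos: "d > 0"
    and no_common_zero: "v \<noteq> (0, 0) \<Longrightarrow> P v \<noteq> 0 \<or> Q v \<noteq> 0"
    and f_pt: "v \<noteq> (0, 0) \<Longrightarrow> f (pt v) = pt (P v, Q v)"
    and f_cont: "continuous_on UNIV f" and f_surj: "surj f"
begin

lemma open_vimage: "open U \<Longrightarrow> open (f -` U)"
  using f_cont by (simp add: continuous_on_open_vimage)

lemma vimage_nonempty: "U \<noteq> {} \<Longrightarrow> f -` U \<noteq> {}"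
  using f_surj by (metis surj_f_inv_f ex_in_conv vimageI)

lemma cone_vimage: "v \<in> cone (f -` U) \<longleftrightarrow> v \<noteq> (0, 0) \<and> (P v, Q v) \<in> cone U"
  using f_pt[of v] no_common_zero[of v] by (auto simp: cone_def)

lemma cone_vimageD: "v \<in> cone (f -` U) \<Longrightarrow> (P v, Q v) \<in> cone U"
  using cone_vimage by blast

lemma Form_compose_PQ: "S \<in> Form m \<Longrightarrow> (\<lambda>v. S (P v, Q v)) \<in> Form (int d * m)"
  by (rule Form_compose[OF _ P Q])

lemma hreg_compose:
  assumes "hreg a U s"
  shows "hreg (int d * a) (f -` U) (\<lambda>v. s (P v, Q v))"
proof -
  obtain e F G where FG: "F \<in> Form (a + e)" "G \<in> Form e" "\<forall>v\<in>cone U. G v \<noteq> 0" "\<forall>v\<in>cone U. s v = F v / G v"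
    by (rule hregE[OF assms])
  show ?thesis
  proof (rule hregI)
    show "(\<lambda>v. F (P v, Q v)) \<in> Form (int d * a + int d * e)"
      using Form_compose_PQ[OF FG(1)] by (simp add: algebra_simps)
    show "(\<lambda>v. G (P v, Q v)) \<in> Form (int d * e)" by (rule Form_compose_PQ[OF FG(2)])
  qed (use FG cone_vimageD in blast)+
qed

lemma Q_nz: "Q \<noteq> (\<lambda>_. 0)"
proof
  assume "Q = (\<lambda>_. 0)"
  then have "int d = 0" using Form_nowhere_zero[OF P] no_common_zero by metis
  then show False using d_pos by simp
qed

text \<open>Each zero z of \<open>G\<close> contributes to \<open>H\<close> the linear form of f(z),
  whose pullback vanishes at z and so is divisible by the linear form of z. Zeros of
  \<open>H\<close> are images of zeros of \<open>G\<close>, which turns a denominator over a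
  preimage into the pullback of a denominator.\<close>

lemma Form_divides_pullback:
  assumes "G \<in> Form (int e)" "G \<noteq> (\<lambda>_. 0)"
  shows "\<exists>H\<in>Form (int e). \<exists>K\<in>Form (int d * int e - int e). H \<noteq> (\<lambda>_. 0) \<and>
    (\<forall>v. H (P v, Q v) = G v * K v) \<and>
    (\<forall>w. w \<noteq> (0, 0) \<longrightarrow> H w = 0 \<longrightarrow> (\<exists>z. z \<noteq> (0, 0) \<and> G z = 0 \<and> f (pt z) = pt w))"
  using assms
proof (induction e arbitrary: G)
  case 0
  define c where "c = G (0, 0)"
  have "G w = c" for w unfolding c_def using 0 by (intro Form_0_const) simp
  then have G: "G = (\<lambda>_. c)" by (rule ext)
  then have "c \<noteq> 0" using 0(2) by blast
  then have "(\<lambda>_ :: 'k \<times> 'k. c) \<noteq> (\<lambda>_. 0)" by (simp add: fun_eq_iff)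
  then show ?case
    by - (rule bexI[where x = "\<lambda>_. c"], rule bexI[where x = "\<lambda>_. 1"], simp_all add: G \<open>c \<noteq> 0\<close>)
next
  case (Suc e)
  obtain z where z: "z \<noteq> (0, 0)" "G z = 0" by (rule Form_has_zero[OF Suc.prems(1)]) (simp, rule that)
  obtain G' where G': "G' \<in> Form (int (Suc e) - 1)" "\<And>w. G w = lin z w * G' w"
    by (rule Form_zero_divisible[OF Suc.prems(1) z]) (rule that)
  have "\<exists>H\<in>Form (int e). \<exists>K\<in>Form (int d * int e - int e). H \<noteq> (\<lambda>_. 0) \<and>
    (\<forall>v. H (P v, Q v) = G' v * K v) \<and>
    (\<forall>w. w \<noteq> (0, 0) \<longrightarrow> H w = 0 \<longrightarrow> (\<exists>z. z \<noteq> (0, 0) \<and> G' z = 0 \<and> f (pt z) = pt w))"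
  proof (rule Suc.IH)
    show "G' \<in> Form (int e)" using G' by simp
    show "G' \<noteq> (\<lambda>_. 0)"
    proof
      assume "G' = (\<lambda>_. 0)"
      then have "G = (\<lambda>_. 0)" using G'(2) by (intro ext) simp
      then show False using Suc.prems(2) by blast
    qed
  qed
  then obtain H K where HK: "H \<in> Form (int e)" "K \<in> Form (int d * int e - int e)" "H \<noteq> (\<lambda>_. 0)"
    "\<forall>v. H (P v, Q v) = G' v * K v"
    "\<forall>w. w \<noteq> (0, 0) \<longrightarrow> H w = 0 \<longrightarrow> (\<exists>z. z \<noteq> (0, 0) \<and> G' z = 0 \<and> f (pt z) = pt w)" by blast
  have fz: "(P z, Q z) \<noteq> (0, 0)" using no_common_zero[OF z(1)] by simp
  let ?l = "lin (P z, Q z)"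
  have "(\<lambda>v. ?l (P v, Q v)) \<in> Form (int d * 1)" by (intro Form_compose_PQ) simp
  then have l: "(\<lambda>v. ?l (P v, Q v)) \<in> Form (int d)" by simp
  obtain K' where K': "K' \<in> Form (int d - 1)" "\<And>w. ?l (P w, Q w) = lin z w * K' w"
    by (rule Form_zero_divisible[OF l z(1)]) (simp, rule that)
  show ?case
  proof (rule bexI[of _ "\<lambda>w. ?l w * H w"], rule bexI[of _ "\<lambda>w. K' w * K w"], intro conjI allI impI)
    show "(\<lambda>w. ?l w * H w) \<noteq> (\<lambda>_. 0)"
      by (rule Form_mult_nonzero[OF lin_Form HK(1) lin_nonzero[OF fz] HK(3)])
    show "?l (P v, Q v) * H (P v, Q v) = G v * (K' v * K v)" for v
      using HK(4)[rule_format, of v] K'(2)[of v] G'(2)[of v] by simp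
    show "(\<lambda>w. K' w * K w) \<in> Form (int d * int (Suc e) - int (Suc e))"
      using Form_mult[OF K'(1) HK(2)] by (simp add: algebra_simps)
    show "(\<lambda>w. ?l w * H w) \<in> Form (int (Suc e))"
      using Form_mult[OF lin_Form HK(1)] by simp
    fix w assume w: "w \<noteq> (0, 0)" "?l w * H w = 0"
    show "\<exists>z. z \<noteq> (0, 0) \<and> G z = 0 \<and> f (pt z) = pt w"
    proof (cases "H w = 0")
      case True
      then obtain y where "y \<noteq> (0, 0)" "G' y = 0" "f (pt y) = pt w" using HK(5) w(1) by blast
      then show ?thesis using G'(2)[of y] by (intro exI[of _ y]) simp
    next
      case False
      then have "?l w = 0" using w(2) by simp
      then have "proj_rel (P z, Q z) w" using lin_eq_0_iff[OF fz w(1)] by blast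
      then have "pt (P z, Q z) = pt w" using pt_eq_iff[OF fz w(1)] by blast
      then show ?thesis using z f_pt[OF z(1)] by (intro exI[of _ z]) simp
    qed
  qed
qed

text \<open>
  For \<open>0 \<le> r < d\<close>, the graded module \<open>\<Oplus>\<^sub>N k[x, y]\<^bsub>r + d N\<^esub>\<close> over \<open>k[P, Q]\<close> is free on the monomials of degree \<open>r\<close>
  and on \<open>d - 1 - r\<close> forms of degree \<open>r + d\<close> that complete the multiples of \<open>P\<close> and \<open>Q\<close> to a basis.
\<close>

definition is_module_basis :: "nat \<Rightarrow> (nat \<Rightarrow> 'k \<times> 'k \<Rightarrow> 'k) \<Rightarrow> bool" where
  "is_module_basis r g \<longleftrightarrow> (\<forall>j\<le>r. g j = mono2 r j) \<and> (\<forall>j. r < j \<longrightarrow> j < d \<longrightarrow> g j \<in> Form (int (r + d))) \<and>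
    (\<forall>c c'. (\<forall>v. (\<Sum>j\<le>r. c j * (P v * g j v)) + (\<Sum>j\<le>r. c' j * (Q v * g j v)) + (\<Sum>j\<in>{r<..<d}. c j * g j v) = 0) \<longrightarrow>
      (\<forall>j<d. c j = 0))"

lemma module_basis_exists:
  assumes "r < d"
  obtains g where "is_module_basis r g"
proof -
  \<comment> \<open>The first index marks the kind: 0 for multiples of \<open>P\<close>, 1 for
    multiples of \<open>Q\<close>, 2 for the completing forms.\<close>
  define I where "I = {0, 1 :: nat} \<times> {..r}"
  define J where "J = {2 :: nat} \<times> {r<..<d}"
  define u where "u = (\<lambda>(k, i) v. (if k = (0 :: nat) then P v else Q v) * mono2 r i v)"
  have fin: "finite I" "finite J" and IJ: "I \<inter> J = {}" by (auto simp: I_def J_def)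
  have sumI: "(\<Sum>x\<in>I. h x) = (\<Sum>i\<le>r. h (0, i)) + (\<Sum>i\<le>r. h (1, i))" for h :: "nat \<times> nat \<Rightarrow> 'k"
    unfolding I_def sum.cartesian_product[symmetric, of "\<lambda>x y. h (x, y)", simplified] by simp
  have sumJ: "(\<Sum>x\<in>J. h x) = (\<Sum>j\<in>{r<..<d}. h (2, j))" for h :: "nat \<times> nat \<Rightarrow> 'k"
    unfolding J_def sum.cartesian_product[symmetric, of "\<lambda>x y. h (x, y)", simplified] by simp
  have uF: "u x \<in> Form (int (r + d))" if "x \<in> I" for x
  proof -
    obtain k i where x1: "x = (k, i)" by force
    then have x: "x = (k, i)" "i \<le> r" using that by (simp_all add: I_def)
    show ?thesis
      using Form_mult[OF P monomial_Form[OF x(2)]] Form_mult[OF Q monomial_Form[OF x(2)]]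
      by (cases "k = 0") (simp_all add: x u_def add.commute)
  qed
  have ind: "indep_family I u"
    unfolding indep_family_def
  proof (intro allI impI)
    fix c assume c: "\<forall>v. (\<Sum>x\<in>I. c x * u x v) = 0"
    define A where "A = (\<lambda>v. \<Sum>i\<le>r. c (0, i) * mono2 r i v)"
    define B where "B = (\<lambda>v. - 1 * (\<Sum>i\<le>r. c (1, i) * mono2 r i v))"
    have AB: "A \<in> Form (int r)" "B \<in> Form (int r)"
      unfolding A_def B_def by (intro Form_scale Form_sum monomial_Form; simp)+
    have "P v * A v - Q v * B v = (\<Sum>x\<in>I. c x * u x v)" for v
      unfolding sumI A_def B_def by (simp add: u_def sum_distrib_left sum_negf algebra_simps)
    then have eq: "P v * A v = Q v * B v" for v
      using c by simp
    have B': "B \<in> Form (int d + int r - int d)" using AB by simp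
    have cop: "P v \<noteq> 0" if "v \<noteq> (0, 0)" "Q v = 0" for v
      using no_common_zero that by blast
    \<comment> \<open>The relation P A = Q B makes Q divide A, whose degree r is less than d; so A =
      0, and then B = 0.\<close>
    obtain C where C: "C \<in> Form (int r - int d)" "\<And>v. A v = Q v * C v"
      by (rule Form_coprime_divides[OF P Q Q_nz AB(1) B' cop eq]) (assumption, assumption, rule that)
    have "C = (\<lambda>_. 0)" using Form_neg[OF C(1)] assms by simp
    then have A0: "A v = 0" for v using C(2) by simp
    then have "Q v * B v = 0" for v using eq[of v] by simp
    then have "B = (\<lambda>_. 0)" using Form_no_zero_divisors[OF Q AB(2)] Q_nz by blast
    then have "B v = 0" for v by simp
    then have B0: "(\<Sum>i\<le>r. c (1, i) * mono2 r i v) = 0" for v by (simp add: B_def)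
    have "c (0, i) = 0" if "i \<le> r" for i
      using indep_familyD[OF indep_monomials[of r], of "\<lambda>i. c (0, i)" i] A0 that unfolding A_def by simp
    moreover have "c (1, i) = 0" if "i \<le> r" for i
      using indep_familyD[OF indep_monomials[of r], of "\<lambda>i. c (1, i)" i] B0 that by simp
    ultimately show "\<forall>x\<in>I. c x = 0" by (auto simp: I_def)
  qed
  \<comment> \<open>The count 2 (r + 1) + (d - 1 - r) is the dimension of the space of forms of
    degree r + d.\<close>
  have "card I + card J = r + d + 1"
    using assms by (simp add: I_def J_def card_cartesian_product)
  from indep_family_extend[OF fin(1) ind uF fin(2) IJ this]
  obtain w where w: "\<forall>j\<in>J. w j \<in> Form (int (r + d))"
    "indep_family (I \<union> J) (\<lambda>x. if x \<in> I then u x else w x)" by blast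
  define g where "g j = (if j \<le> r then mono2 r j else w (2, j))" for j
  have "is_module_basis r g"
    unfolding is_module_basis_def
  proof (intro conjI allI impI)
    fix j assume "j \<le> r" then show "g j = mono2 r j" by (simp add: g_def)
  next
    fix j assume "r < j" "j < d" then show "g j \<in> Form (int (r + d))" using w(1) by (simp add: g_def J_def)
  next
    fix c c' :: "nat \<Rightarrow> 'k" and j
    assume *: "\<forall>v. (\<Sum>j\<le>r. c j * (P v * g j v)) + (\<Sum>j\<le>r. c' j * (Q v * g j v)) +
      (\<Sum>j\<in>{r<..<d}. c j * g j v) = 0" and j: "j < d"
    define e where "e = (\<lambda>(k, j). if k = (1 :: nat) then c' j else c j)"
    have "(\<Sum>x\<in>I \<union> J. e x * (if x \<in> I then u x else w x) v) = 0" for v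
    proof -
      have "(\<Sum>x\<in>I \<union> J. e x * (if x \<in> I then u x else w x) v) =
          (\<Sum>x\<in>I. e x * u x v) + (\<Sum>x\<in>J. e x * w x v)"
        using IJ by (subst sum.union_disjoint[OF fin IJ]) (intro arg_cong2[of _ _ _ _ "(+)"] sum.cong; auto)
      also have "\<dots> = (\<Sum>j\<le>r. c j * (P v * g j v)) + (\<Sum>j\<le>r. c' j * (Q v * g j v)) +
          (\<Sum>j\<in>{r<..<d}. c j * g j v)"
        unfolding sumI sumJ by (simp add: e_def u_def g_def)
      finally show ?thesis using * by simp
    qed
    note 0 = indep_familyD[OF w(2) this]
    show "c j = 0"
    proof (cases "j \<le> r")
      case True
      then have "(0, j) \<in> I \<union> J" by (simp add: I_def)
      from 0[OF this] show ?thesis by (simp add: e_def)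
    next
      case False
      then have "(2, j) \<in> I \<union> J" using j by (simp add: J_def)
      from 0[OF this] show ?thesis by (simp add: e_def)
    qed
  qed
  then show thesis using that by blast
qed

lemma module_basis_Form:
  assumes "is_module_basis r g" "j < d"
  shows "g j \<in> Form (int r - int d * shift r j)"
proof (cases "j \<le> r")
  case True
  then have "g j = mono2 r j" using assms by (simp add: is_module_basis_def)
  then show ?thesis using monomial_Form[OF True] True by (simp add: shift_def)
next
  case False
  then show ?thesis using assms by (simp add: is_module_basis_def shift_def add.commute)
qed

lemma sum_split_at: "r < d \<Longrightarrow> (\<Sum>j<d. h j) = (\<Sum>j\<le>r. h j) + (\<Sum>j\<in>{r<..<d}. h j)" for h :: "nat \<Rightarrow> 'k"
proof -
  assume "r < d"
  then have "{..<d} = {..r} \<union> {r<..<d}" by auto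
  then show ?thesis by (simp add: sum.union_disjoint ivl_disj_int)
qed

text \<open>In the induction step the pure x-power is separated from each coefficient, the rest
  being y S'_j; the relation becomes P^N A + Q B = 0. So Q divides A, the quotient of degree r is a
  combination of the monomials in the basis, and the defining independence kills the separated
  parts. Cancelling Q leaves a relation of lower degree between the S'_j.\<close>

lemma module_basis_indep:
  assumes r: "r < d" and g: "is_module_basis r g"
    and S: "\<And>j. j < d \<Longrightarrow> S j \<in> Form (int N + shift r j)"
    and 0: "\<And>v. (\<Sum>j<d. g j v * S j (P v, Q v)) = 0"
    and j: "j < d"
  shows "S j = (\<lambda>_. 0)"
  using S 0 j
proof (induction N arbitrary: S j)
  case 0
  \<comment> \<open>In degree N = 0 the first r + 1 coefficients are constants, and the others have
    degree - 1 and vanish.\<close>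
  have S0: "S j v = (if j \<le> r then S j (0, 0) else 0)" if "j < d" for j v
    using 0(1)[OF that] Form_0_const[of "S j" v "(0, 0)"] Form_neg[of "S j" "- 1"]
    by (auto simp: shift_def split: if_splits)
  have "(\<Sum>i\<le>r. S i (0, 0) * mono2 r i v) = 0" for v
  proof -
    have "(\<Sum>j<d. g j v * S j (P v, Q v)) = (\<Sum>j<d. g j v * (if j \<le> r then S j (0, 0) else 0))"
      using S0 by (intro sum.cong) auto
    also have "\<dots> = (\<Sum>i\<le>r. S i (0, 0) * mono2 r i v)"
      unfolding sum_split_at[OF r] using g
      by (auto simp: is_module_basis_def mult.commute intro!: sum.cong sum.neutral)
    finally show ?thesis using 0(2)[of v] by simp
  qed
  from indep_familyD[OF indep_monomials this]
  have "S i (0, 0) = 0" if "i \<le> r" for i using that by simp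
  then have "S j v = 0" for v using S0[OF 0(3), of v] by auto
  then show ?case by (rule ext)
next
  case (Suc N)
  have "\<forall>j<d. \<exists>c S'. S' \<in> Form (int N + shift r j) \<and>
    (\<forall>x y. S j (x, y) = c * x ^ (if j \<le> r then Suc N else N) + y * S' (x, y))"
  proof (intro allI impI)
    fix j assume "j < d"
    then have 1: "S j \<in> Form (int (if j \<le> r then Suc N else N))"
      using Suc.prems(1)[of j] by (auto simp: shift_def)
    obtain c S' where "S' \<in> Form (int (if j \<le> r then Suc N else N) - 1)"
      "\<forall>x y. S j (x, y) = c * x ^ (if j \<le> r then Suc N else N) + y * S' (x, y)"
      by (rule Form_split_fst[OF 1])
    then show "\<exists>c S'. S' \<in> Form (int N + shift r j) \<and>
      (\<forall>x y. S j (x, y) = c * x ^ (if j \<le> r then Suc N else N) + y * S' (x, y))"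
      by (intro exI[of _ c] exI[of _ S']) (auto simp: shift_def split: if_splits)
  qed
  then obtain c S' where S': "\<And>j. j < d \<Longrightarrow> S' j \<in> Form (int N + shift r j)"
    "\<And>j x y. j < d \<Longrightarrow> S j (x, y) = c j * x ^ (if j \<le> r then Suc N else N) + y * S' j (x, y)"
    by metis
  define A where "A = (\<lambda>v. (\<Sum>j\<le>r. c j * (P v * g j v)) + (\<Sum>j\<in>{r<..<d}. c j * g j v))"
  define B where "B = (\<lambda>v. \<Sum>j<d. g j v * S' j (P v, Q v))"
  have gr: "g j \<in> Form (int r)" if "j \<le> r" for j
    using module_basis_Form[OF g, of j] that r by (simp add: shift_def)
  have gd: "g j \<in> Form (int r + int d)" if "j \<in> {r<..<d}" for j
    using module_basis_Form[OF g, of j] that by (simp add: shift_def)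
  have A: "A \<in> Form (int r + int d)"
    unfolding A_def using Form_mult[OF P gr] gd
    by (intro Form_add Form_sum Form_scale) (auto simp: add.commute)
  have B: "B \<in> Form (int r + int d * int N)"
    unfolding B_def
  proof (intro Form_sum)
    fix j assume j: "j \<in> {..<d}"
    have "(\<lambda>v. g j v * S' j (P v, Q v)) \<in> Form ((int r - int d * shift r j) + int d * (int N + shift r j))"
      using j by (intro Form_mult module_basis_Form[OF g] Form_compose_PQ S') auto
    then show "(\<lambda>v. g j v * S' j (P v, Q v)) \<in> Form (int r + int d * int N)"
      by (simp add: algebra_simps)
  qed
  have eq: "P v ^ N * A v + Q v * B v = 0" for v
  proof -
    have "0 = (\<Sum>j<d. g j v * S j (P v, Q v))" using Suc.prems(2)[of v] by simp
    also have "\<dots> = (\<Sum>j<d. g j v * (c j * P v ^ (if j \<le> r then Suc N else N)) + g j v * (Q v * S' j (P v, Q v)))"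
      using S'(2) by (intro sum.cong) (auto simp: distrib_left)
    also have "\<dots> = (\<Sum>j<d. g j v * (c j * P v ^ (if j \<le> r then Suc N else N))) + Q v * B v"
      by (simp add: sum.distrib B_def sum_distrib_left algebra_simps)
    also have "(\<Sum>j<d. g j v * (c j * P v ^ (if j \<le> r then Suc N else N))) = P v ^ N * A v"
      unfolding sum_split_at[OF r] A_def distrib_left sum_distrib_left
      by (intro arg_cong2[of _ _ _ _ "(+)"] sum.cong) (auto simp: algebra_simps)
    finally show ?thesis by simp
  qed
  have c0: "\<forall>j<d. c j = 0"
  proof -
    have PN: "(\<lambda>v. P v ^ N) \<in> Form (int N * int d)" by (rule Form_power[OF P])
    have B': "(\<lambda>v. - 1 * B v) \<in> Form (int N * int d + (int r + int d) - int d)"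
      using Form_scale[OF B, of "- 1"] by (simp add: algebra_simps)
    have cop: "P v ^ N \<noteq> 0" if "v \<noteq> (0, 0)" "Q v = 0" for v
      using no_common_zero[OF that(1)] that(2) by simp
    have eq': "P v ^ N * A v = Q v * (- 1 * B v)" for v using eq[of v] by (simp add: eq_neg_iff_add_eq_0)
    obtain C where C: "C \<in> Form (int r + int d - int d)" "\<And>v. A v = Q v * C v"
      by (rule Form_coprime_divides[OF PN Q Q_nz A B' cop eq']) (assumption, assumption, rule that)
    then have "C \<in> Form (int r)" by simp
    then obtain e where e: "\<And>v. C v = (\<Sum>i\<le>r. e i * fst v ^ i * snd v ^ (r - i))"
      by (rule Form_monomials) (rule that)
    \<comment> \<open>The quotient C has coefficients \<open>e\<close> on the monomials
      \<open>g j\<close> with j \<le> r, so A = Q C is a relation with \<open>- e\<close> on the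
      multiples of Q.\<close>
    have "(\<Sum>j\<le>r. c j * (P v * g j v)) + (\<Sum>j\<le>r. (- e j) * (Q v * g j v)) +
      (\<Sum>j\<in>{r<..<d}. c j * g j v) = 0" for v
    proof -
      have "(\<Sum>j\<le>r. (- e j) * (Q v * g j v)) = - (Q v * C v)"
        unfolding e sum_distrib_left sum_negf[symmetric] using g
        by (intro sum.cong) (auto simp: is_module_basis_def)
      then show ?thesis using C(2)[of v] by (simp add: A_def algebra_simps)
    qed
    note rel = this
    show ?thesis
    proof (intro allI impI)
      fix j assume "j < d"
      with rel show "c j = 0"
        by (rule g[unfolded is_module_basis_def, THEN conjunct2, THEN conjunct2, rule_format,
            of c "\<lambda>j. - e j"])
    qed
  qed
  then have "A v = 0" for v using r by (simp add: A_def)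
  then have "Q v * B v = 0" for v using eq[of v] by simp
  then have "B = (\<lambda>_. 0)" using Form_no_zero_divisors[OF Q B] Q_nz by blast
  then have "B v = 0" for v by simp
  then have "(\<Sum>j<d. g j v * S' j (P v, Q v)) = 0" for v by (simp add: B_def)
  from Suc.IH[OF S'(1) this Suc.prems(3)] have "S' j = (\<lambda>_. 0)" .
  then show ?case using S'(2)[OF Suc.prems(3)] c0 Suc.prems(3) by (auto simp: fun_eq_iff)
qed

end

text \<open>
  The degrees of the line bundles in \<open>f\<^sub>* \<O>(a) \<cong> \<Oplus>\<^sub>j \<O>(push_deg d a j)\<close>, \<open>j < d\<close>, for \<open>f\<close> of degree \<open>d\<close>.
\<close>

definition push_deg :: "nat \<Rightarrow> int \<Rightarrow> nat \<Rightarrow> int" where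
  "push_deg d a j = a div int d + shift (nat (a mod int d)) j"

section \<open>Expansion of forms and sections in the module basis\<close>

context proj_map
begin

text \<open>The products of basis members with monomials in P and Q are independent by
  \<open>module_basis_indep\<close>, and their number (r + 1)(N + 1) + (d - 1 - r) N = r + d N + 1
  is the dimension of the space.\<close>

lemma module_basis_spans:
  assumes r: "r < d" and g: "is_module_basis r g" and F: "F \<in> Form (int r + int d * int N)"
  shows "\<exists>S. (\<forall>j<d. S j \<in> Form (int N + shift r j)) \<and> (\<forall>v. F v = (\<Sum>j<d. g j v * S j (P v, Q v)))"
proof -
  \<comment> \<open>\<open>k j\<close> counts the monomials of degree \<open>N + shift r j\<close>;
    for N = 0 and j > r it is 0 and the sums with the truncated \<open>k j - 1\<close> are
    empty.\<close>
  define k where "k j = (if j \<le> r then N + 1 else N)" for j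
  define I where "I = Sigma {..<d} (\<lambda>j. {..<k j})"
  define u where "u = (\<lambda>(j, i) v. g j v * mono2 (k j - 1) i (P v, Q v))"
  have fin: "finite I" by (simp add: I_def)
  have sumI: "(\<Sum>x\<in>I. h x) = (\<Sum>j<d. \<Sum>i<k j. h (j, i))" for h :: "nat \<times> nat \<Rightarrow> 'k"
    unfolding I_def by (subst sum.Sigma) auto
  define S where "S c j = (\<lambda>w :: 'k \<times> 'k. \<Sum>i<k j. c (j, i) * mono2 (k j - 1) i w)" for c :: "nat \<times> nat \<Rightarrow> 'k" and j
  have m: "mono2 (k j - 1) i \<in> Form (int N + shift r j)" if "i < k j" for i j
  proof -
    have "i \<le> k j - 1" "int (k j - 1) = int N + shift r j"
      using that by (auto simp: k_def shift_def split: if_splits)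
    then show ?thesis using monomial_Form by metis
  qed
  have S: "S c j \<in> Form (int N + shift r j)" for c j
    unfolding S_def by (intro Form_sum Form_scale m) auto
  have sumS: "(\<Sum>x\<in>I. c x * u x v) = (\<Sum>j<d. g j v * S c j (P v, Q v))" for c v
    unfolding sumI S_def u_def by (simp add: sum_distrib_left algebra_simps)
  have "indep_family I u"
    unfolding indep_family_def
  proof (intro allI impI)
    fix c assume c: "\<forall>v. (\<Sum>x\<in>I. c x * u x v) = 0"
    have S0: "S c j = (\<lambda>_. 0)" if "j < d" for j
      using module_basis_indep[OF r g S[of c] _ that] c unfolding sumS by blast
    show "\<forall>x\<in>I. c x = 0"
    proof
      fix x assume "x \<in> I"
      then obtain j i where x: "x = (j, i)" "j < d" "i < k j" by (auto simp: I_def)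
      have "{..<k j} = {..k j - 1}" using x(3) by auto
      then have "(\<Sum>i\<le>k j - 1. c (j, i) * mono2 (k j - 1) i w) = 0" for w
        using fun_cong[OF S0[OF x(2)], of w] by (simp add: S_def)
      from indep_familyD[OF indep_monomials this, of i] show "c x = 0" using x by simp
    qed
  qed
  moreover have "u x \<in> Form (int (r + d * N))" if "x \<in> I" for x
  proof -
    obtain j i where x: "x = (j, i)" "j < d" "i < k j" using \<open>x \<in> I\<close> by (auto simp: I_def)
    have "(\<lambda>v. g j v * mono2 (k j - 1) i (P v, Q v)) \<in>
        Form ((int r - int d * shift r j) + int d * (int N + shift r j))"
      by (intro Form_mult module_basis_Form[OF g x(2)] Form_compose_PQ[OF m[OF x(3)]])
    then show ?thesis by (simp add: x u_def algebra_simps)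
  qed
  moreover have "card I = r + d * N + 1"
  proof -
    have "card I = (\<Sum>j<d. k j)" by (simp add: I_def)
    also have "\<dots> = (\<Sum>j\<le>r. k j) + (\<Sum>j\<in>{r<..<d}. k j)"
    proof -
      have "{..<d} = {..r} \<union> {r<..<d}" using r by auto
      then show ?thesis by (simp add: sum.union_disjoint ivl_disj_int)
    qed
    also have "(\<Sum>j\<in>{r<..<d}. k j) = (d - Suc r) * N"
      by (simp add: k_def)
    also have "(\<Sum>j\<le>r. k j) = (r + 1) * (N + 1)"
      by (simp add: k_def)
    also have "(r + 1) * (N + 1) + (d - Suc r) * N = (r + 1) + ((r + 1) + (d - Suc r)) * N"
      by (simp add: algebra_simps)
    also have "\<dots> = r + d * N + 1" using r by simp
    finally show ?thesis .
  qed
  moreover have "F \<in> Form (int (r + d * N))" using F by simp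
  ultimately obtain c where "\<forall>v. F v = (\<Sum>x\<in>I. c x * u x v)"
    using indep_family_spans[OF fin] by blast
  then show ?thesis using S[of c] sumS[of c] by (intro exI[of _ "S c"]) simp
qed

text \<open>Clearing denominators reduces both halves to the module basis: its independence gives
  uniqueness, its spanning property existence. Together they say that s -> sum of g_j s_j(P, Q) is
  an isomorphism from the sum of the O(\<open>push_deg d a j\<close>) to the direct image of
  O(a).\<close>

lemma push_forward:
  "\<exists>g. (\<forall>j<d. g j \<in> Form (a - int d * push_deg d a j)) \<and>
    (\<forall>U s. open U \<longrightarrow> (\<forall>j<d. hreg (push_deg d a j) U (s j)) \<longrightarrow>
      (\<forall>v\<in>cone (f -` U). (\<Sum>j<d. g j v * s j (P v, Q v)) = 0) \<longrightarrow> (\<forall>j<d. \<forall>w\<in>cone U. s j w = 0)) \<and>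
    (\<forall>U t. open U \<longrightarrow> hreg a (f -` U) t \<longrightarrow> (\<exists>s. (\<forall>j<d. hreg (push_deg d a j) U (s j)) \<and>
        (\<forall>v\<in>cone (f -` U). t v = (\<Sum>j<d. g j v * s j (P v, Q v)))))"
proof -
  define q where "q = a div int d"
  define r where "r = nat (a mod int d)"
  have r: "r < d" "a = int d * q + int r"
    using d_pos by (simp_all add: r_def q_def nat_less_iff)
  have pd: "push_deg d a j = q + shift r j" for j by (simp add: push_deg_def q_def r_def)
  obtain g where g: "is_module_basis r g" using module_basis_exists[OF r(1)] .
  show ?thesis
  proof (rule exI[of _ g], intro conjI allI impI ballI)
    fix j assume "j < d"
    moreover have "a - int d * push_deg d a j = int r - int d * shift r j"
      unfolding pd using r(2) by (simp add: algebra_simps)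
    ultimately show "g j \<in> Form (a - int d * push_deg d a j)"
      using module_basis_Form[OF g] by simp
  next
    fix U s j w
    assume U: "open U" and s: "\<forall>j<d. hreg (push_deg d a j) U (s j)"
      and 0: "\<forall>v\<in>cone (f -` U). (\<Sum>j<d. g j v * s j (P v, Q v)) = 0"
      and j: "j < d" and w: "w \<in> cone U"
    have ne: "U \<noteq> {}" using w by (auto simp: cone_def)
    have "\<exists>e. \<exists>G\<in>Form e. (\<forall>v\<in>cone U. G v \<noteq> 0) \<and>
      (\<forall>j\<in>{..<d}. \<exists>F\<in>Form (push_deg d a j + e). \<forall>v\<in>cone U. s j v = F v / G v)"
      using s by (intro hreg_common_denominator) auto
    then obtain e H where H: "H \<in> Form e" "\<forall>v\<in>cone U. H v \<noteq> 0"
      "\<forall>j\<in>{..<d}. \<exists>F\<in>Form (push_deg d a j + e). \<forall>v\<in>cone U. s j v = F v / H v" by blast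
    from bchoice[OF H(3)[unfolded Bex_def]] obtain S where
      S: "\<forall>j\<in>{..<d}. S j \<in> Form (push_deg d a j + e) \<and> (\<forall>v\<in>cone U. s j v = S j v / H v)" by blast
    define F where "F = (\<lambda>v. \<Sum>j<d. g j v * S j (P v, Q v))"
    have "F \<in> Form (a + int d * e)"
      unfolding F_def
    proof (intro Form_sum)
      fix j assume j: "j \<in> {..<d}"
      have "(\<lambda>v. g j v * S j (P v, Q v)) \<in> Form ((int r - int d * shift r j) + int d * (push_deg d a j + e))"
        using j S by (intro Form_mult module_basis_Form[OF g] Form_compose_PQ) auto
      moreover have "int r - int d * shift r j + int d * (push_deg d a j + e) = a + int d * e"
        unfolding pd using r(2) by (simp add: algebra_simps)
      ultimately show "(\<lambda>v. g j v * S j (P v, Q v)) \<in> Form (a + int d * e)" by simp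
    qed
    then have "F = (\<lambda>_. 0)"
    proof (rule Form_vanishes_on_open[OF _ open_vimage[OF U] vimage_nonempty[OF ne]])
      fix v assume v: "v \<in> cone (f -` U)"
      then have Pv: "(P v, Q v) \<in> cone U" by (rule cone_vimageD)
      then have nz: "H (P v, Q v) \<noteq> 0" using H(2) by blast
      have "F v = H (P v, Q v) * (\<Sum>j<d. g j v * s j (P v, Q v))"
        unfolding F_def sum_distrib_left using S Pv nz by (intro sum.cong) auto
      then show "F v = 0" using 0 v by simp
    qed
    then have "F v = 0" for v by simp
    then have F0: "(\<Sum>j<d. g j v * S j (P v, Q v)) = 0" for v by (simp add: F_def)
    \<comment> \<open>For \<open>q + e < 0\<close> all \<open>S j\<close> have negative degree;
      otherwise \<open>q + e\<close> is the natural number that \<open>module_basis_indep\<close>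
      asks for.\<close>
    have "S j = (\<lambda>_. 0)"
    proof (cases "q + e < 0")
      case True
      then show ?thesis using S j Form_neg[of "S j" "push_deg d a j + e"] by (auto simp: pd shift_def split: if_splits)
    next
      case False
      show ?thesis
      proof (rule module_basis_indep[OF r(1) g _ F0 j, of "nat (q + e)"])
        fix j assume "j < d"
        then show "S j \<in> Form (int (nat (q + e)) + shift r j)" using S False by (simp add: pd algebra_simps)
      qed
    qed
    then show "s j w = 0" using S j w by simp
  next
    fix U t assume U: "open U" and t: "hreg a (f -` U) t"
    show "\<exists>s. (\<forall>j<d. hreg (push_deg d a j) U (s j)) \<and>
        (\<forall>v\<in>cone (f -` U). t v = (\<Sum>j<d. g j v * s j (P v, Q v)))"
    proof (cases "U = {}")
      case True
      then show ?thesis by (intro exI[of _ "\<lambda>_ _. 0"]) (simp add: cone_def)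
    next
      case False
      obtain e F G where FG: "F \<in> Form (a + e)" "G \<in> Form e" "\<forall>v\<in>cone (f -` U). G v \<noteq> 0"
        "\<forall>v\<in>cone (f -` U). t v = F v / G v"
        by (rule hregE[OF t])
      have "cone (f -` U) \<noteq> {}" using cone_nonempty[OF vimage_nonempty[OF False]] .
      then have "G \<noteq> (\<lambda>_. 0)" using FG(3) by auto
      with FG(2) obtain m where m: "e = int m" by (meson Form_cases)
      \<comment> \<open>Numerator and denominator are multiplied by \<open>K\<close>, which makes
        the denominator the pullback of \<open>H\<close>.\<close>
      from Form_divides_pullback[OF FG(2)[unfolded m] \<open>G \<noteq> (\<lambda>_. 0)\<close>]
      obtain H K where HK': "H \<in> Form e" "K \<in> Form (int d * e - e)"
        "\<forall>w. w \<noteq> (0, 0) \<longrightarrow> H w = 0 \<longrightarrow> (\<exists>z. z \<noteq> (0, 0) \<and> G z = 0 \<and> f (pt z) = pt w)"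
        "\<forall>v. H (P v, Q v) = G v * K v" unfolding m by blast
      have "H v \<noteq> 0" if v: "v \<in> cone U" for v
      proof
        assume "H v = 0"
        moreover have "v \<noteq> (0, 0)" using v by (simp add: cone_def)
        ultimately obtain z where z: "z \<noteq> (0, 0)" "G z = 0" "f (pt z) = pt v" using HK'(3) by blast
        then have "z \<in> cone (f -` U)" using v by (simp add: cone_def)
        then show False using FG(3) z(2) by blast
      qed
      with HK' have HK: "H \<in> Form e" "K \<in> Form (int d * e - e)"
        "\<forall>v\<in>cone U. H v \<noteq> 0" "\<forall>v. H (P v, Q v) = G v * K v" by blast+
      have FK: "(\<lambda>v. F v * K v) \<in> Form (int r + int d * (q + e))"
        using Form_mult[OF FG(1) HK(2)] by (simp add: r(2) algebra_simps)
      have "\<exists>S. (\<forall>j<d. S j \<in> Form (q + e + shift r j)) \<and> (\<forall>v. F v * K v = (\<Sum>j<d. g j v * S j (P v, Q v)))"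
      proof (cases "q + e < 0")
        case True
        have "int r + int d * (q + e) < 0"
        proof -
          have "int d * (q + e) \<le> int d * (- 1)" using True by (intro mult_left_mono) auto
          then show ?thesis using r(1) by simp
        qed
        from Form_neg[OF FK this] have "F v * K v = 0" for v by (rule fun_cong)
        then show ?thesis by (intro exI[of _ "\<lambda>_ _. 0"]) simp
      next
        case nn: False
        then show ?thesis using module_basis_spans[OF r(1) g, of "\<lambda>v. F v * K v" "nat (q + e)"] FK by simp
      qed
      then obtain S where S: "\<forall>j<d. S j \<in> Form (q + e + shift r j)"
        "\<forall>v. F v * K v = (\<Sum>j<d. g j v * S j (P v, Q v))" by blast
      show ?thesis
      proof (intro exI[of _ "\<lambda>j w. S j w / H w"] conjI allI impI ballI)
        fix j assume "j < d"
        then show "hreg (push_deg d a j) U (\<lambda>w. S j w / H w)"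
          using S(1) HK by (intro hregI[of "S j" _ e H]) (auto simp: pd algebra_simps)
      next
        fix v assume v: "v \<in> cone (f -` U)"
        then have Pv: "(P v, Q v) \<in> cone U" by (rule cone_vimageD)
        have nz: "H (P v, Q v) \<noteq> 0" using HK(3) Pv by blast
        then have "G v \<noteq> 0" "K v \<noteq> 0" using HK(4)[rule_format, of v] by auto
        then have "t v = F v * K v / H (P v, Q v)"
          using FG(4) v HK(4)[rule_format, of v] by simp
        also have "\<dots> = (\<Sum>j<d. g j v * (S j (P v, Q v) / H (P v, Q v)))"
          using S(2)[rule_format, of v] by (simp add: sum_divide_distrib)
        finally show "t v = (\<Sum>j<d. g j v * (S j (P v, Q v) / H (P v, Q v)))" .
      qed
    qed
  qed
qed

end

section \<open>Determinants of matrices of functions\<close>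

text \<open>Matrices are functions of two indices, so that entries may depend on a point of the cone
  without matrix carriers.\<close>

definition detf :: "nat \<Rightarrow> (nat \<Rightarrow> nat \<Rightarrow> 'k::field) \<Rightarrow> 'k" where
  "detf n A = det (mat n n (\<lambda>(i, j). A i j))"

lemma detf_cong: "(\<And>i j. i < n \<Longrightarrow> j < n \<Longrightarrow> A i j = B i j) \<Longrightarrow> detf n A = detf n B"
  unfolding detf_def by (intro arg_cong[of _ _ det] cong_mat) auto

lemma detf_mult: "detf n (\<lambda>i j. \<Sum>k<n. A i k * B k j) = detf n A * detf n B"
proof -
  have "mat n n (\<lambda>(i, j). \<Sum>k<n. A i k * B k j) = mat n n (\<lambda>(i, j). A i j) * mat n n (\<lambda>(i, j). B i j)"
    by (rule eq_matI) (auto simp: scalar_prod_def lessThan_atLeast0)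
  then show ?thesis
    unfolding detf_def by (simp add: det_mult[of _ n])
qed

lemma detf_kernel:
  assumes "detf n A = 0"
  obtains x k where "k < n" "x k \<noteq> 0" "\<forall>i<n. (\<Sum>j<n. A i j * x j) = 0"
proof -
  let ?A = "mat n n (\<lambda>(i, j). A i j)"
  have A: "?A \<in> carrier_mat n n" by simp
  from assms obtain v where v: "v \<in> carrier_vec n" "v \<noteq> 0\<^sub>v n" "?A *\<^sub>v v = 0\<^sub>v n"
    unfolding detf_def det_0_iff_vec_prod_zero[OF A] by blast
  have "\<exists>k<n. v $ k \<noteq> 0"
  proof (rule ccontr)
    assume "\<not> ?thesis"
    then have "v = 0\<^sub>v n" using v(1) by (intro eq_vecI) auto
    then show False using v(2) by blast
  qed
  then obtain k where k: "k < n" "v $ k \<noteq> 0" by blast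
  have "(\<Sum>j<n. A i j * v $ j) = 0" if "i < n" for i
  proof -
    have "(?A *\<^sub>v v) $ i = (\<Sum>j<n. A i j * v $ j)"
      using that v(1) by (auto simp: scalar_prod_def lessThan_atLeast0 intro!: sum.cong)
    then show ?thesis using v(3) that by simp
  qed
  then show thesis by (intro that[of k "\<lambda>j. v $ j"]) (use k in auto)
qed

lemma detf_solve:
  assumes "detf n A \<noteq> 0"
  obtains x where "\<forall>i<n. (\<Sum>j<n. A i j * x j) = t i"
proof -
  let ?A = "mat n n (\<lambda>(i, j). A i j)"
  let ?B = "adj_mat ?A"
  have A: "?A \<in> carrier_mat n n" by simp
  note B = adj_mat(1)[OF A]
  have AB: "(\<Sum>j<n. A i j * ?B $$ (j, l)) = (if i = l then detf n A else 0)" if "i < n" "l < n" for i l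
  proof -
    have "(\<Sum>j<n. A i j * ?B $$ (j, l)) = (?A * ?B) $$ (i, l)"
      using that B by (auto simp: scalar_prod_def lessThan_atLeast0 intro!: sum.cong)
    also have "\<dots> = (if i = l then detf n A else 0)"
      unfolding adj_mat(2)[OF A] detf_def using that by simp
    finally show ?thesis .
  qed
  define x where "x j = (\<Sum>l<n. ?B $$ (j, l) * t l) / detf n A" for j
  have "(\<Sum>j<n. A i j * x j) = t i" if i: "i < n" for i
  proof -
    have "(\<Sum>j<n. A i j * x j) = (\<Sum>j<n. \<Sum>l<n. A i j * ?B $$ (j, l) * t l) / detf n A"
      by (simp add: x_def sum_divide_distrib sum_distrib_left mult.assoc)
    also have "(\<Sum>j<n. \<Sum>l<n. A i j * ?B $$ (j, l) * t l) = (\<Sum>l<n. (\<Sum>j<n. A i j * ?B $$ (j, l)) * t l)"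
      by (subst sum.swap) (simp add: sum_distrib_right)
    also have "\<dots> = (\<Sum>l<n. (if i = l then detf n A * t l else 0))"
      using AB[OF i] by (intro sum.cong) auto
    also have "\<dots> = detf n A * t i" using i by simp
    finally show ?thesis using assms by simp
  qed
  then show thesis using that by blast
qed

text \<open>Row k has no nonzero entry off the diagonal, and deleting row and column k leaves an
  identity matrix.\<close>

lemma detf_replace_column_one:
  assumes "k < n"
  shows "detf n (\<lambda>i j. if j = k then x i else if i = j then 1 else 0) = x k"
proof -
  let ?X = "mat n n (\<lambda>(i, j). if j = k then x i else if i = j then 1 else 0)"
  have X: "?X \<in> carrier_mat n n" by simp
  have "det ?X = (\<Sum>j<n. ?X $$ (k, j) * cofactor ?X k j)"
    by (rule laplace_expansion_row[OF X assms])
  also have "\<dots> = (\<Sum>j<n. if j = k then x k * cofactor ?X k k else 0)"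
    using assms by (intro sum.cong) auto
  also have "\<dots> = x k * cofactor ?X k k" using assms by simp
  also have "mat_delete ?X k k = 1\<^sub>m (n - 1)"
    by (rule eq_matI) (use assms in \<open>auto simp: mat_delete_def\<close>)
  then have "cofactor ?X k k = 1"
    unfolding cofactor_def by simp
  finally show ?thesis by (simp add: detf_def)
qed

text \<open>Replacing column k of A by A x amounts to multiplying A by the identity matrix whose
  column k is replaced by x.\<close>

lemma detf_cramer:
  assumes "k < n" "\<And>i. i < n \<Longrightarrow> t i = (\<Sum>j<n. A i j * x j)"
  shows "detf n (\<lambda>i j. if j = k then t i else A i j) = x k * detf n A"
proof -
  define X where "X i j = (if j = k then x i else if i = j then 1 else 0)" for i j
  have "detf n (\<lambda>i j. if j = k then t i else A i j) = detf n (\<lambda>i j. \<Sum>l<n. A i l * X l j)"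
  proof (rule detf_cong)
    fix i j assume ij: "i < n" "j < n"
    have "(\<Sum>l<n. A i l * X l j) = A i j" if "j \<noteq> k"
    proof -
      have "(\<Sum>l<n. A i l * X l j) = (\<Sum>l<n. if l = j then A i l else 0)"
        using that by (intro sum.cong) (auto simp: X_def)
      then show ?thesis using ij by simp
    qed
    then show "(if j = k then t i else A i j) = (\<Sum>l<n. A i l * X l j)"
      using assms(2)[OF ij(1)] by (simp add: X_def)
  qed
  also have "\<dots> = detf n A * detf n X" by (rule detf_mult)
  also have "detf n X = x k"
    unfolding X_def by (rule detf_replace_column_one[OF assms(1)])
  finally show ?thesis by simp
qed

text \<open>Cramer's rule twice: the determinant with column k set to zero is x_k det A, and also 0
  det A, from the zero solution.\<close>

lemma detf_solution_zero:
  assumes "detf n A \<noteq> 0" "\<And>i. i < n \<Longrightarrow> (\<Sum>j<n. A i j * x j) = 0" "k < n"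
  shows "x k = 0"
proof -
  have "x k * detf n A = detf n (\<lambda>i j. if j = k then 0 else A i j)"
    by (rule detf_cramer[symmetric]) (use assms in auto)
  also have "\<dots> = 0 * detf n A"
    using detf_cramer[of k n "\<lambda>_. 0" A "\<lambda>_. 0"] assms(3) by simp
  finally show ?thesis using assms(1) by simp
qed

text \<open>If n < m, A is made square by zero rows. When that matrix is singular, its kernel vector
  contradicts B A = 1; when not, the n-th unit vector lies in its image although row n is zero. This
  shows that the ranks of two charts agree.\<close>

lemma left_inverse_size_le:
  fixes A B :: "nat \<Rightarrow> nat \<Rightarrow> 'k::field"
  assumes "\<And>i j. i < m \<Longrightarrow> j < m \<Longrightarrow> (\<Sum>k<n. B i k * A k j) = (if i = j then 1 else 0)"
  shows "m \<le> n"
proof (rule ccontr)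
  assume "\<not> m \<le> n"
  then have nm: "n < m" by simp
  define A' where "A' i j = (if i < n then A i j else 0)" for i j
  show False
  proof (cases "detf m A' = 0")
    case True
    obtain x k where x: "k < m" "x k \<noteq> 0" "\<forall>i<m. (\<Sum>j<m. A' i j * x j) = 0"
      by (rule detf_kernel[OF True]) (rule that)
    have 0: "(\<Sum>j<m. A l j * x j) = 0" if "l < n" for l
      using x(3)[rule_format, of l] that nm by (simp add: A'_def)
    have "x k = (\<Sum>j<m. (if k = j then 1 else 0) * x j)"
    proof -
      have "(\<Sum>j<m. (if k = j then 1 else 0) * x j) = (\<Sum>j<m. if k = j then x j else 0)"
        by (intro sum.cong) auto
      then show ?thesis using x(1) by simp
    qed
    also have "\<dots> = (\<Sum>j<m. (\<Sum>l<n. B k l * A l j) * x j)"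
      using assms x(1) by (intro sum.cong) auto
    also have "\<dots> = (\<Sum>l<n. B k l * (\<Sum>j<m. A l j * x j))"
      by (simp add: sum_distrib_left sum_distrib_right mult.assoc) (rule sum.swap)
    also have "\<dots> = 0" using 0 by simp
    finally show False using x(2) by simp
  next
    case False
    obtain x where x: "\<forall>i<m. (\<Sum>j<m. A' i j * x j) = (if i = n then 1 else 0)"
      by (rule detf_solve[OF False]) (rule that)
    from x[rule_format, OF nm] show False by (simp add: A'_def)
  qed
qed

text \<open>Each term of the Leibniz formula takes one entry from every column, so the degrees of
  the columns add up.\<close>

lemma hreg_detf:
  assumes "\<And>i j. i < n \<Longrightarrow> j < n \<Longrightarrow> hreg (c j) U (\<lambda>v. A v i j)"
  shows "hreg (\<Sum>j<n. c j) U (\<lambda>v. detf n (A v))"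
proof -
  have "detf n (A v) = (\<Sum>p | p permutes {0..<n}. signof p * (\<Prod>i = 0..<n. A v i (p i)))" for v
  proof -
    have "detf n (A v) = (\<Sum>p | p permutes {0..<n}. signof p * (\<Prod>i = 0..<n. mat n n (\<lambda>(i, j). A v i j) $$ (i, p i)))"
      unfolding detf_def by (rule det_def') simp
    also have "\<dots> = (\<Sum>p | p permutes {0..<n}. signof p * (\<Prod>i = 0..<n. A v i (p i)))"
    proof (intro sum.cong refl arg_cong2[of _ _ _ _ "(*)"] prod.cong)
      fix p i assume "p \<in> {p. p permutes {0..<n}}" "i \<in> {0..<n}"
      moreover from this have "p i < n" using permutes_in_image[of p "{0..<n}" i] by simp
      ultimately show "mat n n (\<lambda>(i, j). A v i j) $$ (i, p i) = A v i (p i)" by simp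
    qed
    finally show ?thesis .
  qed
  moreover have "hreg (\<Sum>j<n. c j) U (\<lambda>v. signof p * (\<Prod>i = 0..<n. A v i (p i)))"
    if p: "p permutes {0..<n}" for p
  proof (rule hreg_scale)
    have "hreg (\<Sum>i = 0..<n. c (p i)) U (\<lambda>v. \<Prod>i = 0..<n. A v i (p i))"
    proof (rule hreg_prod)
      fix i assume "i \<in> {0..<n}"
      moreover from this have "p i < n" using permutes_in_image[OF p, of i] by simp
      ultimately show "hreg (c (p i)) U (\<lambda>v. A v i (p i))" using assms by simp
    qed
    moreover have "(\<Sum>i = 0..<n. c (p i)) = (\<Sum>j<n. c j)"
      using sum.permute[OF p, of c] by (simp add: lessThan_atLeast0 o_def)
    ultimately show "hreg (\<Sum>j<n. c j) U (\<lambda>v. \<Prod>i = 0..<n. A v i (p i))" by simp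
  qed
  ultimately show ?thesis
    by (simp only:) (rule hreg_sum, simp)
qed

section \<open>Splitting of vector bundles given by cocycles\<close>

text \<open>If z lies over W, the numerator is divisible by the factor theorem; if not, the linear
  form has no zero over W and is a legitimate denominator.\<close>

lemma hreg_divide_lin:
  assumes s: "hreg b W s" and z: "z \<noteq> (0, 0)" and 0: "z \<in> cone W \<Longrightarrow> s z = 0"
  shows "\<exists>s'. hreg (b - 1) W s' \<and> (\<forall>v\<in>cone W. s v = lin z v * s' v)"
proof (cases "z \<in> cone W")
  case True
  obtain e F G where FG: "F \<in> Form (b + e)" "G \<in> Form e" "\<forall>v\<in>cone W. G v \<noteq> 0" "\<forall>v\<in>cone W. s v = F v / G v"
    by (rule hregE[OF s])
  have "F z = 0" using FG True 0 by simp
  then obtain F' where F': "F' \<in> Form (b + e - 1)" "\<And>w. F w = lin z w * F' w"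
    by (rule Form_zero_divisible[OF FG(1) z]) (rule that)
  have "hreg (b - 1) W (\<lambda>v. F' v / G v)"
    by (rule hregI[of F' _ e G]) (use F' FG in \<open>auto simp: algebra_simps\<close>)
  then show ?thesis using FG(4) F'(2) by (intro exI[of _ "\<lambda>v. F' v / G v"]) simp
next
  case False
  have nz: "lin z v \<noteq> 0" if "v \<in> cone W" for v
  proof
    assume "lin z v = 0"
    moreover have v: "v \<noteq> (0, 0)" using that by (simp add: cone_def)
    ultimately have "pt z = pt v" using lin_eq_0_iff[OF z v] pt_eq_iff[OF z v] by blast
    then show False using that False z by (simp add: cone_def)
  qed
  have "hreg (b - 1) W (\<lambda>v. s v / lin z v)"
    by (rule hreg_divide[OF s hreg_Form[OF lin_Form] nz])
  then show ?thesis using nz by (intro exI[of _ "\<lambda>v. s v / lin z v"]) simp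
qed

lemma nonzero_locus_nonempty:
  fixes F :: "'k::alg_closed_field \<times> 'k \<Rightarrow> 'k"
  assumes "F \<in> Form m" "F \<noteq> (\<lambda>_. 0)"
  shows "nonzero_locus F \<noteq> {}"
proof -
  obtain v where "v \<noteq> (0, 0)" "F v \<noteq> 0" by (rule Form_nonzero_point[OF assms])
  then have "pt v \<in> nonzero_locus F" using cone_nonzero_locus[OF assms(1), of v] by (simp add: cone_def)
  then show ?thesis by blast
qed

lemma open_Int2_nonempty:
  fixes A B :: "'k::alg_closed_field proj1 set"
  assumes "open A" "open B" "A \<noteq> {}" "B \<noteq> {}"
  shows "open (A \<inter> B)" "A \<inter> B \<noteq> {}"
  using assms open_Int_nonempty[OF assms] by auto

lemma open_Int3_nonempty:
  fixes A B C :: "'k::alg_closed_field proj1 set"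
  assumes "open A" "open B" "open C" "A \<noteq> {}" "B \<noteq> {}" "C \<noteq> {}"
  shows "open (A \<inter> B \<inter> C)" "A \<inter> B \<inter> C \<noteq> {}"
  using assms open_Int_nonempty[OF assms(1,2,4,5)] open_Int_nonempty[of "A \<inter> B" C] by auto

text \<open>Coordinate columns transform by h_c = g c c' h_c'. Finitely many charts permit common
  denominators, and nonempty ones always overlap.\<close>

locale cocycle =
  fixes n :: nat and C :: "'c set" and U :: "'c \<Rightarrow> 'k::alg_closed_field proj1 set"
    and g :: "'c \<Rightarrow> 'c \<Rightarrow> 'k \<times> 'k \<Rightarrow> nat \<Rightarrow> nat \<Rightarrow> 'k"
  assumes fin: "finite C" and U_open: "c \<in> C \<Longrightarrow> open (U c)" and U_ne: "c \<in> C \<Longrightarrow> U c \<noteq> {}"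
    and cover: "\<exists>c\<in>C. p \<in> U c"
    and g_hreg: "c \<in> C \<Longrightarrow> c' \<in> C \<Longrightarrow> i < n \<Longrightarrow> j < n \<Longrightarrow> hreg 0 (U c \<inter> U c') (\<lambda>v. g c c' v i j)"
    and g_id: "c \<in> C \<Longrightarrow> v \<in> cone (U c) \<Longrightarrow> i < n \<Longrightarrow> j < n \<Longrightarrow> g c c v i j = (if i = j then 1 else 0)"
    and g_cocycle: "c \<in> C \<Longrightarrow> c' \<in> C \<Longrightarrow> c'' \<in> C \<Longrightarrow> v \<in> cone (U c \<inter> U c' \<inter> U c'') \<Longrightarrow> i < n \<Longrightarrow> j < n \<Longrightarrow>
      (\<Sum>k<n. g c c' v i k * g c' c'' v k j) = g c c'' v i j"
begin

text \<open>Sections over \<open>W\<close> of the twist by \<open>\<O>(a)\<close> of the bundle with transition matrices \<open>g\<close>.\<close>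

definition twisted :: "int \<Rightarrow> 'k proj1 set \<Rightarrow> ('c \<Rightarrow> 'k \<times> 'k \<Rightarrow> nat \<Rightarrow> 'k) \<Rightarrow> bool" where
  "twisted a W h \<longleftrightarrow> (\<forall>c\<in>C. \<forall>i<n. hreg a (W \<inter> U c) (\<lambda>v. h c v i)) \<and>
    (\<forall>c\<in>C. \<forall>c'\<in>C. \<forall>v\<in>cone (W \<inter> U c \<inter> U c'). \<forall>i<n. h c v i = (\<Sum>j<n. g c c' v i j * h c' v j))"

lemma twisted_hreg: "twisted a W h \<Longrightarrow> c \<in> C \<Longrightarrow> i < n \<Longrightarrow> hreg a (W \<inter> U c) (\<lambda>v. h c v i)"
  by (simp add: twisted_def)

lemma twisted_compat: "twisted a W h \<Longrightarrow> c \<in> C \<Longrightarrow> c' \<in> C \<Longrightarrow> v \<in> cone (W \<inter> U c \<inter> U c') \<Longrightarrow> i < n \<Longrightarrow>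
    h c v i = (\<Sum>j<n. g c c' v i j * h c' v j)"
  by (simp add: twisted_def)

text \<open>Both sides of the compatibility are regular on the overlap of two charts, so by the
  identity theorem it may be checked on a nonempty open set.\<close>

lemma twistedI_generic:
  assumes h: "\<And>c i. c \<in> C \<Longrightarrow> i < n \<Longrightarrow> hreg a (U c) (\<lambda>v. h c v i)"
    and V: "open V" "V \<noteq> {}"
    and compat: "\<And>c c' v i. c \<in> C \<Longrightarrow> c' \<in> C \<Longrightarrow> v \<in> cone (U c \<inter> U c' \<inter> V) \<Longrightarrow> i < n \<Longrightarrow>
      h c v i = (\<Sum>j<n. g c c' v i j * h c' v j)"
  shows "twisted a UNIV h"
  unfolding twisted_def
proof (intro conjI ballI allI impI)
  fix c i assume "c \<in> C" "i < n"
  then show "hreg a (UNIV \<inter> U c) (\<lambda>v. h c v i)" using h by simp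
next
  fix c c' v i assume c: "c \<in> C" "c' \<in> C" and v: "v \<in> cone (UNIV \<inter> U c \<inter> U c')" and i: "i < n"
  have 1: "hreg a (U c \<inter> U c') (\<lambda>v. h c v i)"
    using h[OF c(1) i] by (rule hreg_mono) auto
  have 2: "hreg a (U c \<inter> U c') (\<lambda>v. \<Sum>j<n. g c c' v i j * h c' v j)"
  proof (rule hreg_sum)
    fix j assume j: "j \<in> {..<n}"
    have "hreg a (U c \<inter> U c') (\<lambda>v. h c' v j)"
      by (rule hreg_mono[OF h[OF c(2)]]) (use j in auto)
    then show "hreg a (U c \<inter> U c') (\<lambda>v. g c c' v i j * h c' v j)"
      using hreg_mult[OF g_hreg[OF c i, of j]] j by simp
  qed
  note ne = open_Int3_nonempty[OF U_open[OF c(1)] U_open[OF c(2)] V(1) U_ne[OF c(1)] U_ne[OF c(2)] V(2)]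
  show "h c v i = (\<Sum>j<n. g c c' v i j * h c' v j)"
    by (rule hreg_eqI[OF 1 2 ne]) (use compat[OF c _ i] v in auto)
qed

text \<open>Column j is a section of the bundle twisted by O(- a j), that is, a map from O(a j). A
  single point with nonzero determinant makes the determinant generically nonzero in every chart
  (\<open>frame_generic\<close>).\<close>

definition is_frame :: "(nat \<Rightarrow> int) \<Rightarrow> ('c \<Rightarrow> 'k \<times> 'k \<Rightarrow> nat \<Rightarrow> nat \<Rightarrow> 'k) \<Rightarrow> bool" where
  "is_frame a e \<longleftrightarrow> (\<forall>j<n. twisted (- a j) UNIV (\<lambda>c v i. e c v i j)) \<and>
    (\<exists>c\<in>C. \<exists>v\<in>cone (U c). detf n (e c v) \<noteq> 0)"

lemma frame_twisted: "is_frame a e \<Longrightarrow> j < n \<Longrightarrow> twisted (- a j) UNIV (\<lambda>c v i. e c v i j)"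
  by (simp add: is_frame_def)

lemma frame_hreg:
  assumes "is_frame a e" "c \<in> C" "i < n" "j < n"
  shows "hreg (- a j) (U c) (\<lambda>v. e c v i j)"
  using twisted_hreg[OF frame_twisted[OF assms(1,4)] assms(2,3)] by simp

lemma frame_detf_hreg:
  assumes "is_frame a e" "c \<in> C"
  shows "hreg (\<Sum>j<n. - a j) (U c) (\<lambda>v. detf n (e c v))"
  by (rule hreg_detf) (rule frame_hreg[OF assms])

lemma frame_compat:
  assumes "is_frame a e" "c \<in> C" "c' \<in> C" "v \<in> cone (U c \<inter> U c')" "i < n" "j < n"
  shows "e c v i j = (\<Sum>k<n. g c c' v i k * e c' v k j)"
  using twisted_compat[OF frame_twisted[OF assms(1,6)] assms(2,3) _ assms(5)] assms(4) by simp

lemma frame_detf: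
  assumes "is_frame a e" "c \<in> C" "c' \<in> C" "v \<in> cone (U c \<inter> U c')"
  shows "detf n (e c v) = detf n (g c c' v) * detf n (e c' v)"
  unfolding detf_mult[symmetric] by (rule detf_cong) (rule frame_compat[OF assms])

text \<open>A determinant vanishing on an open part of one chart vanishes on that chart, then on its
  overlap with any other, since determinants differ by that of the transition matrix, and so on
  every chart.\<close>

lemma frame_generic:
  assumes e: "is_frame a e" and c: "c \<in> C" and V: "open V" "V \<noteq> {}"
  obtains v where "v \<in> cone (U c \<inter> V)" "detf n (e c v) \<noteq> 0"
proof (rule ccontr)
  assume *: "\<not> thesis"
  have D: "detf n (e c v) = 0" if "v \<in> cone (U c)" for v
  proof (rule hreg_eqI[OF frame_detf_hreg[OF e c] hreg_zero _ _ _ _ that])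
    show "open (U c \<inter> V)" "U c \<inter> V \<noteq> {}"
      using open_Int2_nonempty[OF U_open[OF c] V(1) U_ne[OF c] V(2)] .
    show "detf n (e c v) = 0" if "v \<in> cone (U c \<inter> V)" for v
      using * \<open>\<And>v. v \<in> cone (U c \<inter> V) \<Longrightarrow> detf n (e c v) \<noteq> 0 \<Longrightarrow> thesis\<close> that by blast
  qed auto
  obtain c' v where c': "c' \<in> C" "v \<in> cone (U c')" "detf n (e c' v) \<noteq> 0"
    using e unfolding is_frame_def by blast
  have "detf n (e c' v) = 0"
  proof (rule hreg_eqI[OF frame_detf_hreg[OF e c'(1)] hreg_zero _ _ _ _ c'(2)])
    show "open (U c' \<inter> U c)" "U c' \<inter> U c \<noteq> {}"
      using open_Int2_nonempty[OF U_open[OF c'(1)] U_open[OF c] U_ne[OF c'(1)] U_ne[OF c]] .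
    show "detf n (e c' v) = 0" if "v \<in> cone (U c' \<inter> U c)" for v
      using frame_detf[OF e c'(1) c that] D that by (simp add: cone_Int)
  qed auto
  then show False using c' by blast
qed

section \<open>Existence of a frame and the bound on its degrees\<close>

lemma obtain_chart: obtains c where "c \<in> C"
  using cover by blast

text \<open>The unit vectors of the chart \<open>c0\<close> have the columns of
  \<open>g c c0\<close> as coordinates elsewhere, possibly with poles outside \<open>U c0\<close>.
  One form \<open>H\<close> of degree N clears the poles and makes them global sections of the twist
  by O(N).\<close>

lemma frame_exists: "\<exists>a e. is_frame a e"
proof -
  obtain c0 where c0: "c0 \<in> C" using obtain_chart .
  define I where "I = C \<times> {..<n} \<times> {..<n}"
  have "\<exists>N. \<exists>H\<in>Form N. H \<noteq> (\<lambda>_. 0) \<and>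
    (\<forall>x\<in>I. \<exists>h. hreg N (U (fst x)) h \<and>
      (\<forall>v\<in>cone (U (fst x) \<inter> U c0). h v = H v * g (fst x) c0 v (fst (snd x)) (snd (snd x))))"
  proof (rule hreg_clear_poles)
    show "finite I" using fin by (simp add: I_def)
    fix x assume "x \<in> I"
    then have x: "fst x \<in> C" "fst (snd x) < n" "snd (snd x) < n" by (auto simp: I_def)
    show "hreg 0 (U (fst x) \<inter> U c0) (\<lambda>v. g (fst x) c0 v (fst (snd x)) (snd (snd x)))"
      by (rule g_hreg[OF x(1) c0 x(2,3)])
    show "U (fst x) \<inter> U c0 \<noteq> {}"
      using open_Int_nonempty[OF U_open[OF x(1)] U_open[OF c0] U_ne[OF x(1)] U_ne[OF c0]] .
  qed
  then obtain N H where H: "H \<in> Form N" "H \<noteq> (\<lambda>_. 0)" and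
    "\<forall>x\<in>I. \<exists>h. hreg N (U (fst x)) h \<and>
      (\<forall>v\<in>cone (U (fst x) \<inter> U c0). h v = H v * g (fst x) c0 v (fst (snd x)) (snd (snd x)))" by blast
  from bchoice[OF this(3)] obtain h where h: "\<forall>x\<in>I. hreg N (U (fst x)) (h x) \<and>
      (\<forall>v\<in>cone (U (fst x) \<inter> U c0). h x v = H v * g (fst x) c0 v (fst (snd x)) (snd (snd x)))" by blast
  define e where "e c v i j = h (c, i, j) v" for c v i j
  have e1: "hreg N (U c) (\<lambda>v. e c v i j)" if "c \<in> C" "i < n" "j < n" for c i j
    using h[rule_format, of "(c, i, j)"] that by (simp add: I_def e_def)
  have e2: "e c v i j = H v * g c c0 v i j" if "c \<in> C" "i < n" "j < n" "v \<in> cone (U c \<inter> U c0)" for c v i j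
    using h[rule_format, of "(c, i, j)"] that by (simp add: I_def e_def)
  have "is_frame (\<lambda>_. - N) e"
    unfolding is_frame_def
  proof (intro conjI allI impI)
    fix j assume j: "j < n"
    show "twisted (- (- N)) UNIV (\<lambda>c v i. e c v i j)"
    proof (rule twistedI_generic[OF _ U_open[OF c0] U_ne[OF c0]])
      fix c c' v i assume *: "c \<in> C" "c' \<in> C" "v \<in> cone (U c \<inter> U c' \<inter> U c0)" "i < n"
      then have v: "v \<in> cone (U c \<inter> U c0)" "v \<in> cone (U c' \<inter> U c0)" by (auto simp: cone_Int)
      have "(\<Sum>k<n. g c c' v i k * e c' v k j) = (\<Sum>k<n. H v * (g c c' v i k * g c' c0 v k j))"
        using e2[OF *(2) _ j v(2)] by (intro sum.cong) auto
      also have "\<dots> = H v * g c c0 v i j"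
        using g_cocycle[OF *(1,2) c0 *(3,4) j] by (simp add: sum_distrib_left[symmetric])
      finally show "e c v i j = (\<Sum>k<n. g c c' v i k * e c' v k j)"
        using e2[OF *(1,4) j v(1)] by simp
    qed (use e1 j in simp)
  next
    have "open (U c0 \<inter> nonzero_locus H)" "U c0 \<inter> nonzero_locus H \<noteq> {}"
      using open_Int2_nonempty[OF U_open[OF c0] open_nonzero_locus[OF H(1)] U_ne[OF c0]
        nonzero_locus_nonempty[OF H]] .
    then obtain v where v: "v \<in> cone (U c0 \<inter> nonzero_locus H)" using cone_nonempty[of "U c0 \<inter> nonzero_locus H"] by blast
    then have Hv: "H v \<noteq> 0" "v \<in> cone (U c0)"
      using cone_nonzero_locus[OF H(1)] by (auto simp: cone_Int)
    \<comment> \<open>Over \<open>c0\<close> the frame is \<open>H\<close> times the identity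
      matrix.\<close>
    have "detf n (e c0 v) \<noteq> 0"
    proof
      assume "detf n (e c0 v) = 0"
      then obtain x k where x: "k < n" "x k \<noteq> 0" "\<forall>i<n. (\<Sum>j<n. e c0 v i j * x j) = 0"
        by (rule detf_kernel) (rule that)
      have "(\<Sum>j<n. e c0 v k j * x j) = (\<Sum>j<n. if k = j then H v * x k else 0)"
        using e2[OF c0 x(1)] g_id[OF c0 Hv(2) x(1)] Hv(2) by (intro sum.cong) auto
      then show False using x Hv by simp
    qed
    then show "\<exists>c\<in>C. \<exists>v\<in>cone (U c). detf n (e c v) \<noteq> 0" using c0 Hv by blast
  qed
  then show ?thesis by blast
qed

text \<open>Agreement with one chart spreads to all pairs of charts, because the overlap of three
  charts is never empty; the glued function is a global section and hence a form.\<close>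

lemma global_Form:
  assumes c0: "c0 \<in> C" and s: "\<And>c. c \<in> C \<Longrightarrow> hreg b (U c) (s c)"
    and eq: "\<And>c v. c \<in> C \<Longrightarrow> v \<in> cone (U c \<inter> U c0) \<Longrightarrow> s c v = s c0 v"
  obtains F where "F \<in> Form b" "\<And>c v. c \<in> C \<Longrightarrow> v \<in> cone (U c) \<Longrightarrow> s c v = F v"
proof -
  define S where "S v = s (SOME c. c \<in> C \<and> pt v \<in> U c) v" for v
  have S: "S v = s c v" if c: "c \<in> C" and v: "v \<in> cone (U c)" for c v
  proof -
    define c' where "c' = (SOME c. c \<in> C \<and> pt v \<in> U c)"
    have "\<exists>c. c \<in> C \<and> pt v \<in> U c" using cover by blast
    then have "c' \<in> C \<and> pt v \<in> U c'" unfolding c'_def by (rule someI_ex)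
    then have c': "c' \<in> C" "v \<in> cone (U c')" using v by (auto simp: cone_def)
    have "s c' v = s c v"
    proof (rule hreg_eqI)
      show "hreg b (U c' \<inter> U c) (s c')" "hreg b (U c' \<inter> U c) (s c)"
        using hreg_mono[OF s[OF c'(1)]] hreg_mono[OF s[OF c]] by auto
      show "open (U c' \<inter> U c \<inter> U c0)" "U c' \<inter> U c \<inter> U c0 \<noteq> {}"
        using open_Int3_nonempty[OF U_open[OF c'(1)] U_open[OF c] U_open[OF c0]
          U_ne[OF c'(1)] U_ne[OF c] U_ne[OF c0]] .
      show "s c' w = s c w" if "w \<in> cone (U c' \<inter> U c \<inter> U c0)" for w
        using eq[OF c'(1), of w] eq[OF c, of w] that by (simp add: cone_Int)
      show "v \<in> cone (U c' \<inter> U c)" using v c' by (simp add: cone_Int)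
    qed auto
    then show ?thesis by (simp add: S_def c'_def)
  qed
  have "hreg b UNIV S"
  proof (rule hreg_local)
    fix v :: "'k \<times> 'k" assume "v \<in> cone UNIV"
    obtain c where c: "c \<in> C" "pt v \<in> U c" using cover by blast
    then have "v \<in> cone (U c)" using \<open>v \<in> cone UNIV\<close> by (simp add: cone_def)
    moreover have "hreg b (U c) S"
      using s[OF c(1)] S[OF c(1)] hreg_cong[of "U c" S "s c"] by blast
    ultimately show "\<exists>V. open V \<and> v \<in> cone V \<and> hreg b V S" using U_open[OF c(1)] by blast
  qed simp
  then obtain F where F: "F \<in> Form b" "\<And>v. v \<noteq> (0, 0) \<Longrightarrow> S v = F v"
    by (rule hreg_UNIV) (rule that)
  show thesis
  proof (rule that[OF F(1)])
    fix c v assume "c \<in> C" "v \<in> cone (U c)"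
    then show "s c v = F v" using S F(2)[of v] by (simp add: cone_def)
  qed
qed

text \<open>
  A frame with degrees \<open>- a j\<close> has a determinant, which after multiplication with a fixed section
  of the dual determinant bundle becomes a form; so its degree is not negative.
\<close>

lemma frame_degree_bound: "\<exists>M. \<forall>a e. is_frame a e \<longrightarrow> (\<Sum>j<n. a j) \<le> M"
proof -
  obtain c0 where c0: "c0 \<in> C" using obtain_chart .
  have gd: "hreg 0 (U c \<inter> U c0) (\<lambda>v. detf n (g c0 c v))" if "c \<in> C" for c
    using hreg_detf[of n "\<lambda>_. 0" "U c \<inter> U c0" "g c0 c"] g_hreg[OF c0 that] by (simp add: Int_commute)
  have "\<exists>N. \<exists>H\<in>Form N. H \<noteq> (\<lambda>_. 0) \<and>
    (\<forall>c\<in>C. \<exists>h. hreg N (U c) h \<and> (\<forall>v\<in>cone (U c \<inter> U c0). h v = H v * detf n (g c0 c v)))"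
  proof (rule hreg_clear_poles[OF fin gd])
    fix c assume c: "c \<in> C"
    show "U c \<inter> U c0 \<noteq> {}"
      using open_Int_nonempty[OF U_open[OF c] U_open[OF c0] U_ne[OF c] U_ne[OF c0]] .
  qed
  then obtain N H where H: "H \<in> Form N" "H \<noteq> (\<lambda>_. 0)" and
    "\<forall>c\<in>C. \<exists>h. hreg N (U c) h \<and> (\<forall>v\<in>cone (U c \<inter> U c0). h v = H v * detf n (g c0 c v))" by blast
  \<comment> \<open>\<open>\<kappa>\<close> is the section of the dual determinant bundle, twisted
    by O(N), that equals \<open>H\<close> over \<open>c0\<close>; its pairing with the determinant
    of a frame is independent of the chart.\<close>
  from bchoice[OF this(3)] obtain \<kappa> where \<kappa>: "\<forall>c\<in>C. hreg N (U c) (\<kappa> c) \<and>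
    (\<forall>v\<in>cone (U c \<inter> U c0). \<kappa> c v = H v * detf n (g c0 c v))" by blast
  have "(\<Sum>j<n. a j) \<le> N" if e: "is_frame a e" for a e
  proof -
    define s where "s c v = \<kappa> c v * detf n (e c v)" for c v
    have s: "hreg (N + (\<Sum>j<n. - a j)) (U c) (s c)" if "c \<in> C" for c
      unfolding s_def using \<kappa> that by (intro hreg_mult frame_detf_hreg[OF e]) auto
    have s0: "s c v = H v * detf n (e c0 v)" if "c \<in> C" "v \<in> cone (U c \<inter> U c0)" for c v
    proof -
      have "detf n (e c0 v) = detf n (g c0 c v) * detf n (e c v)"
        using that by (intro frame_detf[OF e c0]) (auto simp: Int_commute)
      then show ?thesis using \<kappa> that by (simp add: s_def)
    qed
    have "s c v = s c0 v" if "c \<in> C" "v \<in> cone (U c \<inter> U c0)" for c v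
      using s0[OF that] s0[OF c0, of v] that by (simp add: cone_Int)
    from global_Form[OF c0 s this] obtain F where
      F: "F \<in> Form (N + (\<Sum>j<n. - a j))" "\<And>c v. c \<in> C \<Longrightarrow> v \<in> cone (U c) \<Longrightarrow> s c v = F v" by metis
    obtain v where v: "v \<in> cone (U c0 \<inter> nonzero_locus H)" "detf n (e c0 v) \<noteq> 0"
      by (rule frame_generic[OF e c0 open_nonzero_locus[OF H(1)] nonzero_locus_nonempty[OF H]])
    then have Hv: "H v \<noteq> 0" "v \<in> cone (U c0)" using cone_nonzero_locus[OF H(1)] by (auto simp: cone_Int)
    then have "F v = H v * detf n (e c0 v)" using F(2)[OF c0, of v] s0[OF c0, of v] by simp
    then have "F v \<noteq> 0" using Hv(1) v(2) by simp
    then have "\<not> N + (\<Sum>j<n. - a j) < 0" using Form_neg[OF F(1)] by auto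
    then show ?thesis by (simp add: sum_negf)
  qed
  then show ?thesis by blast
qed

text \<open>
  At a point where the frame is dependent, the section of lowest twist in a relation can be replaced by
  a combination of all of them that is divisible by the linear form of the point.
\<close>

lemma frame_improve:
  assumes e: "is_frame a e" and c0: "c0 \<in> C" and z: "z \<in> cone (U c0)" and D: "detf n (e c0 z) = 0"
  shows "\<exists>a' e'. is_frame a' e' \<and> (\<Sum>j<n. a' j) = (\<Sum>j<n. a j) + 1"
proof -
  have z0: "z \<noteq> (0, 0)" using z by (simp add: cone_def)
  obtain x k where x: "k < n" "x k \<noteq> 0" "\<forall>i<n. (\<Sum>j<n. e c0 z i j * x j) = 0"
    by (rule detf_kernel[OF D]) (rule that)
  define K where "K = {j. j < n \<and> x j \<noteq> 0}"
  have "finite K" "K \<noteq> {}" using x by (auto simp: K_def)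
  then have "\<exists>m\<in>K. \<forall>j\<in>K. a m \<le> a j"
    using arg_min_if_finite[of K a] by (metis leI)
  then obtain m where m: "m < n" "x m \<noteq> 0" "\<And>j. j < n \<Longrightarrow> x j \<noteq> 0 \<Longrightarrow> a m \<le> a j"
    by (auto simp: K_def)
  obtain L where L: "L \<in> Form 1" "L z = 1" by (rule linear_form_at[OF z0])
  \<comment> \<open>The powers of \<open>L\<close> bring all summands to the twist of the m-th
    section, and \<open>L z = 1\<close> keeps the relation at z. Minimality of \<open>a m\<close>
    makes the exponents nonnegative wherever \<open>x j\<close> is nonzero.\<close>
  define y where "y j = (\<lambda>v. x j * L v ^ nat (a j - a m))" for j
  have y: "y j \<in> Form (a j - a m)" if "j < n" for j
  proof (cases "x j = 0")
    case False
    then have "(\<lambda>v. L v ^ nat (a j - a m)) \<in> Form (a j - a m)"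
      using Form_power[OF L(1), of "nat (a j - a m)"] m(3)[OF that] by simp
    then show ?thesis unfolding y_def by (rule Form_scale)
  qed (simp add: y_def)
  define h where "h c v i = (\<Sum>j<n. e c v i j * y j v)" for c v i
  have h: "hreg (- a m) (U c) (\<lambda>v. h c v i)" if "c \<in> C" "i < n" for c i
    unfolding h_def
  proof (rule hreg_sum)
    fix j assume "j \<in> {..<n}"
    then show "hreg (- a m) (U c) (\<lambda>v. e c v i j * y j v)"
      using hreg_mult[OF frame_hreg[OF e that, of j] hreg_Form[OF y[of j]]] by simp
  qed
  have hc: "h c v i = (\<Sum>k<n. g c c' v i k * h c' v k)"
    if "c \<in> C" "c' \<in> C" "v \<in> cone (U c \<inter> U c')" "i < n" for c c' v i
  proof -
    have "h c v i = (\<Sum>j<n. \<Sum>k<n. g c c' v i k * e c' v k j * y j v)"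
      unfolding h_def using frame_compat[OF e that] by (intro sum.cong) (auto simp: sum_distrib_right)
    also have "\<dots> = (\<Sum>k<n. g c c' v i k * h c' v k)"
      unfolding h_def by (subst sum.swap) (simp add: sum_distrib_left mult.assoc)
    finally show ?thesis .
  qed
  have hz: "h c z i = 0" if "c \<in> C" "i < n" "z \<in> cone (U c)" for c i
  proof -
    have "h c0 z k = 0" if "k < n" for k
      using x(3) that by (simp add: h_def y_def L(2))
    then show ?thesis using hc[OF that(1) c0 _ that(2), of z] that z by (simp add: cone_Int)
  qed
  have "\<forall>c\<in>C. \<forall>i\<in>{..<n}. \<exists>s. hreg (- a m - 1) (U c) s \<and> (\<forall>v\<in>cone (U c). h c v i = lin z v * s v)"
    using hreg_divide_lin[OF h z0] hz by simp
  then have "\<forall>c\<in>C. \<exists>s. \<forall>i\<in>{..<n}. hreg (- a m - 1) (U c) (s i) \<and>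
      (\<forall>v\<in>cone (U c). h c v i = lin z v * s i v)"
    by (intro ballI bchoice) simp
  from bchoice[OF this] obtain s where s: "\<And>c i. c \<in> C \<Longrightarrow> i < n \<Longrightarrow> hreg (- a m - 1) (U c) (s c i)"
    "\<And>c i v. c \<in> C \<Longrightarrow> i < n \<Longrightarrow> v \<in> cone (U c) \<Longrightarrow> h c v i = lin z v * s c i v"
    by (metis lessThan_iff)
  \<comment> \<open>Division by the linear form of z lowers the degree of the m-th section by one,
    which raises \<open>a m\<close> by one.\<close>
  define e' where "e' c v i j = (if j = m then s c i v else e c v i j)" for c v i j
  define a' where "a' = a(m := a m + 1)"
  have lz: "open (nonzero_locus (lin z))" "nonzero_locus (lin z) \<noteq> {}"
    using open_nonzero_locus[OF lin_Form] nonzero_locus_nonempty[OF lin_Form lin_nonzero[OF z0]] .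
  have nz: "lin z v \<noteq> 0" if "v \<in> cone (nonzero_locus (lin z))" for v
    using cone_nonzero_locus[OF lin_Form] that by blast
  have "is_frame a' e'"
    unfolding is_frame_def
  proof (intro conjI allI impI)
    fix j assume j: "j < n"
    show "twisted (- a' j) UNIV (\<lambda>c v i. e' c v i j)"
    proof (cases "j = m")
      case False
      then show ?thesis using frame_twisted[OF e j] by (simp add: e'_def a'_def)
    next
      case True
      have "twisted (- a m - 1) UNIV (\<lambda>c v i. s c i v)"
      proof (rule twistedI_generic[OF s(1) lz])
        fix c c' v i assume *: "c \<in> C" "c' \<in> C" "v \<in> cone (U c \<inter> U c' \<inter> nonzero_locus (lin z))" "i < n"
        then have v: "v \<in> cone (U c)" "v \<in> cone (U c')" "lin z v \<noteq> 0" "v \<in> cone (U c \<inter> U c')"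
          using nz by (auto simp: cone_Int)
        have "lin z v * s c i v = (\<Sum>k<n. g c c' v i k * (lin z v * s c' k v))"
          using hc[OF *(1,2) v(4) *(4)] s(2)[OF *(1,4) v(1)] s(2)[OF *(2) _ v(2)]
          by (simp cong: sum.cong_simp)
        also have "\<dots> = lin z v * (\<Sum>k<n. g c c' v i k * s c' k v)"
          by (simp add: sum_distrib_left algebra_simps)
        finally show "s c i v = (\<Sum>k<n. g c c' v i k * s c' k v)" using v(3) by simp
      qed
      then show ?thesis using True by (simp add: e'_def a'_def)
    qed
  next
    obtain v where v: "v \<in> cone (U c0 \<inter> nonzero_locus (lin z))" "detf n (e c0 v) \<noteq> 0"
      by (rule frame_generic[OF e c0 lz])
    then have v': "v \<in> cone (U c0)" "lin z v \<noteq> 0" using nz by (auto simp: cone_Int)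
    have "L v ^ nat (a m - a m) = 1" by simp
    have "detf n (e' c0 v) = detf n (\<lambda>i j. if j = m then s c0 i v else e c0 v i j)"
      unfolding e'_def by (rule refl)
    \<comment> \<open>By Cramer's rule only the coefficient of the replaced section matters;
      \<open>y m\<close> is the nonzero constant \<open>x m\<close>, so the result is again a
      frame.\<close>
    also have "\<dots> = y m v / lin z v * detf n (e c0 v)"
    proof (rule detf_cramer[OF m(1)])
      fix i assume i: "i < n"
      have "lin z v * s c0 i v = (\<Sum>j<n. e c0 v i j * y j v)"
        using s(2)[OF c0 i v'(1)] by (simp add: h_def)
      then have "s c0 i v = (\<Sum>j<n. e c0 v i j * y j v) / lin z v"
        using v'(2) by (simp add: field_simps)
      then show "s c0 i v = (\<Sum>j<n. e c0 v i j * (y j v / lin z v))"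
        by (simp add: sum_divide_distrib)
    qed
    finally have "detf n (e' c0 v) \<noteq> 0" using v v' m(2) by (simp add: y_def)
    then show "\<exists>c\<in>C. \<exists>v\<in>cone (U c). detf n (e' c v) \<noteq> 0" using c0 v' by blast
  qed
  moreover have "(\<Sum>j<n. a' j) = (\<Sum>j<n. a j) + 1"
  proof -
    have "(\<Sum>j<n. a' j) = a' m + (\<Sum>j\<in>{..<n} - {m}. a' j)"
      using m(1) by (intro sum.remove) auto
    also have "(\<Sum>j\<in>{..<n} - {m}. a' j) = (\<Sum>j\<in>{..<n} - {m}. a j)"
      by (intro sum.cong) (auto simp: a'_def)
    also have "a' m + \<dots> = (a m + (\<Sum>j\<in>{..<n} - {m}. a j)) + 1" by (simp add: a'_def)
    also have "a m + (\<Sum>j\<in>{..<n} - {m}. a j) = (\<Sum>j<n. a j)"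
      using m(1) by (intro sum.remove[symmetric]) auto
    finally show ?thesis .
  qed
  ultimately show ?thesis by blast
qed

text \<open>Each improvement raises the bounded sum of the \<open>a j\<close> by one, so the process
  ends with a frame independent at every point.\<close>

lemma splitting_frame_exists:
  "\<exists>a e. is_frame a e \<and> (\<forall>c\<in>C. \<forall>v\<in>cone (U c). detf n (e c v) \<noteq> 0)"
proof -
  obtain M where M: "\<And>a e. is_frame a e \<Longrightarrow> (\<Sum>j<n. a j) \<le> M" using frame_degree_bound by blast
  have "\<exists>a e. is_frame a e \<and> (\<forall>c\<in>C. \<forall>v\<in>cone (U c). detf n (e c v) \<noteq> 0)" if "is_frame a e" for a e
    using that
  proof (induction "nat (M - (\<Sum>j<n. a j))" arbitrary: a e rule: less_induct)
    case less
    show ?case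
    proof (cases "\<forall>c\<in>C. \<forall>v\<in>cone (U c). detf n (e c v) \<noteq> 0")
      case False
      then obtain c v where "c \<in> C" "v \<in> cone (U c)" "detf n (e c v) = 0" by blast
      from frame_improve[OF less.prems this] obtain a' e' where
        e': "is_frame a' e'" "(\<Sum>j<n. a' j) = (\<Sum>j<n. a j) + 1" by blast
      show ?thesis
        by (rule less.hyps[OF _ e'(1)]) (use M[OF e'(1)] e'(2) in simp)
    qed (use less in blast)
  qed
  then show ?thesis using frame_exists by blast
qed

text \<open>Cramer's quotients are the coordinates. The replaced column contributes degree 0 instead
  of - a k, so they have degree a k; being unique at each point, they do not depend on the chart and
  glue.\<close>

lemma splitting_frame_coordinates:
  assumes e: "is_frame a e" and D: "\<forall>c\<in>C. \<forall>v\<in>cone (U c). detf n (e c v) \<noteq> 0"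
    and W: "open W" and t: "twisted 0 W t"
  obtains s where "\<And>j. j < n \<Longrightarrow> hreg (a j) W (s j)"
    "\<And>c v i. c \<in> C \<Longrightarrow> v \<in> cone (W \<inter> U c) \<Longrightarrow> i < n \<Longrightarrow> t c v i = (\<Sum>j<n. e c v i j * s j v)"
proof -
  define x where "x c k v = detf n (\<lambda>i j. if j = k then t c v i else e c v i j) / detf n (e c v)" for c k v
  have x1: "hreg (a k) (W \<inter> U c) (x c k)" if c: "c \<in> C" and k: "k < n" for c k
  proof -
    have "hreg (\<Sum>j<n. if j = k then 0 else - a j) (W \<inter> U c) (\<lambda>v. detf n (\<lambda>i j. if j = k then t c v i else e c v i j))"
    proof (rule hreg_detf)
      fix i j assume ij: "i < n" "j < n"
      have "hreg (- a j) (W \<inter> U c) (\<lambda>v. e c v i j)"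
        using frame_hreg[OF e c ij] by (rule hreg_mono) simp
      then show "hreg (if j = k then 0 else - a j) (W \<inter> U c) (\<lambda>v. if j = k then t c v i else e c v i j)"
        using twisted_hreg[OF t c ij(1)] by simp
    qed
    moreover have "hreg (\<Sum>j<n. - a j) (W \<inter> U c) (\<lambda>v. detf n (e c v))"
      using frame_detf_hreg[OF e c] by (rule hreg_mono) simp
    ultimately have "hreg ((\<Sum>j<n. if j = k then 0 else - a j) - (\<Sum>j<n. - a j)) (W \<inter> U c) (x c k)"
      unfolding x_def using D c by (intro hreg_divide) (auto simp: cone_Int)
    moreover have "(\<Sum>j<n. if j = k then 0 else - a j) - (\<Sum>j<n. - a j) = a k"
    proof -
      have "(\<Sum>j<n. if j = k then 0 else - a j) - (\<Sum>j<n. - a j) = (\<Sum>j<n. if j = k then a j else 0)"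
        unfolding sum_subtractf[symmetric] by (intro sum.cong) auto
      then show ?thesis using k by simp
    qed
    ultimately show ?thesis by simp
  qed
  have x2: "x c k v = u k" if c: "c \<in> C" and v: "v \<in> cone (U c)" and k: "k < n"
    and u: "\<And>i. i < n \<Longrightarrow> t c v i = (\<Sum>j<n. e c v i j * u j)" for c k v u
  proof -
    have "detf n (\<lambda>i j. if j = k then t c v i else e c v i j) = u k * detf n (e c v)"
      by (rule detf_cramer[OF k u])
    then show ?thesis using D c v by (simp add: x_def)
  qed
  have x3: "t c v i = (\<Sum>j<n. e c v i j * x c j v)" if c: "c \<in> C" and v: "v \<in> cone (U c)" and i: "i < n" for c v i
  proof -
    have "detf n (e c v) \<noteq> 0" using D c v by blast
    then obtain u where u: "\<forall>i<n. (\<Sum>j<n. e c v i j * u j) = t c v i"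
      by (rule detf_solve) (rule that)
    then have "x c j v = u j" if "j < n" for j using x2[OF c v that, of u] by simp
    then show ?thesis using u i by simp
  qed
  have x4: "x c k v = x c' k v" if c: "c \<in> C" "c' \<in> C" and v: "v \<in> cone (W \<inter> U c \<inter> U c')" and k: "k < n" for c c' k v
  proof (rule x2[OF c(1) _ k])
    show "v \<in> cone (U c)" using v by (simp add: cone_Int)
    have v': "v \<in> cone (U c')" "v \<in> cone (U c \<inter> U c')" using v by (simp_all add: cone_Int)
    fix i assume i: "i < n"
    have "t c v i = (\<Sum>l<n. g c c' v i l * t c' v l)" by (rule twisted_compat[OF t c v i])
    also have "\<dots> = (\<Sum>l<n. \<Sum>j<n. g c c' v i l * e c' v l j * x c' j v)"
      using x3[OF c(2) v'(1)] by (intro sum.cong) (auto simp: sum_distrib_left mult.assoc)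
    also have "\<dots> = (\<Sum>j<n. (\<Sum>l<n. g c c' v i l * e c' v l j) * x c' j v)"
      by (subst sum.swap) (simp add: sum_distrib_right)
    also have "\<dots> = (\<Sum>j<n. e c v i j * x c' j v)"
      using frame_compat[OF e c v'(2) i] by (intro sum.cong) auto
    finally show "t c v i = (\<Sum>j<n. e c v i j * x c' j v)" .
  qed
  define s where "s k v = x (SOME c. c \<in> C \<and> pt v \<in> U c) k v" for k v
  have s: "s k v = x c k v" if c: "c \<in> C" and v: "v \<in> cone (W \<inter> U c)" and k: "k < n" for c v k
  proof -
    define c' where "c' = (SOME c. c \<in> C \<and> pt v \<in> U c)"
    have "\<exists>c. c \<in> C \<and> pt v \<in> U c" using cover by blast
    then have "c' \<in> C \<and> pt v \<in> U c'" unfolding c'_def by (rule someI_ex)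
    then have c': "c' \<in> C" "v \<in> cone (W \<inter> U c' \<inter> U c)" using v by (auto simp: cone_def)
    then show ?thesis using x4[OF c'(1) c c'(2) k] by (simp add: s_def c'_def)
  qed
  show thesis
  proof (rule that[of s])
    fix k assume k: "k < n"
    show "hreg (a k) W (s k)"
    proof (rule hreg_local[OF W])
      fix v assume v: "v \<in> cone W"
      obtain c where c: "c \<in> C" "pt v \<in> U c" using cover by blast
      then have "v \<in> cone (W \<inter> U c)" using v by (simp add: cone_def)
      moreover have "hreg (a k) (W \<inter> U c) (s k)"
        using x1[OF c(1) k] s[OF c(1) _ k] hreg_cong[of "W \<inter> U c" "s k" "x c k"] by blast
      ultimately show "\<exists>V. open V \<and> v \<in> cone V \<and> hreg (a k) V (s k)"
        using U_open[OF c(1)] W by blast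
    qed
  next
    fix c v i assume *: "c \<in> C" "v \<in> cone (W \<inter> U c)" "i < n"
    have "t c v i = (\<Sum>j<n. e c v i j * x c j v)" using x3[OF *(1) _ *(3)] *(2) by (simp add: cone_Int)
    also have "\<dots> = (\<Sum>j<n. e c v i j * s j v)" using s[OF *(1,2)] by (intro sum.cong) auto
    finally show "t c v i = (\<Sum>j<n. e c v i j * s j v)" .
  qed
qed

lemma frame_combination_twisted:
  assumes e: "is_frame a e" and s: "\<And>j. j < n \<Longrightarrow> hreg (a j) W (s j)"
  shows "twisted 0 W (\<lambda>c v i. \<Sum>j<n. e c v i j * s j v)"
  unfolding twisted_def
proof (intro conjI ballI allI impI)
  fix c i assume ci: "c \<in> C" "i < n"
  show "hreg 0 (W \<inter> U c) (\<lambda>v. \<Sum>j<n. e c v i j * s j v)"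
  proof (rule hreg_sum)
    fix j assume "j \<in> {..<n}"
    then have "hreg (- a j) (W \<inter> U c) (\<lambda>v. e c v i j)" "hreg (a j) (W \<inter> U c) (s j)"
      using hreg_mono[OF frame_hreg[OF e ci]] hreg_mono[OF s] by auto
    from hreg_mult[OF this] show "hreg 0 (W \<inter> U c) (\<lambda>v. e c v i j * s j v)" by simp
  qed
next
  fix c c' v i assume *: "c \<in> C" "c' \<in> C" "v \<in> cone (W \<inter> U c \<inter> U c')" "i < n"
  then have v: "v \<in> cone (U c \<inter> U c')" by (simp add: cone_Int)
  have "(\<Sum>j<n. e c v i j * s j v) = (\<Sum>j<n. \<Sum>k<n. g c c' v i k * e c' v k j * s j v)"
    using frame_compat[OF e *(1,2) v *(4)] by (intro sum.cong) (auto simp: sum_distrib_right)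
  also have "\<dots> = (\<Sum>k<n. g c c' v i k * (\<Sum>j<n. e c' v k j * s j v))"
    by (subst sum.swap) (simp add: sum_distrib_left mult.assoc)
  finally show "(\<Sum>j<n. e c v i j * s j v) = (\<Sum>k<n. g c c' v i k * (\<Sum>j<n. e c' v k j * s j v))" .
qed

end

section \<open>Morphisms are given by forms\<close>

lemma morphism_continuous: "is_morphism f \<Longrightarrow> continuous_on UNIV f"
  by (simp add: is_morphism_def)

lemma morphism_open_vimage: "is_morphism f \<Longrightarrow> open U \<Longrightarrow> open (f -` U)"
  using morphism_continuous[of f] by (simp add: continuous_on_open_vimage)

lemma morphism_pullback_regular:
  "is_morphism f \<Longrightarrow> open V \<Longrightarrow> regular_on V g \<Longrightarrow> regular_on (f -` V) (g \<circ> f)"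
  by (simp add: is_morphism_def)

text \<open>A/B is regular where B is nonzero, so its pullback under a morphism is regular and hence
  a single fraction of forms of equal degree.\<close>

lemma morphism_pullback_fraction:
  fixes f :: "'k::alg_closed_field proj1 \<Rightarrow> 'k proj1"
  assumes f: "is_morphism f" and A: "A \<in> Form 1" and B: "B \<in> Form 1"
  obtains e F G where "F \<in> Form e" "G \<in> Form e"
    "\<And>v w. v \<noteq> (0, 0) \<Longrightarrow> w \<noteq> (0, 0) \<Longrightarrow> f (pt v) = pt w \<Longrightarrow> B w \<noteq> 0 \<Longrightarrow> G v \<noteq> 0 \<and> A w / B w = F v / G v"
proof -
  let ?V = "nonzero_locus B"
  have V: "open ?V" by (rule open_nonzero_locus[OF B])
  have "hreg (1 - 1) ?V (\<lambda>w. A w / B w)"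
    by (rule hreg_divide[OF hreg_Form[OF A] hreg_Form[OF B]]) (use cone_nonzero_locus[OF B] in blast)
  then have "hreg 0 ?V (\<lambda>w. A w / B w)" by simp
  define g where "g = desc ?V (\<lambda>w. A w / B w)"
  have g: "regular_on ?V g" "\<And>v. v \<in> cone ?V \<Longrightarrow> g (pt v) = A v / B v"
    unfolding g_def by (rule desc_regular[OF V \<open>hreg 0 ?V _\<close>], rule desc_pt[OF \<open>hreg 0 ?V _\<close>])
  have "regular_on (f -` ?V) (g \<circ> f)" by (rule morphism_pullback_regular[OF f V g(1)])
  then have "hreg 0 (f -` ?V) (\<lambda>v. g (f (pt v)))"
    using regular_on_iff_hreg[OF morphism_open_vimage[OF f V], of "g \<circ> f"] by simp
  then obtain e F G where FG: "F \<in> Form (0 + e)" "G \<in> Form e" "\<forall>v\<in>cone (f -` ?V). G v \<noteq> 0"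
    "\<forall>v\<in>cone (f -` ?V). g (f (pt v)) = F v / G v" by (rule hregE)
  show thesis
  proof (rule that[of F e G])
    fix v w :: "'k \<times> 'k"
    assume *: "v \<noteq> (0, 0)" "w \<noteq> (0, 0)" "f (pt v) = pt w" "B w \<noteq> 0"
    then have w: "w \<in> cone ?V" using cone_nonzero_locus[OF B] by blast
    then have v: "v \<in> cone (f -` ?V)" using * by (simp add: cone_def)
    have "A w / B w = g (f (pt v))" using g(2)[OF w] *(3) by simp
    then show "G v \<noteq> 0 \<and> A w / B w = F v / G v" using FG v by simp
  qed (use FG in simp_all)
qed

text \<open>P/Q is the pullback of x/y in lowest terms. Over the point at infinity the pullback
  F'/G' of y/x takes over, and the identity P F' = Q G' links the two descriptions.\<close>

lemma morphism_proj_map: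
  fixes f :: "'k::alg_closed_field proj1 \<Rightarrow> 'k proj1"
  assumes f: "is_morphism f" and surj: "surj f"
  obtains P Q d where "proj_map f P Q d"
proof -
  obtain e F G where 1: "F \<in> Form e" "G \<in> Form e"
    "\<And>v w. v \<noteq> (0, 0) \<Longrightarrow> w \<noteq> (0, 0) \<Longrightarrow> f (pt v) = pt w \<Longrightarrow> snd w \<noteq> 0 \<Longrightarrow> G v \<noteq> 0 \<and> fst w / snd w = F v / G v"
    by (rule morphism_pullback_fraction[OF f Form_fst Form_snd]) (rule that)
  obtain e' F' G' where 2: "F' \<in> Form e'" "G' \<in> Form e'"
    "\<And>v w. v \<noteq> (0, 0) \<Longrightarrow> w \<noteq> (0, 0) \<Longrightarrow> f (pt v) = pt w \<Longrightarrow> fst w \<noteq> 0 \<Longrightarrow> G' v \<noteq> 0 \<and> snd w / fst w = F' v / G' v"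
    by (rule morphism_pullback_fraction[OF f Form_snd Form_fst]) (rule that)
  have lift: "\<exists>v. v \<noteq> (0, 0) \<and> f (pt v) = pt w" for w
  proof -
    obtain p where p: "f p = pt w" using surj by (metis surjD)
    obtain v where "v \<noteq> (0, 0)" "p = pt v" by (rule pt_surj)
    then show ?thesis using p by blast
  qed
  obtain v1 where v1: "v1 \<noteq> (0, 0)" "f (pt v1) = pt (0, 1)" using lift by blast
  have "G v1 \<noteq> 0" using 1(3)[OF v1(1) _ v1(2)] by simp
  then have Gnz: "G \<noteq> (\<lambda>_. 0)" by auto
  from 1(1) have "F \<in> Form (0 + e)" by simp
  from Form_reduce_fraction[OF this 1(2) Gnz] obtain e1 P Q K where PQ: "P \<in> Form e1" "Q \<in> Form e1"
    "\<forall>v. F v = K v * P v \<and> G v = K v * Q v" "\<forall>v. v \<noteq> (0, 0) \<longrightarrow> Q v = 0 \<longrightarrow> P v \<noteq> 0" by auto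
  have FGv: "F v = K v * P v" "G v = K v * Q v" for v using PQ(3) by blast+
  have pq: "Q v \<noteq> 0 \<and> fst w / snd w = P v / Q v"
    if "v \<noteq> (0, 0)" "w \<noteq> (0, 0)" "f (pt v) = pt w" "snd w \<noteq> 0" for v w
    using 1(3)[OF that] FGv[of v] by auto
  have "Q v1 \<noteq> 0" using pq[OF v1(1) _ v1(2)] by simp
  then have "Q \<noteq> (\<lambda>_. 0)" by auto
  with PQ(2) obtain d where d: "e1 = int d" by (meson Form_cases)
  \<comment> \<open>Over the locus where x and y are both nonzero the two fractions are inverse to
    each other; its preimage is nonempty by surjectivity.\<close>
  have cross: "P v * F' v = Q v * G' v" for v
  proof -
    let ?W = "f -` (nonzero_locus fst \<inter> nonzero_locus snd)"
    have "(1, 1) \<in> cone (nonzero_locus fst \<inter> nonzero_locus snd :: 'k proj1 set)"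
      using cone_nonzero_locus[OF Form_fst, of "(1, 1 :: 'k)"] cone_nonzero_locus[OF Form_snd, of "(1, 1 :: 'k)"]
      by (simp add: cone_Int)
    then have ne: "pt (1, 1) \<in> nonzero_locus fst \<inter> (nonzero_locus snd :: 'k proj1 set)" by (simp add: cone_def)
    have W: "open ?W"
      by (intro morphism_open_vimage[OF f] open_Int open_nonzero_locus[OF Form_fst] open_nonzero_locus[OF Form_snd])
    obtain v0 where "v0 \<noteq> (0, 0)" "f (pt v0) = pt (1, 1)" using lift by blast
    then have Wne: "?W \<noteq> {}" using ne by auto
    have "(\<lambda>v. P v * F' v - Q v * G' v) = (\<lambda>_. 0)"
    proof (rule Form_vanishes_on_open[OF _ W Wne])
      show "(\<lambda>v. P v * F' v - Q v * G' v) \<in> Form (e1 + e')"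
        by (intro Form_diff Form_mult PQ 2)
      fix v assume v: "v \<in> cone ?W"
      obtain w where w: "w \<noteq> (0, 0)" "f (pt v) = pt w" by (rule pt_surj)
      have v0: "v \<noteq> (0, 0)" using v by (simp add: cone_def)
      have "w \<in> cone (nonzero_locus fst)" "w \<in> cone (nonzero_locus snd)" using v w by (simp_all add: cone_def)
      then have nz: "fst w \<noteq> 0" "snd w \<noteq> 0"
        using cone_nonzero_locus[OF Form_fst] cone_nonzero_locus[OF Form_snd] by blast+
      have "Q v \<noteq> 0" "fst w / snd w = P v / Q v" using pq[OF v0 w nz(2)] by blast+
      moreover have "G' v \<noteq> 0" "snd w / fst w = F' v / G' v" using 2(3)[OF v0 w nz(1)] by blast+
      moreover have "(fst w / snd w) * (snd w / fst w) = 1" using nz by simp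
      ultimately have "(P v / Q v) * (F' v / G' v) = 1" by simp
      then show "P v * F' v - Q v * G' v = 0" using \<open>Q v \<noteq> 0\<close> \<open>G' v \<noteq> 0\<close> by (simp add: field_simps)
    qed
    from fun_cong[OF this, of v] show ?thesis by simp
  qed
  have fpt: "f (pt v) = pt (P v, Q v)" if v: "v \<noteq> (0, 0)" for v
  proof -
    obtain w where w: "w \<noteq> (0, 0)" "f (pt v) = pt w" by (rule pt_surj)
    have nc: "(P v, Q v) \<noteq> (0, 0)" using PQ(4)[rule_format, OF v] by auto
    have "lin (P v, Q v) w = 0"
    proof (cases "snd w = 0")
      case False
      then have "Q v \<noteq> 0" "fst w / snd w = P v / Q v" using pq[OF v w] by blast+
      then show ?thesis using False by (simp add: lin_def field_simps)
    next
      case True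
      then have "fst w \<noteq> 0" using w(1) by (cases w) auto
      from 2(3)[OF v w this] True have "G' v \<noteq> 0" "F' v = 0" by auto
      \<comment> \<open>At a point mapped to infinity \<open>F'\<close> vanishes and
        \<open>G'\<close> does not, so the identity forces \<open>Q\<close> to vanish.\<close>
      then have "Q v = 0" using cross[of v] by simp
      then show ?thesis using True by (simp add: lin_def)
    qed
    then have "proj_rel (P v, Q v) w" using lin_eq_0_iff[OF nc w(1)] by blast
    then show ?thesis using pt_eq_iff[OF nc w(1)] w(2) by simp
  qed
  \<comment> \<open>Forms of degree 0 would give a constant map, against surjectivity.\<close>
  have "d > 0"
  proof (rule ccontr)
    assume "\<not> d > 0"
    then have 0: "P \<in> Form 0" "Q \<in> Form 0" using PQ d by auto
    have const: "f (pt v) = f (pt w)" if "v \<noteq> (0, 0)" "w \<noteq> (0, 0)" for v w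
      using fpt that Form_0_const[OF 0(1), of v w] Form_0_const[OF 0(2), of v w] by simp
    obtain v0 where v0: "v0 \<noteq> (0, 0)" "f (pt v0) = pt (1, 0)" using lift by blast
    have "pt (0, 1) = (pt (1, 0) :: 'k proj1)" using const[OF v1(1) v0(1)] v1 v0 by simp
    then have "proj_rel (0, 1) (1, 0 :: 'k)" using pt_eq_iff[of "(0, 1)" "(1, 0 :: 'k)"] by simp
    then show False by (auto simp: proj_rel_def)
  qed
  then have "proj_map f P Q d"
    by unfold_locales (use PQ d fpt morphism_continuous[OF f] surj in auto)
  then show thesis by (rule that)
qed

section \<open>The function field and the degree\<close>

declare split_paired_All [simp del] split_paired_Ex [simp del]

lemma carrier_structure_ring_iff:
  "g \<in> carrier (structure_ring U) \<longleftrightarrow> g \<in> extensional U \<and> regular_on U g"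
  by (simp add: structure_ring_def)

lemma desc_unique:
  assumes "g \<in> extensional U" "hreg 0 U s" "\<And>v. v \<in> cone U \<Longrightarrow> g (pt v) = s v"
  shows "g = desc U s"
proof (rule extensionalityI[OF assms(1) desc_extensional])
  fix p assume p: "p \<in> U"
  obtain v where v: "v \<noteq> (0, 0)" "p = pt v" by (rule pt_surj)
  then have "v \<in> cone U" using p by (simp add: cone_def)
  then show "g p = desc U s p" using assms(3) desc_pt[OF assms(2)] v by simp
qed

definition ratfun :: "'k::alg_closed_field proj1 set \<Rightarrow> ('k \<times> 'k \<Rightarrow> 'k) \<Rightarrow> bool" where
  "ratfun U s \<longleftrightarrow> open U \<and> U \<noteq> {} \<and> hreg 0 U s"

text \<open>The rational function of a degree 0 function on the cone; the arithmetic of the function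
  field is carried out on such representatives.\<close>

definition rat :: "'k::alg_closed_field proj1 set \<Rightarrow> ('k \<times> 'k \<Rightarrow> 'k) \<Rightarrow> ('k proj1 set \<times> ('k proj1 \<Rightarrow> 'k)) set" where
  "rat U s = rational_rel `` {(U, desc U s)}"

lemma ratfun_reps: "ratfun U s \<Longrightarrow> (U, desc U s) \<in> rational_reps"
  by (simp add: ratfun_def rational_reps_def carrier_structure_ring_iff desc_regular)

lemma reps_ratfun:
  assumes "(U, g) \<in> rational_reps"
  shows "ratfun U (\<lambda>v. g (pt v))" "g = desc U (\<lambda>v. g (pt v))"
proof -
  have *: "open U" "U \<noteq> {}" "g \<in> extensional U" "regular_on U g"
    using assms by (auto simp: rational_reps_def carrier_structure_ring_iff)
  then show r: "ratfun U (\<lambda>v. g (pt v))"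
    using regular_on_iff_hreg[of U g] by (simp add: ratfun_def)
  show "g = desc U (\<lambda>v. g (pt v))"
    using r by (intro desc_unique[OF *(3)]) (simp_all add: ratfun_def)
qed

lemma rational_rel_iff:
  "((U, g), (V, h)) \<in> rational_rel \<longleftrightarrow> (U, g) \<in> rational_reps \<and> (V, h) \<in> rational_reps \<and>
    (\<forall>v\<in>cone (U \<inter> V). g (pt v) = h (pt v))"
proof -
  have "(\<forall>p\<in>U \<inter> V. g p = h p) \<longleftrightarrow> (\<forall>v\<in>cone (U \<inter> V). g (pt v) = h (pt v))"
  proof (intro iffI ballI)
    fix v assume "\<forall>p\<in>U \<inter> V. g p = h p" "v \<in> cone (U \<inter> V)"
    then show "g (pt v) = h (pt v)" by (simp add: cone_def)
  next
    fix p assume *: "\<forall>v\<in>cone (U \<inter> V). g (pt v) = h (pt v)" "p \<in> U \<inter> V"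
    obtain v where "v \<noteq> (0, 0)" "p = pt v" by (rule pt_surj)
    then show "g p = h p" using *(1)[rule_format, of v] *(2) by (simp add: cone_def)
  qed
  then show ?thesis by (simp add: rational_rel_def)
qed

text \<open>The outer functions are only known to agree inside the middle domain V, but V meets U
  \<inter> W in a nonempty open set and the identity theorem does the rest.\<close>

lemma rational_rel_trans:
  assumes "((U, g), (V, h)) \<in> rational_rel" "((V, h), (W, k)) \<in> rational_rel"
  shows "((U, g), (W, k)) \<in> rational_rel"
proof -
  note xy = assms(1)[unfolded rational_rel_iff] and yz = assms(2)[unfolded rational_rel_iff]
  have 1: "ratfun U (\<lambda>v. g (pt v))" using reps_ratfun xy by blast
  have 2: "ratfun V (\<lambda>v. h (pt v))" using reps_ratfun xy by blast
  have 3: "ratfun W (\<lambda>v. k (pt v))" using reps_ratfun yz by blast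
  have "g (pt v) = k (pt v)" if "v \<in> cone (U \<inter> W)" for v
  proof (rule hreg_eqI[where V = "U \<inter> W \<inter> V", OF _ _ _ _ _ _ that])
    show "hreg 0 (U \<inter> W) (\<lambda>v. g (pt v))" using 1 hreg_mono[of 0 U] by (auto simp: ratfun_def)
    show "hreg 0 (U \<inter> W) (\<lambda>v. k (pt v))" using 3 hreg_mono[of 0 W] by (auto simp: ratfun_def)
    show "open (U \<inter> W \<inter> V)" "U \<inter> W \<inter> V \<noteq> {}"
      using open_Int3_nonempty[of U W V] 1 2 3 by (simp_all add: ratfun_def)
    fix w assume "w \<in> cone (U \<inter> W \<inter> V)"
    then have "w \<in> cone (U \<inter> V)" "w \<in> cone (V \<inter> W)" by (simp_all add: cone_Int)
    then show "g (pt w) = k (pt w)" using xy yz by simp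
  qed auto
  then show ?thesis unfolding rational_rel_iff using xy yz by blast
qed

lemma equiv_rational: "equiv rational_reps rational_rel"
proof (rule equivI)
  show "trans rational_rel"
    by (rule transI) (metis rational_rel_trans surj_pair)
qed (auto simp: rational_rel_def refl_on_def sym_def)

lemma rat_eq_iff:
  assumes "ratfun U s" "ratfun V t"
  shows "rat U s = rat V t \<longleftrightarrow> (\<forall>v\<in>cone (U \<inter> V). s v = t v)"
proof -
  have "rat U s = rat V t \<longleftrightarrow> (\<forall>v\<in>cone (U \<inter> V). desc U s (pt v) = desc V t (pt v))"
    unfolding rat_def eq_equiv_class_iff[OF equiv_rational ratfun_reps[OF assms(1)] ratfun_reps[OF assms(2)]]
    using ratfun_reps[OF assms(1)] ratfun_reps[OF assms(2)] by (simp add: rational_rel_iff)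
  also have "\<dots> \<longleftrightarrow> (\<forall>v\<in>cone (U \<inter> V). s v = t v)"
    using desc_pt[of U s] desc_pt[of V t] assms by (simp add: ratfun_def cone_Int)
  finally show ?thesis .
qed

lemma rat_eqI:
  assumes "ratfun U s" "ratfun V t" "open W" "W \<noteq> {}" "W \<subseteq> U \<inter> V" "\<And>v. v \<in> cone W \<Longrightarrow> s v = t v"
  shows "rat U s = rat V t"
  unfolding rat_eq_iff[OF assms(1,2)]
proof
  fix v assume v: "v \<in> cone (U \<inter> V)"
  have "hreg 0 (U \<inter> V) s" "hreg 0 (U \<inter> V) t"
    using assms(1,2) hreg_mono[of 0 U s "U \<inter> V"] hreg_mono[of 0 V t "U \<inter> V"] by (auto simp: ratfun_def)
  from hreg_eqI[OF this assms(3-6) v] show "s v = t v" .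
qed

lemma ratfun_restrict: "ratfun U s \<Longrightarrow> open W \<Longrightarrow> W \<noteq> {} \<Longrightarrow> W \<subseteq> U \<Longrightarrow> ratfun W s"
  using hreg_mono[of 0 U s W] by (simp add: ratfun_def)

lemma rat_restrict: "ratfun U s \<Longrightarrow> open W \<Longrightarrow> W \<noteq> {} \<Longrightarrow> W \<subseteq> U \<Longrightarrow> rat U s = rat W s"
  using ratfun_restrict[of U s W] by (simp add: rat_eq_iff)

lemma ratfun_Int:
  assumes "ratfun U s" "ratfun V t"
  shows "ratfun (U \<inter> V) s" "ratfun (U \<inter> V) t"
  using ratfun_restrict[OF assms(1), of "U \<inter> V"] ratfun_restrict[OF assms(2), of "U \<inter> V"]
    open_Int2_nonempty[of U V] assms by (auto simp: ratfun_def)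

lemma rat_carrier: "ratfun U s \<Longrightarrow> rat U s \<in> carrier function_field"
  by (simp add: function_field_def rat_def quotientI ratfun_reps)

lemma carrier_rat:
  assumes "A \<in> carrier function_field"
  obtains U s where "ratfun U s" "A = rat U s"
proof -
  from assms obtain x where x: "x \<in> rational_reps" "A = rational_rel `` {x}"
    by (auto simp: function_field_def elim: quotientE)
  obtain U g where "x = (U, g)" by force
  with x have "(U, g) \<in> rational_reps" "A = rational_rel `` {(U, g)}" by auto
  then show thesis using reps_ratfun[of U g] that[of U "\<lambda>v. g (pt v)"] by (simp add: rat_def)
qed

lemma rat_member:
  assumes "ratfun U s" "(V, h) \<in> rat U s"
  shows "ratfun V (\<lambda>v. h (pt v))" "rat V (\<lambda>v. h (pt v)) = rat U s" "h \<in> extensional V"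
    "\<And>v. v \<in> cone (U \<inter> V) \<Longrightarrow> h (pt v) = s v"
proof -
  have r: "((U, desc U s), (V, h)) \<in> rational_rel" using assms by (simp add: rat_def)
  then have V: "(V, h) \<in> rational_reps" by (simp add: rational_rel_iff)
  note h = reps_ratfun[OF V]
  show "ratfun V (\<lambda>v. h (pt v))" by (rule h(1))
  show "h \<in> extensional V" using V by (simp add: rational_reps_def carrier_structure_ring_iff)
  have "rational_rel `` {(U, desc U s)} = rational_rel `` {(V, h)}"
    by (rule equiv_class_eq[OF equiv_rational r])
  then show eq: "rat V (\<lambda>v. h (pt v)) = rat U s" using h(2) by (simp add: rat_def)
  show "h (pt v) = s v" if "v \<in> cone (U \<inter> V)" for v
    using eq that unfolding rat_eq_iff[OF h(1) assms(1)] by (simp add: Int_commute)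
qed

lemma rat_nonempty: "ratfun U s \<Longrightarrow> rat U s \<noteq> {}"
  unfolding rat_def using equiv_class_self[OF equiv_rational ratfun_reps] by blast

lemma UN_const2:
  assumes "A \<noteq> {}" "B \<noteq> {}" "\<And>x y. x \<in> A \<Longrightarrow> y \<in> B \<Longrightarrow> F x y = c"
  shows "(\<Union>x\<in>A. \<Union>y\<in>B. F x y) = c"
  using assms by auto

text \<open>All representatives give the same class, so the union over them in the definition of the
  operations is one class. A general operation \<open>opr\<close> serves for sum and product
  alike.\<close>

lemma rat_op:
  assumes clos: "\<And>W s t. hreg 0 W s \<Longrightarrow> hreg 0 W t \<Longrightarrow> hreg 0 W (\<lambda>v. opr (s v) (t v))"
    and s: "ratfun U s" and t: "ratfun V t"
  shows "(\<Union>(U, g)\<in>rat U s. \<Union>(V, h)\<in>rat V t. rational_rel `` {(U \<inter> V, \<lambda>p\<in>U \<inter> V. opr (g p) (h p))}) =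
    rat (U \<inter> V) (\<lambda>v. opr (s v) (t v))"
    and "ratfun (U \<inter> V) (\<lambda>v. opr (s v) (t v))"
proof -
  have clos': "ratfun (U \<inter> V) (\<lambda>v. opr (s v) (t v))" if "ratfun U s" "ratfun V t" for U V s t
    using ratfun_Int[OF that] clos by (simp add: ratfun_def)
  show rst: "ratfun (U \<inter> V) (\<lambda>v. opr (s v) (t v))" by (rule clos'[OF s t])
  have "rational_rel `` {(U1 \<inter> V1, \<lambda>p\<in>U1 \<inter> V1. opr (g p) (h p))} = rat (U \<inter> V) (\<lambda>v. opr (s v) (t v))"
    if g: "(U1, g) \<in> rat U s" and h: "(V1, h) \<in> rat V t" for U1 g V1 h
  proof -
    note g' = rat_member[OF s g] and h' = rat_member[OF t h]
    have r: "ratfun (U1 \<inter> V1) (\<lambda>v. opr (g (pt v)) (h (pt v)))" by (rule clos'[OF g'(1) h'(1)])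
    have "(\<lambda>p\<in>U1 \<inter> V1. opr (g p) (h p)) = desc (U1 \<inter> V1) (\<lambda>v. opr (g (pt v)) (h (pt v)))"
      using r by (intro desc_unique) (auto simp: ratfun_def cone_def)
    then have "rational_rel `` {(U1 \<inter> V1, \<lambda>p\<in>U1 \<inter> V1. opr (g p) (h p))} =
        rat (U1 \<inter> V1) (\<lambda>v. opr (g (pt v)) (h (pt v)))" by (simp add: rat_def)
    also have "\<dots> = rat (U \<inter> V) (\<lambda>v. opr (s v) (t v))"
    proof (rule rat_eqI[OF r rst, of "(U1 \<inter> V1) \<inter> (U \<inter> V)"])
      show "open (U1 \<inter> V1 \<inter> (U \<inter> V))" "U1 \<inter> V1 \<inter> (U \<inter> V) \<noteq> {}"
        using open_Int2_nonempty[of "U1 \<inter> V1" "U \<inter> V"] r rst by (simp_all add: ratfun_def)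
      show "opr (g (pt v)) (h (pt v)) = opr (s v) (t v)" if "v \<in> cone (U1 \<inter> V1 \<inter> (U \<inter> V))" for v
        using g'(4)[of v] h'(4)[of v] that by (simp add: cone_Int)
    qed simp
    finally show ?thesis .
  qed
  then show "(\<Union>(U, g)\<in>rat U s. \<Union>(V, h)\<in>rat V t. rational_rel `` {(U \<inter> V, \<lambda>p\<in>U \<inter> V. opr (g p) (h p))}) =
    rat (U \<inter> V) (\<lambda>v. opr (s v) (t v))"
    using rat_nonempty[OF s] rat_nonempty[OF t] unfolding case_prod_unfold by (intro UN_const2) auto
qed

lemma function_field_zero: "\<zero>\<^bsub>function_field\<^esub> = rat UNIV (\<lambda>_. 0 :: 'k::alg_closed_field)"
proof -
  have "(\<lambda>p. 0) = desc UNIV (\<lambda>_. 0 :: 'k)" by (rule desc_unique) simp_all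
  then show ?thesis by (simp add: function_field_def rat_def)
qed

lemma function_field_one: "\<one>\<^bsub>function_field\<^esub> = rat UNIV (\<lambda>_. 1 :: 'k::alg_closed_field)"
proof -
  have "(\<lambda>p. 1) = desc UNIV (\<lambda>_. 1 :: 'k)" by (rule desc_unique) simp_all
  then show ?thesis by (simp add: function_field_def rat_def)
qed

lemma ratfun_const [simp]: "ratfun UNIV (\<lambda>_. c)"
  by (simp add: ratfun_def)

lemma rat_mult:
  assumes "ratfun U s" "ratfun V t"
  shows "rat U s \<otimes>\<^bsub>function_field\<^esub> rat V t = rat (U \<inter> V) (\<lambda>v. s v * t v)"
    and "ratfun (U \<inter> V) (\<lambda>v. s v * t v)"
proof -
  have clos: "hreg 0 W (\<lambda>v. s v * t v)" if "hreg 0 W s" "hreg 0 W t" for W and s t :: "'a \<times> 'a \<Rightarrow> 'a"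
    using hreg_mult[OF that] by simp
  have "(\<Union>(U, g)\<in>rat U s. \<Union>(V, h)\<in>rat V t. rational_rel `` {(U \<inter> V, \<lambda>p\<in>U \<inter> V. g p * h p)}) =
      rat (U \<inter> V) (\<lambda>v. s v * t v)"
    by (rule rat_op(1)[where opr = "(*)"]) (rule clos, assumption+, rule assms, rule assms)
  then show "rat U s \<otimes>\<^bsub>function_field\<^esub> rat V t = rat (U \<inter> V) (\<lambda>v. s v * t v)"
    by (simp only: function_field_def monoid.simps)
  show "ratfun (U \<inter> V) (\<lambda>v. s v * t v)"
    by (rule rat_op(2)[where opr = "(*)"]) (rule clos, assumption+, rule assms, rule assms)
qed

lemma rat_add:
  assumes "ratfun U s" "ratfun V t"
  shows "rat U s \<oplus>\<^bsub>function_field\<^esub> rat V t = rat (U \<inter> V) (\<lambda>v. s v + t v)"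
    and "ratfun (U \<inter> V) (\<lambda>v. s v + t v)"
proof -
  have "(\<Union>(U, g)\<in>rat U s. \<Union>(V, h)\<in>rat V t. rational_rel `` {(U \<inter> V, \<lambda>p\<in>U \<inter> V. g p + h p)}) =
      rat (U \<inter> V) (\<lambda>v. s v + t v)"
    by (rule rat_op(1)[where opr = "(+)"]) (rule hreg_add, assumption+, rule assms, rule assms)
  then show "rat U s \<oplus>\<^bsub>function_field\<^esub> rat V t = rat (U \<inter> V) (\<lambda>v. s v + t v)"
    by (simp only: function_field_def ring.simps)
  show "ratfun (U \<inter> V) (\<lambda>v. s v + t v)"
    by (rule rat_op(2)[where opr = "(+)"]) (rule hreg_add, assumption+, rule assms, rule assms)
qed

text \<open>The laws hold for representatives on the intersection of their domains; a nonzero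
  element is inverted after removing the zeros of its numerator.\<close>

lemma field_function_field: "field (function_field :: (('k::alg_closed_field proj1 set \<times> ('k proj1 \<Rightarrow> 'k)) set) ring)"
  (is "field ?K")
proof -
  note rat_simps = function_field_zero function_field_one rat_mult rat_add rat_eq_iff rat_carrier
  have ag: "abelian_group ?K"
  proof (rule abelian_groupI)
    fix x y assume "x \<in> carrier ?K" "y \<in> carrier ?K"
    then obtain U s V t where *: "ratfun U s" "x = rat U s" "ratfun V t" "y = rat V t"
      by (elim carrier_rat)
    then show "x \<oplus>\<^bsub>?K\<^esub> y \<in> carrier ?K" by (simp add: rat_simps)
    show "x \<oplus>\<^bsub>?K\<^esub> y = y \<oplus>\<^bsub>?K\<^esub> x" using * by (simp add: rat_simps add.commute Int_commute)
  next
    fix x y z assume "x \<in> carrier ?K" "y \<in> carrier ?K" "z \<in> carrier ?K"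
    then obtain U s V t W u where "ratfun U s" "x = rat U s" "ratfun V t" "y = rat V t" "ratfun W u" "z = rat W u"
      by (elim carrier_rat)
    then show "x \<oplus>\<^bsub>?K\<^esub> y \<oplus>\<^bsub>?K\<^esub> z = x \<oplus>\<^bsub>?K\<^esub> (y \<oplus>\<^bsub>?K\<^esub> z)"
      by (simp add: rat_simps add.assoc Int_assoc)
  next
    fix x assume "x \<in> carrier ?K"
    then obtain U s where x: "ratfun U s" "x = rat U s" by (elim carrier_rat)
    then show "\<zero>\<^bsub>?K\<^esub> \<oplus>\<^bsub>?K\<^esub> x = x" by (simp add: rat_simps)
    have neg: "ratfun U (\<lambda>v. - 1 * s v)" using x hreg_scale[of 0 U s "- 1"] by (simp add: ratfun_def)
    have "rat U (\<lambda>v. - 1 * s v) \<oplus>\<^bsub>?K\<^esub> x = \<zero>\<^bsub>?K\<^esub>"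
      using rat_add[OF neg x(1)] x(2) by (simp add: function_field_zero rat_eq_iff)
    then show "\<exists>y\<in>carrier ?K. y \<oplus>\<^bsub>?K\<^esub> x = \<zero>\<^bsub>?K\<^esub>" using rat_carrier[OF neg] by blast
  qed (simp add: rat_simps)
  have cm: "comm_monoid ?K"
  proof (rule comm_monoidI)
    fix x y assume "x \<in> carrier ?K" "y \<in> carrier ?K"
    then obtain U s V t where *: "ratfun U s" "x = rat U s" "ratfun V t" "y = rat V t"
      by (elim carrier_rat)
    then show "x \<otimes>\<^bsub>?K\<^esub> y \<in> carrier ?K" by (simp add: rat_simps)
    show "x \<otimes>\<^bsub>?K\<^esub> y = y \<otimes>\<^bsub>?K\<^esub> x" using * by (simp add: rat_simps mult.commute Int_commute)
  next
    fix x y z assume "x \<in> carrier ?K" "y \<in> carrier ?K" "z \<in> carrier ?K"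
    then obtain U s V t W u where "ratfun U s" "x = rat U s" "ratfun V t" "y = rat V t" "ratfun W u" "z = rat W u"
      by (elim carrier_rat)
    then show "x \<otimes>\<^bsub>?K\<^esub> y \<otimes>\<^bsub>?K\<^esub> z = x \<otimes>\<^bsub>?K\<^esub> (y \<otimes>\<^bsub>?K\<^esub> z)"
      by (simp add: rat_simps mult.assoc Int_assoc)
  next
    fix x assume "x \<in> carrier ?K"
    then obtain U s where x: "ratfun U s" "x = rat U s" by (elim carrier_rat)
    then show "\<one>\<^bsub>?K\<^esub> \<otimes>\<^bsub>?K\<^esub> x = x" by (simp add: rat_simps)
  qed (simp add: rat_simps)
  have cring: "cring ?K"
  proof (rule cringI[OF ag cm])
    fix x y z assume "x \<in> carrier ?K" "y \<in> carrier ?K" "z \<in> carrier ?K"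
    then obtain U s V t W u where "ratfun U s" "x = rat U s" "ratfun V t" "y = rat V t" "ratfun W u" "z = rat W u"
      by (elim carrier_rat)
    then show "(x \<oplus>\<^bsub>?K\<^esub> y) \<otimes>\<^bsub>?K\<^esub> z = x \<otimes>\<^bsub>?K\<^esub> z \<oplus>\<^bsub>?K\<^esub> y \<otimes>\<^bsub>?K\<^esub> z"
      by (simp add: rat_simps distrib_right Int_ac)
  qed
  show ?thesis
  proof (rule cring.cring_fieldI2[OF cring])
    have "(1, 0) \<in> cone (UNIV :: 'k proj1 set)" by (simp add: cone_def)
    then show "\<zero>\<^bsub>?K\<^esub> \<noteq> \<one>\<^bsub>?K\<^esub>" by (auto simp: rat_simps)
    fix x assume "x \<in> carrier ?K" and x0: "x \<noteq> \<zero>\<^bsub>?K\<^esub>"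
    then obtain U s where x: "ratfun U s" "x = rat U s" by (elim carrier_rat)
    from x(1) have "hreg 0 U s" by (simp add: ratfun_def)
    then obtain e F G where FG: "F \<in> Form (0 + e)" "G \<in> Form e" "\<forall>v\<in>cone U. G v \<noteq> 0"
      "\<forall>v\<in>cone U. s v = F v / G v" by (rule hregE)
    have "F \<noteq> (\<lambda>_. 0)" using x0 x FG(4) by (auto simp: rat_simps)
    then have W: "open (U \<inter> nonzero_locus F)" "U \<inter> nonzero_locus F \<noteq> {}"
      using open_Int2_nonempty[OF _ open_nonzero_locus[OF FG(1)] _ nonzero_locus_nonempty[OF FG(1)], of U] x(1)
      by (simp_all add: ratfun_def)
    have nz: "s v \<noteq> 0" if "v \<in> cone (U \<inter> nonzero_locus F)" for v
      using that FG cone_nonzero_locus[OF FG(1)] by (simp add: cone_Int)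
    have sW: "hreg 0 (U \<inter> nonzero_locus F) s" using x(1) hreg_mono[of 0 U s] by (simp add: ratfun_def)
    have r: "ratfun (U \<inter> nonzero_locus F) (\<lambda>v. 1 / s v)"
      using hreg_inverse[OF sW nz] W by (simp add: ratfun_def)
    have "x \<otimes>\<^bsub>?K\<^esub> rat (U \<inter> nonzero_locus F) (\<lambda>v. 1 / s v) = \<one>\<^bsub>?K\<^esub>"
      unfolding x(2) rat_mult(1)[OF x(1) r] function_field_one rat_eq_iff[OF rat_mult(2)[OF x(1) r] ratfun_const]
      using nz by (simp add: cone_Int)
    then show "\<exists>b\<in>carrier ?K. x \<otimes>\<^bsub>?K\<^esub> b = \<one>\<^bsub>?K\<^esub>" using rat_carrier[OF r] by blast
  qed
qed

lemma rat_common_domain: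
  assumes "finite I" "\<And>i. i \<in> I \<Longrightarrow> A i \<in> carrier function_field"
  shows "\<exists>W s. open W \<and> W \<noteq> {} \<and> (\<forall>i\<in>I. ratfun W (s i) \<and> A i = rat W (s i))"
  using assms
proof (induction I)
  case empty
  show ?case by (intro exI[of _ UNIV]) auto
next
  case (insert j I)
  then obtain W s where W: "open W" "W \<noteq> {}" "\<forall>i\<in>I. ratfun W (s i) \<and> A i = rat W (s i)" by auto
  obtain V t where V: "ratfun V t" "A j = rat V t" by (rule carrier_rat[of "A j"]) (use insert in auto)
  have "V \<inter> W \<noteq> {}" "open (V \<inter> W)"
    using open_Int2_nonempty[of V W] V W by (simp_all add: ratfun_def)
  then have "ratfun (V \<inter> W) (if i = j then t else s i) \<and> A i = rat (V \<inter> W) (if i = j then t else s i)"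
    if "i \<in> insert j I" for i
    using that ratfun_restrict[of V t "V \<inter> W"] ratfun_restrict[of W "s i" "V \<inter> W"]
      rat_restrict[of V t "V \<inter> W"] rat_restrict[of W "s i" "V \<inter> W"] V W by auto
  then show ?case using \<open>V \<inter> W \<noteq> {}\<close> \<open>open (V \<inter> W)\<close>
    by (intro exI[of _ "V \<inter> W"] exI[of _ "\<lambda>i. if i = j then t else s i"]) blast
qed

text \<open>Translates the list combinations in which dimension over a subfield is defined into sums
  of functions.\<close>

lemma combine_rat:
  fixes A B :: "'k::alg_closed_field proj1 set" and k u :: "'j \<Rightarrow> 'k \<times> 'k \<Rightarrow> 'k"
  assumes k: "\<And>j. j \<in> set js \<Longrightarrow> ratfun A (k j)" and u: "\<And>j. j \<in> set js \<Longrightarrow> ratfun B (u j)"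
    and AB: "open (A \<inter> B)" "A \<inter> B \<noteq> {}"
  shows "ring.combine function_field (map (\<lambda>j. rat A (k j)) js) (map (\<lambda>j. rat B (u j)) js) =
      rat (A \<inter> B) (\<lambda>v. \<Sum>j\<leftarrow>js. k j v * u j v) \<and> ratfun (A \<inter> B) (\<lambda>v. \<Sum>j\<leftarrow>js. k j v * u j v)"
  using k u
proof (induction js)
  case Nil
  interpret field "function_field :: (('k proj1 set \<times> ('k proj1 \<Rightarrow> 'k)) set) ring"
    by (rule field_function_field)
  have "ratfun (A \<inter> B) (\<lambda>_. 0)" using AB by (simp add: ratfun_def)
  then show ?case by (simp add: function_field_zero rat_eq_iff)
next
  case (Cons j js)
  interpret field "function_field :: (('k proj1 set \<times> ('k proj1 \<Rightarrow> 'k)) set) ring"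
    by (rule field_function_field)
  note IH = Cons.IH[OF Cons.prems(1,2)]
  have m: "ratfun A (k j)" "ratfun B (u j)" using Cons.prems by simp_all
  from IH have "combine (map (\<lambda>j. rat A (k j)) js) (map (\<lambda>j. rat B (u j)) js) =
      rat (A \<inter> B) (\<lambda>v. \<Sum>j\<leftarrow>js. k j v * u j v)" "ratfun (A \<inter> B) (\<lambda>v. \<Sum>j\<leftarrow>js. k j v * u j v)" by simp_all
  then show ?case using rat_mult[OF m] rat_add[OF rat_mult(2)[OF m], of "A \<inter> B" "\<lambda>v. \<Sum>j\<leftarrow>js. k j v * u j v"]
    by simp
qed

section \<open>Pullback of rational functions and the degree of a morphism\<close>

context proj_map
begin

lemma ratfun_pullback: "ratfun U s \<Longrightarrow> ratfun (f -` U) (\<lambda>v. s (P v, Q v))"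
  using hreg_compose[of 0 U s] open_vimage[of U] vimage_nonempty[of U] by (simp add: ratfun_def)

lemma pullback_rat:
  assumes s: "ratfun U s"
  shows "pullback_rational f (rat U s) = rat (f -` U) (\<lambda>v. s (P v, Q v))"
proof -
  have "rational_rel `` {(f -` V, \<lambda>p\<in>f -` V. g (f p))} = rat (f -` U) (\<lambda>v. s (P v, Q v))"
    if g: "(V, g) \<in> rat U s" for V g
  proof -
    note g' = rat_member[OF s g]
    note r = ratfun_pullback[OF g'(1)]
    have "(\<lambda>p\<in>f -` V. g (f p)) = desc (f -` V) (\<lambda>v. g (pt (P v, Q v)))"
    proof (rule desc_unique)
      show "(\<lambda>p\<in>f -` V. g (f p)) (pt v) = g (pt (P v, Q v))" if "v \<in> cone (f -` V)" for v
        using that f_pt[of v] by (simp add: cone_def)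
    qed (use r in \<open>simp_all add: ratfun_def\<close>)
    then have "rational_rel `` {(f -` V, \<lambda>p\<in>f -` V. g (f p))} = rat (f -` V) (\<lambda>v. g (pt (P v, Q v)))"
      by (simp add: rat_def)
    also have "\<dots> = rat (f -` U) (\<lambda>v. s (P v, Q v))"
      unfolding rat_eq_iff[OF r ratfun_pullback[OF s]]
    proof
      fix v assume "v \<in> cone (f -` V \<inter> f -` U)"
      then have "v \<in> cone (f -` V)" "v \<in> cone (f -` U)" by (simp_all add: cone_Int)
      then have "(P v, Q v) \<in> cone (U \<inter> V)" using cone_vimageD by (simp add: cone_Int)
      then show "g (pt (P v, Q v)) = s (P v, Q v)" by (rule g'(4))
    qed
    finally show ?thesis .
  qed
  then show ?thesis
    unfolding pullback_rational_def case_prod_unfold using rat_nonempty[OF s] by auto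
qed

lemma pullback_ring_hom: "pullback_rational f \<in> Ring.ring_hom function_field function_field"
proof (rule ring_hom_memI)
  fix x assume "x \<in> carrier (function_field :: (('k proj1 set \<times> ('k proj1 \<Rightarrow> 'k)) set) ring)"
  then obtain U s where "ratfun U s" "x = rat U s" by (elim carrier_rat)
  then show "pullback_rational f x \<in> carrier function_field"
    by (simp add: pullback_rat ratfun_pullback rat_carrier)
next
  fix x y :: "('k proj1 set \<times> ('k proj1 \<Rightarrow> 'k)) set"
  assume "x \<in> carrier function_field" "y \<in> carrier function_field"
  then obtain U s V t where *: "ratfun U s" "x = rat U s" "ratfun V t" "y = rat V t"
    by (elim carrier_rat)
  note pb = ratfun_pullback[OF *(1)] ratfun_pullback[OF *(3)]
  show "pullback_rational f (x \<otimes>\<^bsub>function_field\<^esub> y) =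
      pullback_rational f x \<otimes>\<^bsub>function_field\<^esub> pullback_rational f y"
    using * rat_mult(1)[OF pb] by (simp add: rat_mult pullback_rat)
  show "pullback_rational f (x \<oplus>\<^bsub>function_field\<^esub> y) =
      pullback_rational f x \<oplus>\<^bsub>function_field\<^esub> pullback_rational f y"
    using * rat_add(1)[OF pb] by (simp add: rat_add pullback_rat)
next
  show "pullback_rational f \<one>\<^bsub>function_field\<^esub> = \<one>\<^bsub>function_field\<^esub>"
    by (simp add: function_field_one pullback_rat)
qed

text \<open>For a = d - 1 all coordinates given by \<open>push_forward\<close> have degree 0. The d
  generators divided by y^(d-1) are rational functions, independent over the pulled back field by
  uniqueness of these coordinates and spanning by their existence.\<close>

theorem degree_eq: "morphism_degree f = d"
proof -
  let ?K = "function_field :: (('k proj1 set \<times> ('k proj1 \<Rightarrow> 'k)) set) ring"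
  interpret K: field ?K by (rule field_function_field)
  interpret h: ring_hom_ring ?K ?K "pullback_rational f"
    by (rule ring_hom_ringI2[OF K.ring_axioms K.ring_axioms pullback_ring_hom])
  let ?k = "pullback_rational f ` carrier ?K"
  have sub: "subfield ?k ?K"
    by (rule h.img_is_subfield(2)[OF K.carrier_is_subfield K.one_not_zero])
  \<comment> \<open>Here q = 0 and r = d - 1, so every j < d has shift 0.\<close>
  define a where "a = int d - 1"
  have pd: "push_deg d a j = 0" if "j < d" for j
  proof -
    have "0 \<le> a" "a < int d" using d_pos by (simp_all add: a_def)
    then have "a div int d = 0" "a mod int d = a" by simp_all
    then show ?thesis using that by (simp add: push_deg_def a_def shift_def)
  qed
  from push_forward[of a] obtain g where g: "\<forall>j<d. g j \<in> Form (a - int d * push_deg d a j)"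
    "\<forall>U s. open U \<longrightarrow> (\<forall>j<d. hreg (push_deg d a j) U (s j)) \<longrightarrow>
      (\<forall>v\<in>cone (f -` U). (\<Sum>j<d. g j v * s j (P v, Q v)) = 0) \<longrightarrow> (\<forall>j<d. \<forall>w\<in>cone U. s j w = 0)"
    "\<forall>U t. open U \<longrightarrow> hreg a (f -` U) t \<longrightarrow> (\<exists>s. (\<forall>j<d. hreg (push_deg d a j) U (s j)) \<and>
        (\<forall>v\<in>cone (f -` U). t v = (\<Sum>j<d. g j v * s j (P v, Q v))))"
    by (elim exE conjE)
  have g1: "g j \<in> Form a" if "j < d" for j using g(1)[rule_format, OF that] pd[OF that] by simp
  let ?V = "nonzero_locus (snd :: 'k \<times> 'k \<Rightarrow> 'k)"
  have "(snd :: 'k \<times> 'k \<Rightarrow> 'k) \<noteq> (\<lambda>_. 0)"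
  proof
    assume *: "(snd :: 'k \<times> 'k \<Rightarrow> 'k) = (\<lambda>_. 0)"
    from fun_cong[OF *, of "(0, 1)"] show False by simp
  qed
  then have V: "open ?V" "?V \<noteq> {}"
    using open_nonzero_locus[OF Form_snd] nonzero_locus_nonempty[OF Form_snd] by simp_all
  have snd_nz: "snd v \<noteq> 0" if "v \<in> cone ?V" for v :: "'k \<times> 'k"
    using cone_nonzero_locus[OF Form_snd] that by blast
  have snd_pow: "(\<lambda>v. snd v ^ (d - 1)) \<in> Form a"
    using Form_power[OF Form_snd, of "d - 1"] d_pos by (simp add: a_def of_nat_diff)
  define u where "u j v = g j v / snd v ^ (d - 1)" for j v
  have u: "ratfun ?V (u j)" if "j < d" for j
  proof -
    have "hreg (a - a) ?V (u j)"
      unfolding u_def using snd_nz by (intro hreg_divide hreg_Form g1[OF that] snd_pow) auto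
    then show ?thesis using V by (simp add: ratfun_def)
  qed
  define Us where "Us = map (\<lambda>j. rat ?V (u j)) [0..<d]"
  have Us: "set Us \<subseteq> carrier ?K" by (auto simp: Us_def intro!: rat_carrier u)
  have sum_eq: "(\<Sum>j\<leftarrow>[0..<d]. k j) = (\<Sum>j<d. k j)" for k :: "nat \<Rightarrow> 'k"
    by (simp add: interv_sum_list_conv_sum_set_nat lessThan_atLeast0)
  have comb: "K.combine (map (\<lambda>j. rat (f -` W) (\<lambda>v. s j (P v, Q v))) [0..<d]) Us =
      rat (f -` W \<inter> ?V) (\<lambda>v. \<Sum>j<d. s j (P v, Q v) * u j v) \<and>
      ratfun (f -` W \<inter> ?V) (\<lambda>v. \<Sum>j<d. s j (P v, Q v) * u j v)"
    if W: "open W" "W \<noteq> {}" "\<And>j. j < d \<Longrightarrow> ratfun W (s j)" for W s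
    unfolding Us_def sum_eq[symmetric]
  proof (rule combine_rat)
    show "open (f -` W \<inter> ?V)" "f -` W \<inter> ?V \<noteq> {}"
      using open_Int2_nonempty[OF open_vimage[OF W(1)] V(1) vimage_nonempty[OF W(2)] V(2)] .
  qed (use W(3) u ratfun_pullback in auto)
  have ind: "K.independent ?k Us"
  proof (rule K.trivial_combine_imp_independent[OF sub Us])
    fix Ks assume Ks: "set Ks \<subseteq> ?k" and 0: "K.combine Ks Us = \<zero>\<^bsub>?K\<^esub>"
    have kK: "?k \<subseteq> carrier ?K" by (rule subfieldE(3)[OF sub])
    then have "set Ks \<subseteq> carrier ?K" using Ks by blast
    \<comment> \<open>The coefficient list may have any length; it is cut or padded with zeros to
      length d.\<close>
    from K.combine_normalize[OF this Us 0] obtain Ks' where Ks':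
      "set (take (length Us) Ks) \<subseteq> set Ks'" "set Ks' \<subseteq> set (take (length Us) Ks) \<union> {\<zero>\<^bsub>?K\<^esub>}"
      "length Ks' = length Us" "K.combine Ks' Us = \<zero>\<^bsub>?K\<^esub>" by blast
    have len: "length Ks' = d" using Ks'(3) by (simp add: Us_def)
    have z: "\<zero>\<^bsub>?K\<^esub> \<in> ?k" by (rule subringE(2)[OF subfieldE(1)[OF sub]])
    have "\<forall>j\<in>{..<d}. \<exists>A\<in>carrier ?K. Ks' ! j = pullback_rational f A"
    proof
      fix j assume "j \<in> {..<d}"
      then have "Ks' ! j \<in> set Ks'" using len by simp
      then have "Ks' ! j \<in> ?k" using Ks'(2) Ks z set_take_subset[of "length Us" Ks] by blast
      then show "\<exists>A\<in>carrier ?K. Ks' ! j = pullback_rational f A" by blast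
    qed
    from bchoice[OF this[unfolded Bex_def]] obtain A where
      A: "\<forall>j\<in>{..<d}. A j \<in> carrier ?K \<and> Ks' ! j = pullback_rational f (A j)" by blast
    have "\<exists>W s. open W \<and> W \<noteq> {} \<and> (\<forall>j\<in>{..<d}. ratfun W (s j) \<and> A j = rat W (s j))"
      using A by (intro rat_common_domain) auto
    then obtain W s where W: "open W" "W \<noteq> {}" "\<forall>j\<in>{..<d}. ratfun W (s j) \<and> A j = rat W (s j)" by blast
    have Ks_eq: "Ks' = map (\<lambda>j. rat (f -` W) (\<lambda>v. s j (P v, Q v))) [0..<d]"
      using len A W(3) by (intro nth_equalityI) (auto simp: pullback_rat)
    have c: "rat (f -` W \<inter> ?V) (\<lambda>v. \<Sum>j<d. s j (P v, Q v) * u j v) = rat UNIV (\<lambda>_. 0)"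
      "ratfun (f -` W \<inter> ?V) (\<lambda>v. \<Sum>j<d. s j (P v, Q v) * u j v)"
      using comb[OF W(1,2), of s] W(3) Ks'(4) unfolding Ks_eq function_field_zero by simp_all
    have "\<forall>v\<in>cone ((f -` W \<inter> ?V) \<inter> UNIV). (\<Sum>j<d. s j (P v, Q v) * u j v) = 0"
      using c(1) unfolding rat_eq_iff[OF c(2) ratfun_const] .
    then have c0: "(\<Sum>j<d. s j (P v, Q v) * u j v) = 0" if "v \<in> cone (f -` W \<inter> ?V)" for v using that by simp
    have sW: "hreg 0 W (s j)" if "j < d" for j using W(3) that by (simp add: ratfun_def)
    \<comment> \<open>The relation is known only where y is nonzero; multiplied by y^(d-1) it
      concerns a regular section over the whole preimage and extends there.\<close>
    have tot: "hreg a (f -` W) (\<lambda>v. \<Sum>j<d. g j v * s j (P v, Q v))"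
    proof (rule hreg_sum)
      fix j assume j: "j \<in> {..<d}"
      then show "hreg a (f -` W) (\<lambda>v. g j v * s j (P v, Q v))"
        using hreg_mult[OF hreg_Form[OF g1] hreg_compose[OF sW], of j j] by simp
    qed
    have "(\<Sum>j<d. g j v * s j (P v, Q v)) = 0" if v: "v \<in> cone (f -` W)" for v
    proof (rule hreg_eqI[OF tot hreg_zero _ _ _ _ v])
      show "open (f -` W \<inter> ?V)" "f -` W \<inter> ?V \<noteq> {}" using c(2) by (simp_all add: ratfun_def)
      fix w assume w: "w \<in> cone (f -` W \<inter> ?V)"
      then have "snd w \<noteq> 0" using snd_nz by (simp add: cone_Int)
      then have "(\<Sum>j<d. g j w * s j (P w, Q w)) = (\<Sum>j<d. snd w ^ (d - 1) * (s j (P w, Q w) * u j w))"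
        by (intro sum.cong) (auto simp: u_def)
      also have "\<dots> = 0" using c0[OF w] by (simp add: sum_distrib_left[symmetric])
      finally show "(\<Sum>j<d. g j w * s j (P w, Q w)) = 0" .
    qed auto
    then have s0: "s j w = 0" if "j < d" "w \<in> cone W" for j w
      using g(2)[rule_format, OF W(1) _ _ that, of s] sW pd by simp
    have "set Ks' \<subseteq> {\<zero>\<^bsub>?K\<^esub>}"
    proof
      fix x assume "x \<in> set Ks'"
      then obtain j where j: "j < d" "x = rat (f -` W) (\<lambda>v. s j (P v, Q v))" by (auto simp: Ks_eq)
      have r: "ratfun (f -` W) (\<lambda>v. s j (P v, Q v))" using W(3) j ratfun_pullback by simp
      have "x = \<zero>\<^bsub>?K\<^esub>"
        unfolding j(2) function_field_zero rat_eq_iff[OF r ratfun_const]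
        using s0[OF j(1)] cone_vimageD by simp
      then show "x \<in> {\<zero>\<^bsub>?K\<^esub>}" by simp
    qed
    then show "set (take (length Us) Ks) \<subseteq> {\<zero>\<^bsub>?K\<^esub>}" using Ks'(1) by blast
  qed
  have "K.Span ?k Us = carrier ?K"
  proof
    show "K.Span ?k Us \<subseteq> carrier ?K"
      by (rule K.Span_in_carrier[OF subfieldE(3)[OF sub] Us])
    show "carrier ?K \<subseteq> K.Span ?k Us"
    proof
      fix A assume "A \<in> carrier ?K"
      then obtain U s where A: "ratfun U s" "A = rat U s" by (elim carrier_rat)
      have U: "open U" "U \<noteq> {}" and s: "hreg 0 U s" using A(1) by (simp_all add: ratfun_def)
      obtain e F G where FG: "F \<in> Form (0 + e)" "G \<in> Form e" "\<forall>v\<in>cone U. G v \<noteq> 0"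
        "\<forall>v\<in>cone U. s v = F v / G v" by (rule hregE[OF s])
      have Gnz: "G \<noteq> (\<lambda>_. 0)" using cone_nonempty[OF U(2)] FG(3) by auto
      with FG(2) obtain m where m: "e = int m" by (meson Form_cases)
      \<comment> \<open>The domain is replaced by the preimage of an open set, the situation to
        which \<open>push_forward\<close> applies.\<close>
      from Form_divides_pullback[OF FG(2)[unfolded m] Gnz]
      obtain H L where HL: "H \<in> Form e" "H \<noteq> (\<lambda>_. 0)" "\<forall>v. H (P v, Q v) = G v * L v"
        unfolding m by blast
      define W where "W = nonzero_locus H"
      have W: "open W" "W \<noteq> {}"
        using open_nonzero_locus[OF HL(1)] nonzero_locus_nonempty[OF HL(1,2)] by (simp_all add: W_def)
      have G: "G v \<noteq> 0" if "v \<in> cone (f -` W)" for v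
        using cone_vimageD[OF that] cone_nonzero_locus[OF HL(1)] HL(3)[rule_format, of v] by (auto simp: W_def)
      have FGr: "hreg 0 (f -` W) (\<lambda>v. F v / G v)"
        by (rule hregI[OF FG(1,2)]) (use G in auto)
      then have r: "ratfun (f -` W) (\<lambda>v. F v / G v)"
        using open_vimage[OF W(1)] vimage_nonempty[OF W(2)] by (simp add: ratfun_def)
      have A': "A = rat (f -` W) (\<lambda>v. F v / G v)"
        unfolding A(2) rat_eq_iff[OF A(1) r] using FG(4) by (simp add: cone_Int)
      have "hreg (0 + a) (f -` W) (\<lambda>v. F v / G v * snd v ^ (d - 1))"
        by (rule hreg_mult[OF FGr hreg_Form[OF snd_pow]])
      then have "hreg a (f -` W) (\<lambda>v. F v / G v * snd v ^ (d - 1))" by simp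
      from g(3)[rule_format, OF W(1) this] obtain s' where s': "\<forall>j<d. hreg (push_deg d a j) W (s' j)"
        "\<forall>v\<in>cone (f -` W). F v / G v * snd v ^ (d - 1) = (\<Sum>j<d. g j v * s' j (P v, Q v))" by blast
      have rs': "ratfun W (s' j)" if "j < d" for j
        using s'(1) pd[OF that] that W by (auto simp: ratfun_def)
      let ?Ks = "map (\<lambda>j. rat (f -` W) (\<lambda>v. s' j (P v, Q v))) [0..<d]"
      have c: "K.combine ?Ks Us = rat (f -` W \<inter> ?V) (\<lambda>v. \<Sum>j<d. s' j (P v, Q v) * u j v) \<and>
          ratfun (f -` W \<inter> ?V) (\<lambda>v. \<Sum>j<d. s' j (P v, Q v) * u j v)"
        by (rule comb[OF W]) (rule rs')
      have "K.combine ?Ks Us = A"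
      proof -
        have "rat (f -` W \<inter> ?V) (\<lambda>v. \<Sum>j<d. s' j (P v, Q v) * u j v) = rat (f -` W) (\<lambda>v. F v / G v)"
          unfolding rat_eq_iff[OF c[THEN conjunct2] r]
        proof
          fix v assume "v \<in> cone (f -` W \<inter> ?V \<inter> f -` W)"
          then have v: "v \<in> cone (f -` W)" "snd v \<noteq> 0" using snd_nz by (simp_all add: cone_Int)
          have "(\<Sum>j<d. s' j (P v, Q v) * u j v) = (\<Sum>j<d. g j v * s' j (P v, Q v)) / snd v ^ (d - 1)"
            unfolding sum_divide_distrib by (intro sum.cong) (auto simp: u_def)
          also have "\<dots> = F v / G v"
            using s'(2)[rule_format, OF v(1), symmetric] v(2) by simp
          finally show "(\<Sum>j<d. s' j (P v, Q v) * u j v) = F v / G v" .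
        qed
        then show ?thesis using c A' by simp
      qed
      moreover have "set ?Ks \<subseteq> ?k"
      proof
        fix x assume "x \<in> set ?Ks"
        then obtain j where "j < d" "x = rat (f -` W) (\<lambda>v. s' j (P v, Q v))" by auto
        then show "x \<in> ?k" using pullback_rat[OF rs'[of j], symmetric] rat_carrier[OF rs'[of j]] by simp
      qed
      ultimately show "A \<in> K.Span ?k Us"
        unfolding K.Span_eq_combine_set[OF sub Us] by blast
    qed
  qed
  then have "K.dimension (length Us) ?k (carrier ?K)"
    by (rule K.dimensionI[OF sub ind])
  then have "(K.dim over ?k) (carrier ?K) = d"
    using K.dimI[OF sub] by (simp add: Us_def)
  then show ?thesis by (simp add: morphism_degree_def over_def)
qed

end

section \<open>Split sheaves\<close>

text \<open>Extensional on the cone, so that sections with the same values there are equal.\<close>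

definition line_sections :: "int \<Rightarrow> 'k::alg_closed_field proj1 set \<Rightarrow> ('k \<times> 'k \<Rightarrow> 'k) set" where
  "line_sections b U = {s \<in> extensional (cone U). hreg b U s}"

definition split_sections ::
    "'i set \<Rightarrow> ('i \<Rightarrow> int) \<Rightarrow> 'k::alg_closed_field proj1 set \<Rightarrow> ('i \<Rightarrow> 'k \<times> 'k \<Rightarrow> 'k) set" where
  "split_sections I b U = (\<Pi>\<^sub>E i\<in>I. line_sections (b i) U)"

text \<open>The sum of line bundles enters only through its sets of sections, with the operations
  described by values at points. Two sheaves with the same target can then be compared through
  it.\<close>

definition splitting_map ::
    "('k::alg_closed_field, 'm) module_presheaf \<Rightarrow> 'i set \<Rightarrow> ('i \<Rightarrow> int) \<Rightarrow>
     ('k proj1 set \<Rightarrow> 'm \<Rightarrow> 'i \<Rightarrow> 'k \<times> 'k \<Rightarrow> 'k) \<Rightarrow> bool" where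
  "splitting_map E I b \<Psi> \<longleftrightarrow> (\<forall>U. open U \<longrightarrow>
     bij_betw (\<Psi> U) (carrier (sections E U)) (split_sections I b U) \<and>
     (\<forall>s\<in>carrier (sections E U). \<forall>t\<in>carrier (sections E U). \<forall>i\<in>I. \<forall>v\<in>cone U.
        \<Psi> U (s \<oplus>\<^bsub>sections E U\<^esub> t) i v = \<Psi> U s i v + \<Psi> U t i v) \<and>
     (\<forall>r\<in>carrier (structure_ring U). \<forall>s\<in>carrier (sections E U). \<forall>i\<in>I. \<forall>v\<in>cone U.
        \<Psi> U (r \<odot>\<^bsub>sections E U\<^esub> s) i v = r (pt v) * \<Psi> U s i v) \<and>
     (\<forall>V. open V \<longrightarrow> V \<subseteq> U \<longrightarrow> (\<forall>s\<in>carrier (sections E U). \<forall>i\<in>I. \<forall>v\<in>cone V.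
        \<Psi> V (restr E U V s) i v = \<Psi> U s i v)))"

text \<open>\<open>E\<close> is isomorphic to the direct sum of the line bundles \<open>\<O>(b i)\<close>, \<open>i \<in> I\<close>.\<close>

definition splits :: "('k::alg_closed_field, 'm) module_presheaf \<Rightarrow> 'i set \<Rightarrow> ('i \<Rightarrow> int) \<Rightarrow> bool" where
  "splits E I b \<longleftrightarrow> (\<exists>\<Psi>. splitting_map E I b \<Psi>)"

lemma splitting_map_bij:
  "splitting_map E I b \<Psi> \<Longrightarrow> open U \<Longrightarrow> bij_betw (\<Psi> U) (carrier (sections E U)) (split_sections I b U)"
  by (simp add: splitting_map_def)

lemma splitting_map_add:
  "splitting_map E I b \<Psi> \<Longrightarrow> open U \<Longrightarrow> s \<in> carrier (sections E U) \<Longrightarrow> t \<in> carrier (sections E U) \<Longrightarrow>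
    i \<in> I \<Longrightarrow> v \<in> cone U \<Longrightarrow> \<Psi> U (s \<oplus>\<^bsub>sections E U\<^esub> t) i v = \<Psi> U s i v + \<Psi> U t i v"
  by (simp add: splitting_map_def)

lemma splitting_map_smult:
  "splitting_map E I b \<Psi> \<Longrightarrow> open U \<Longrightarrow> r \<in> carrier (structure_ring U) \<Longrightarrow> s \<in> carrier (sections E U) \<Longrightarrow>
    i \<in> I \<Longrightarrow> v \<in> cone U \<Longrightarrow> \<Psi> U (r \<odot>\<^bsub>sections E U\<^esub> s) i v = r (pt v) * \<Psi> U s i v"
  by (simp add: splitting_map_def)

lemma splitting_map_restr:
  "splitting_map E I b \<Psi> \<Longrightarrow> open U \<Longrightarrow> open V \<Longrightarrow> V \<subseteq> U \<Longrightarrow> s \<in> carrier (sections E U) \<Longrightarrow>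
    i \<in> I \<Longrightarrow> v \<in> cone V \<Longrightarrow> \<Psi> V (restr E U V s) i v = \<Psi> U s i v"
  by (simp add: splitting_map_def)

lemma split_sections_eqI:
  assumes "\<sigma> \<in> split_sections I b U" "\<tau> \<in> split_sections I b U"
    "\<And>i v. i \<in> I \<Longrightarrow> v \<in> cone U \<Longrightarrow> \<sigma> i v = \<tau> i v"
  shows "\<sigma> = \<tau>"
proof (rule PiE_ext[OF assms(1,2)[unfolded split_sections_def]])
  fix i assume i: "i \<in> I"
  have "\<sigma> i \<in> extensional (cone U)" "\<tau> i \<in> extensional (cone U)"
    using assms(1,2) i by (auto simp: split_sections_def line_sections_def)
  then show "\<sigma> i = \<tau> i" by (rule extensionalityI) (rule assms(3)[OF i])
qed

lemma split_sections_hreg: "\<sigma> \<in> split_sections I b U \<Longrightarrow> i \<in> I \<Longrightarrow> hreg (b i) U (\<sigma> i)"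
  by (auto simp: split_sections_def line_sections_def)

lemma split_sections_restrict:
  assumes "\<And>i. i \<in> I \<Longrightarrow> hreg (b i) U (s i)"
  shows "(\<lambda>i\<in>I. \<lambda>v\<in>cone U. s i v) \<in> split_sections I b U"
  unfolding split_sections_def line_sections_def
proof (intro restrict_PiE_iff[THEN iffD2] ballI CollectI conjI)
  fix i assume "i \<in> I"
  then show "hreg (b i) U (\<lambda>v\<in>cone U. s i v)"
    using assms hreg_cong[of U "\<lambda>v\<in>cone U. s i v" "s i"] by simp
qed simp

text \<open>Coordinates are characterised by an equation instead of a formula; existence and
  uniqueness in both directions make them a bijection.\<close>

lemma bij_betw_from_relation:
  assumes "\<And>s. s \<in> A \<Longrightarrow> \<exists>\<sigma>\<in>B. R s \<sigma>" "\<And>\<sigma>. \<sigma> \<in> B \<Longrightarrow> \<exists>s\<in>A. R s \<sigma>"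
    and "\<And>s \<sigma> \<tau>. s \<in> A \<Longrightarrow> \<sigma> \<in> B \<Longrightarrow> \<tau> \<in> B \<Longrightarrow> R s \<sigma> \<Longrightarrow> R s \<tau> \<Longrightarrow> \<sigma> = \<tau>"
    and "\<And>s t \<sigma>. s \<in> A \<Longrightarrow> t \<in> A \<Longrightarrow> \<sigma> \<in> B \<Longrightarrow> R s \<sigma> \<Longrightarrow> R t \<sigma> \<Longrightarrow> s = t"
  shows "\<exists>\<Psi>. bij_betw \<Psi> A B \<and> (\<forall>s\<in>A. R s (\<Psi> s))"
proof -
  have "\<forall>s\<in>A. \<exists>\<sigma>. \<sigma> \<in> B \<and> R s \<sigma>" using assms(1) by blast
  from bchoice[OF this] obtain \<Psi> where \<Psi>: "\<forall>s\<in>A. \<Psi> s \<in> B \<and> R s (\<Psi> s)" by blast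
  have "bij_betw \<Psi> A B"
    unfolding bij_betw_def
  proof
    show "inj_on \<Psi> A"
    proof (rule inj_onI)
      fix s t assume st: "s \<in> A" "t \<in> A" "\<Psi> s = \<Psi> t"
      then have "R s (\<Psi> s)" "R t (\<Psi> s)" "\<Psi> s \<in> B" using \<Psi> by auto
      then show "s = t" using assms(4) st by blast
    qed
    show "\<Psi> ` A = B"
    proof
      show "B \<subseteq> \<Psi> ` A"
      proof
        fix \<sigma> assume \<sigma>: "\<sigma> \<in> B"
        then obtain s where s: "s \<in> A" "R s \<sigma>" using assms(2) by blast
        then have "\<Psi> s = \<sigma>" using assms(3)[OF s(1) _ \<sigma> _ s(2)] \<Psi> by blast
        then show "\<sigma> \<in> \<Psi> ` A" using s by blast
      qed
    qed (use \<Psi> in blast)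
  qed
  then show ?thesis using \<Psi> by blast
qed

text \<open>The closure properties on which \<open>splits_isomorphic\<close> relies; they pass
  directly to direct images.\<close>

definition closed_presheaf :: "('k::alg_closed_field, 'm) module_presheaf \<Rightarrow> bool" where
  "closed_presheaf E \<longleftrightarrow> (\<forall>U. open U \<longrightarrow>
     (\<forall>s\<in>carrier (sections E U). \<forall>t\<in>carrier (sections E U). s \<oplus>\<^bsub>sections E U\<^esub> t \<in> carrier (sections E U)) \<and>
     (\<forall>r\<in>carrier (structure_ring U). \<forall>s\<in>carrier (sections E U). r \<odot>\<^bsub>sections E U\<^esub> s \<in> carrier (sections E U)) \<and>
     (\<forall>V. open V \<longrightarrow> V \<subseteq> U \<longrightarrow> (\<forall>s\<in>carrier (sections E U). restr E U V s \<in> carrier (sections E V))))"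

lemma closed_presheaf_add:
  "closed_presheaf E \<Longrightarrow> open U \<Longrightarrow> s \<in> carrier (sections E U) \<Longrightarrow> t \<in> carrier (sections E U) \<Longrightarrow>
    s \<oplus>\<^bsub>sections E U\<^esub> t \<in> carrier (sections E U)"
  by (simp add: closed_presheaf_def)

lemma closed_presheaf_smult:
  "closed_presheaf E \<Longrightarrow> open U \<Longrightarrow> r \<in> carrier (structure_ring U) \<Longrightarrow> s \<in> carrier (sections E U) \<Longrightarrow>
    r \<odot>\<^bsub>sections E U\<^esub> s \<in> carrier (sections E U)"
  by (simp add: closed_presheaf_def)

lemma closed_presheaf_restr:
  "closed_presheaf E \<Longrightarrow> open U \<Longrightarrow> open V \<Longrightarrow> V \<subseteq> U \<Longrightarrow> s \<in> carrier (sections E U) \<Longrightarrow>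
    restr E U V s \<in> carrier (sections E V)"
  by (simp add: closed_presheaf_def)

lemma presheaf_module:
  assumes "is_module_presheaf E" "open U"
  shows "Module.module (structure_ring U) (sections E U)"
proof -
  from assms(1) have "\<forall>U. open U \<longrightarrow> Module.module (structure_ring U) (sections E U)"
    unfolding is_module_presheaf_def by (elim conjE)
  then show ?thesis using assms(2) by simp
qed

lemma presheaf_restr:
  assumes "is_module_presheaf E" "open U" "open V" "V \<subseteq> U" "s \<in> carrier (sections E U)"
  shows "restr E U V s \<in> carrier (sections E V)"
    and "t \<in> carrier (sections E U) \<Longrightarrow>
      restr E U V (s \<oplus>\<^bsub>sections E U\<^esub> t) = restr E U V s \<oplus>\<^bsub>sections E V\<^esub> restr E U V t"
    and "r \<in> carrier (structure_ring U) \<Longrightarrow>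
      restr E U V (r \<odot>\<^bsub>sections E U\<^esub> s) = restrict r V \<odot>\<^bsub>sections E V\<^esub> restr E U V s"
proof -
  from assms(1) have *: "\<forall>U V. open U \<longrightarrow> open V \<longrightarrow> V \<subseteq> U \<longrightarrow>
        restr E U V \<in> hom (add_monoid (sections E U)) (add_monoid (sections E V)) \<and>
        (\<forall>r\<in>carrier (structure_ring U). \<forall>s\<in>carrier (sections E U).
           restr E U V (r \<odot>\<^bsub>sections E U\<^esub> s) = restrict r V \<odot>\<^bsub>sections E V\<^esub> restr E U V s)"
    unfolding is_module_presheaf_def by (elim conjE)
  note r = *[rule_format, OF assms(2-4)]
  from r have hom: "restr E U V \<in> hom (add_monoid (sections E U)) (add_monoid (sections E V))" by blast
  show "restr E U V s \<in> carrier (sections E V)" using hom assms(5) unfolding hom_def by auto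
  show "restr E U V (s \<oplus>\<^bsub>sections E U\<^esub> t) = restr E U V s \<oplus>\<^bsub>sections E V\<^esub> restr E U V t"
    if "t \<in> carrier (sections E U)" using hom assms(5) that unfolding hom_def by auto
  show "restr E U V (r \<odot>\<^bsub>sections E U\<^esub> s) = restrict r V \<odot>\<^bsub>sections E V\<^esub> restr E U V s"
    if "r \<in> carrier (structure_ring U)" using r that assms(5) by blast
qed

lemma presheaf_restr_restr:
  assumes "is_module_presheaf E" "open U" "open V" "open W" "W \<subseteq> V" "V \<subseteq> U" "s \<in> carrier (sections E U)"
  shows "restr E V W (restr E U V s) = restr E U W s"
proof -
  from assms(1) have "\<forall>U V W. open U \<longrightarrow> open V \<longrightarrow> open W \<longrightarrow> W \<subseteq> V \<longrightarrow> V \<subseteq> U \<longrightarrow>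
        (\<forall>s\<in>carrier (sections E U). restr E V W (restr E U V s) = restr E U W s)"
    unfolding is_module_presheaf_def by (elim conjE)
  from this[rule_format, OF assms(2-7)] show ?thesis .
qed

lemma presheaf_restr_self:
  assumes "is_module_presheaf E" "open U" "s \<in> carrier (sections E U)"
  shows "restr E U U s = s"
proof -
  from assms(1) have "\<forall>U. open U \<longrightarrow> (\<forall>s\<in>carrier (sections E U). restr E U U s = s)"
    unfolding is_module_presheaf_def by (elim conjE)
  from this[rule_format, OF assms(2,3)] show ?thesis .
qed

lemma presheaf_add_closed:
  assumes "is_module_presheaf E" "open U" "s \<in> carrier (sections E U)" "t \<in> carrier (sections E U)"
  shows "s \<oplus>\<^bsub>sections E U\<^esub> t \<in> carrier (sections E U)"
proof -
  interpret Module.module "structure_ring U" "sections E U" by (rule presheaf_module[OF assms(1,2)])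
  show ?thesis using assms(3,4) by (rule M.a_closed)
qed

lemma presheaf_smult_closed:
  assumes "is_module_presheaf E" "open U" "r \<in> carrier (structure_ring U)" "s \<in> carrier (sections E U)"
  shows "r \<odot>\<^bsub>sections E U\<^esub> s \<in> carrier (sections E U)"
proof -
  interpret Module.module "structure_ring U" "sections E U" by (rule presheaf_module[OF assms(1,2)])
  show ?thesis using assms(3,4) by (rule smult_closed)
qed

lemma module_presheaf_closed: "is_module_presheaf E \<Longrightarrow> closed_presheaf E"
  unfolding closed_presheaf_def
  by (intro allI impI conjI ballI; (rule presheaf_add_closed presheaf_smult_closed presheaf_restr(1); assumption))

text \<open>The isomorphism is one splitting followed by the inverse of the other. Its compatibility
  with the operations is checked on coordinates, where both splittings obey the same
  formulas.\<close>

lemma splits_isomorphic: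
  fixes E :: "('k::alg_closed_field, 'm) module_presheaf" and F :: "('k, 'n) module_presheaf"
  assumes "closed_presheaf E" "closed_presheaf F" "splits E I b" "splits F I b"
  shows "isomorphic E F"
proof -
  note E = assms(1) and F = assms(2)
  from assms(3) obtain \<Psi> where \<Psi>: "splitting_map E I b \<Psi>" unfolding splits_def ..
  from assms(4) obtain \<Phi> where \<Phi>: "splitting_map F I b \<Phi>" unfolding splits_def ..
  define \<phi> where "\<phi> U = inv_into (carrier (sections F U)) (\<Phi> U) \<circ> \<Psi> U" for U
  have bij: "bij_betw (\<phi> U) (carrier (sections E U)) (carrier (sections F U))" if "open U" for U
    unfolding \<phi>_def
    by (rule bij_betw_trans[OF splitting_map_bij[OF \<Psi> that] bij_betw_inv_into[OF splitting_map_bij[OF \<Phi> that]]])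
  have in_F: "\<phi> U s \<in> carrier (sections F U)" if "open U" "s \<in> carrier (sections E U)" for U s
    using bij_betwE[OF bij[OF that(1)]] that(2) by blast
  have val: "\<Phi> U (\<phi> U s) = \<Psi> U s" if "open U" "s \<in> carrier (sections E U)" for U s
  proof -
    have "\<Psi> U s \<in> split_sections I b U" using bij_betwE[OF splitting_map_bij[OF \<Psi> that(1)]] that(2) by blast
    then show ?thesis
      using bij_betw_inv_into_right[OF splitting_map_bij[OF \<Phi> that(1)]] by (simp add: \<phi>_def)
  qed
  have eqI: "x = y" if U: "open U" and x: "x \<in> carrier (sections F U)" and y: "y \<in> carrier (sections F U)"
    and eq: "\<And>i v. i \<in> I \<Longrightarrow> v \<in> cone U \<Longrightarrow> \<Phi> U x i v = \<Phi> U y i v" for U x y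
  proof -
    have b: "bij_betw (\<Phi> U) (carrier (sections F U)) (split_sections I b U)" by (rule splitting_map_bij[OF \<Phi> U])
    have "\<Phi> U x = \<Phi> U y"
      using bij_betwE[OF b] x y by (intro split_sections_eqI[of _ I b U] eq) auto
    then show ?thesis using inj_onD[OF bij_betw_imp_inj_on[OF b]] x y by blast
  qed
  show ?thesis
    unfolding isomorphic_on_def
  proof (intro exI[of _ \<phi>] conjI allI impI ballI)
    fix V :: "'k proj1 set" assume V: "open V"
    have "\<phi> V (s \<oplus>\<^bsub>sections E V\<^esub> t) = \<phi> V s \<oplus>\<^bsub>sections F V\<^esub> \<phi> V t"
      if s: "s \<in> carrier (sections E V)" and t: "t \<in> carrier (sections E V)" for s t
    proof (rule eqI[OF V])
      have st: "s \<oplus>\<^bsub>sections E V\<^esub> t \<in> carrier (sections E V)" by (rule closed_presheaf_add[OF E V s t])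
      show "\<phi> V (s \<oplus>\<^bsub>sections E V\<^esub> t) \<in> carrier (sections F V)" by (rule in_F[OF V st])
      show "\<phi> V s \<oplus>\<^bsub>sections F V\<^esub> \<phi> V t \<in> carrier (sections F V)"
        by (rule closed_presheaf_add[OF F V in_F[OF V s] in_F[OF V t]])
      fix i v assume "i \<in> I" "v \<in> cone V"
      then show "\<Phi> V (\<phi> V (s \<oplus>\<^bsub>sections E V\<^esub> t)) i v = \<Phi> V (\<phi> V s \<oplus>\<^bsub>sections F V\<^esub> \<phi> V t) i v"
        using s t in_F[OF V s] in_F[OF V t]
        by (simp add: val[OF V] st splitting_map_add[OF \<Psi> V] splitting_map_add[OF \<Phi> V])
    qed
    then show "\<phi> V \<in> iso (add_monoid (sections E V)) (add_monoid (sections F V))"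
      using bij[OF V] in_F[OF V] by (auto simp: iso_def hom_def)
    fix r s assume r: "r \<in> carrier (structure_ring V)" and s: "s \<in> carrier (sections E V)"
    show "\<phi> V (r \<odot>\<^bsub>sections E V\<^esub> s) = r \<odot>\<^bsub>sections F V\<^esub> \<phi> V s"
    proof (rule eqI[OF V])
      have rs: "r \<odot>\<^bsub>sections E V\<^esub> s \<in> carrier (sections E V)" by (rule closed_presheaf_smult[OF E V r s])
      show "\<phi> V (r \<odot>\<^bsub>sections E V\<^esub> s) \<in> carrier (sections F V)" by (rule in_F[OF V rs])
      show "r \<odot>\<^bsub>sections F V\<^esub> \<phi> V s \<in> carrier (sections F V)" by (rule closed_presheaf_smult[OF F V r in_F[OF V s]])
      fix i v assume "i \<in> I" "v \<in> cone V"
      then show "\<Phi> V (\<phi> V (r \<odot>\<^bsub>sections E V\<^esub> s)) i v = \<Phi> V (r \<odot>\<^bsub>sections F V\<^esub> \<phi> V s) i v"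
        using r s in_F[OF V s]
        by (simp add: val[OF V] rs splitting_map_smult[OF \<Psi> V] splitting_map_smult[OF \<Phi> V])
    qed
  next
    fix V W :: "'k proj1 set" and s assume V: "open V" and W: "open W" "W \<subseteq> V" and s: "s \<in> carrier (sections E V)"
    show "\<phi> W (restr E V W s) = restr F V W (\<phi> V s)"
    proof (rule eqI[OF W(1)])
      have rs: "restr E V W s \<in> carrier (sections E W)" by (rule closed_presheaf_restr[OF E V W s])
      show "\<phi> W (restr E V W s) \<in> carrier (sections F W)" by (rule in_F[OF W(1) rs])
      show "restr F V W (\<phi> V s) \<in> carrier (sections F W)" by (rule closed_presheaf_restr[OF F V W in_F[OF V s]])
      fix i v assume iv: "i \<in> I" "v \<in> cone W"
      have "\<Phi> W (\<phi> W (restr E V W s)) i v = \<Psi> V s i v"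
        using splitting_map_restr[OF \<Psi> V W s iv] by (simp add: val[OF W(1) rs])
      also have "\<dots> = \<Phi> W (restr F V W (\<phi> V s)) i v"
        using splitting_map_restr[OF \<Phi> V W in_F[OF V s] iv] by (simp add: val[OF V s])
      finally show "\<Phi> W (\<phi> W (restr E V W s)) i v = \<Phi> W (restr F V W (\<phi> V s)) i v" .
    qed
  qed
qed

section \<open>Direct images of split sheaves\<close>

lemma structure_ring_hreg: "open U \<Longrightarrow> r \<in> carrier (structure_ring U) \<Longrightarrow> hreg 0 U (\<lambda>v. r (pt v))"
  using regular_on_iff_hreg[of U r] by (simp add: carrier_structure_ring_iff)

lemma structure_ring_pullback:
  assumes "is_morphism f" "open U" "r \<in> carrier (structure_ring U)"
  shows "(\<lambda>p\<in>f -` U. r (f p)) \<in> carrier (structure_ring (f -` U))"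
proof -
  have U': "open (f -` U)" using morphism_open_vimage assms by blast
  have "regular_on (f -` U) (r \<circ> f)"
    using morphism_pullback_regular[OF assms(1,2)] assms(3) by (simp add: carrier_structure_ring_iff)
  then have "hreg 0 (f -` U) (\<lambda>v. r (f (pt v)))" using regular_on_iff_hreg[OF U', of "r \<circ> f"] by simp
  then have "hreg 0 (f -` U) (\<lambda>v. (\<lambda>p\<in>f -` U. r (f p)) (pt v))"
    using hreg_cong[of "f -` U" "\<lambda>v. (\<lambda>p\<in>f -` U. r (f p)) (pt v)" "\<lambda>v. r (f (pt v))"] by (simp add: cone_def)
  then show ?thesis using regular_on_iff_hreg[OF U'] by (simp add: carrier_structure_ring_iff)
qed

lemma direct_image_simps:
  "carrier (sections (direct_image f E) U) = carrier (sections E (f -` U))"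
  "s \<oplus>\<^bsub>sections (direct_image f E) U\<^esub> t = s \<oplus>\<^bsub>sections E (f -` U)\<^esub> t"
  "r \<odot>\<^bsub>sections (direct_image f E) U\<^esub> s = (\<lambda>p\<in>f -` U. r (f p)) \<odot>\<^bsub>sections E (f -` U)\<^esub> s"
  "restr (direct_image f E) U V s = restr E (f -` U) (f -` V) s"
  by (simp_all add: direct_image_def)

lemma closed_presheaf_direct_image:
  fixes f :: "'k::alg_closed_field proj1 \<Rightarrow> 'k proj1"
  assumes f: "is_morphism f" and E: "closed_presheaf E"
  shows "closed_presheaf (direct_image f E)"
  unfolding closed_presheaf_def direct_image_simps
proof (intro allI impI conjI ballI)
  fix U :: "'k proj1 set" assume U: "open U"
  note U' = morphism_open_vimage[OF f U]
  fix s assume s: "s \<in> carrier (sections E (f -` U))"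
  show "s \<oplus>\<^bsub>sections E (f -` U)\<^esub> t \<in> carrier (sections E (f -` U))" if "t \<in> carrier (sections E (f -` U))" for t
    by (rule closed_presheaf_add[OF E U' s that])
  show "(\<lambda>p\<in>f -` U. r (f p)) \<odot>\<^bsub>sections E (f -` U)\<^esub> s \<in> carrier (sections E (f -` U))"
    if "r \<in> carrier (structure_ring U)" for r
    by (rule closed_presheaf_smult[OF E U' structure_ring_pullback[OF f U that] s])
  show "restr E (f -` U) (f -` V) s \<in> carrier (sections E (f -` V))" if "open V" "V \<subseteq> U" for V
    by (rule closed_presheaf_restr[OF E U' morphism_open_vimage[OF f that(1)] vimage_mono[OF that(2)] s])
qed

text \<open>\<open>push_forward\<close> is applied to each summand O(b i). Coordinates over U are
  determined by those they induce over the preimage, so every compatibility is transported from the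
  given splitting.\<close>

lemma (in proj_map) splits_direct_image:
  assumes f: "is_morphism f" and cl: "closed_presheaf E" and E: "splits E I b"
  shows "splits (direct_image f E) (I \<times> {..<d}) (\<lambda>(i, j). push_deg d (b i) j)"
proof -
  have "\<forall>a. \<exists>g. (\<forall>j<d. g j \<in> Form (a - int d * push_deg d a j)) \<and>
    (\<forall>U s. open U \<longrightarrow> (\<forall>j<d. hreg (push_deg d a j) U (s j)) \<longrightarrow>
      (\<forall>v\<in>cone (f -` U). (\<Sum>j<d. g j v * s j (P v, Q v)) = 0) \<longrightarrow> (\<forall>j<d. \<forall>w\<in>cone U. s j w = 0)) \<and>
    (\<forall>U t. open U \<longrightarrow> hreg a (f -` U) t \<longrightarrow> (\<exists>s. (\<forall>j<d. hreg (push_deg d a j) U (s j)) \<and>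
        (\<forall>v\<in>cone (f -` U). t v = (\<Sum>j<d. g j v * s j (P v, Q v)))))"
    by (rule allI) (rule push_forward)
  from choice[OF this] obtain g where
    "\<forall>a. (\<forall>j<d. g a j \<in> Form (a - int d * push_deg d a j)) \<and>
    (\<forall>U s. open U \<longrightarrow> (\<forall>j<d. hreg (push_deg d a j) U (s j)) \<longrightarrow>
      (\<forall>v\<in>cone (f -` U). (\<Sum>j<d. g a j v * s j (P v, Q v)) = 0) \<longrightarrow> (\<forall>j<d. \<forall>w\<in>cone U. s j w = 0)) \<and>
    (\<forall>U t. open U \<longrightarrow> hreg a (f -` U) t \<longrightarrow> (\<exists>s. (\<forall>j<d. hreg (push_deg d a j) U (s j)) \<and>
        (\<forall>v\<in>cone (f -` U). t v = (\<Sum>j<d. g a j v * s j (P v, Q v)))))" by (elim exE)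
  then have g1: "\<And>a j. j < d \<Longrightarrow> g a j \<in> Form (a - int d * push_deg d a j)"
    and g2: "\<And>a U s. open U \<Longrightarrow> \<forall>j<d. hreg (push_deg d a j) U (s j) \<Longrightarrow>
      \<forall>v\<in>cone (f -` U). (\<Sum>j<d. g a j v * s j (P v, Q v)) = 0 \<Longrightarrow> \<forall>j<d. \<forall>w\<in>cone U. s j w = 0"
    and g3: "\<And>a U t. open U \<Longrightarrow> hreg a (f -` U) t \<Longrightarrow> \<exists>s. (\<forall>j<d. hreg (push_deg d a j) U (s j)) \<and>
        (\<forall>v\<in>cone (f -` U). t v = (\<Sum>j<d. g a j v * s j (P v, Q v)))"
    by simp_all
  from E obtain \<Psi> where \<Psi>: "splitting_map E I b \<Psi>" unfolding splits_def ..
  let ?J = "I \<times> {..<d}" and ?b = "\<lambda>(i, j). push_deg d (b i) j"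
  \<comment> \<open>\<open>ev \<sigma> i\<close> is the i-th coordinate over the preimage of U
    represented by the coordinates \<open>\<sigma>\<close> over U.\<close>
  define ev where "ev \<sigma> i v = (\<Sum>j<d. g (b i) j v * \<sigma> (i, j) (P v, Q v))"
    for \<sigma> :: "_ \<times> nat \<Rightarrow> 'k \<times> 'k \<Rightarrow> 'k" and i v
  have ev_unique: "\<sigma> x w = \<tau> x w"
    if U: "open U" and h: "\<And>x. x \<in> ?J \<Longrightarrow> hreg (?b x) U (\<sigma> x)" "\<And>x. x \<in> ?J \<Longrightarrow> hreg (?b x) U (\<tau> x)"
      and eq: "\<And>i v. i \<in> I \<Longrightarrow> v \<in> cone (f -` U) \<Longrightarrow> ev \<sigma> i v = ev \<tau> i v"
      and x: "x \<in> ?J" "w \<in> cone U" for U \<sigma> \<tau> x w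
  proof -
    obtain i j where ij: "x = (i, j)" "i \<in> I" "j < d" using x(1) by auto
    have "\<forall>j<d. hreg (push_deg d (b i) j) U (\<lambda>v. \<sigma> (i, j) v + - 1 * \<tau> (i, j) v)"
    proof (intro allI impI)
      fix j assume "j < d"
      then have "(i, j) \<in> ?J" using ij by simp
      from hreg_add[OF h(1)[OF this] hreg_scale[OF h(2)[OF this], of "- 1"]]
      show "hreg (push_deg d (b i) j) U (\<lambda>v. \<sigma> (i, j) v + - 1 * \<tau> (i, j) v)" by simp
    qed
    moreover have "\<forall>v\<in>cone (f -` U). (\<Sum>j<d. g (b i) j v * (\<sigma> (i, j) (P v, Q v) + - 1 * \<tau> (i, j) (P v, Q v))) = 0"
      using eq[OF ij(2)] by (simp add: ev_def algebra_simps sum_subtractf)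
    ultimately have "\<forall>j<d. \<forall>w\<in>cone U. \<sigma> (i, j) w + - 1 * \<tau> (i, j) w = 0" by (rule g2[OF U])
    then show ?thesis using ij x(2) by simp
  qed
  have "\<exists>\<Phi>. bij_betw \<Phi> (carrier (sections E (f -` U))) (split_sections ?J ?b U) \<and>
    (\<forall>s\<in>carrier (sections E (f -` U)). \<forall>i\<in>I. \<forall>v\<in>cone (f -` U). \<Psi> (f -` U) s i v = ev (\<Phi> s) i v)"
    if U: "open U" for U
  proof (rule bij_betw_from_relation)
    note U' = open_vimage[OF U]
    have bij: "bij_betw (\<Psi> (f -` U)) (carrier (sections E (f -` U))) (split_sections I b (f -` U))"
      by (rule splitting_map_bij[OF \<Psi> U'])
    {
      fix s assume s: "s \<in> carrier (sections E (f -` U))"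
      have sS: "\<Psi> (f -` U) s \<in> split_sections I b (f -` U)" using bij_betwE[OF bij] s by blast
      have "\<forall>i\<in>I. \<exists>t. (\<forall>j<d. hreg (push_deg d (b i) j) U (t j)) \<and>
          (\<forall>v\<in>cone (f -` U). \<Psi> (f -` U) s i v = (\<Sum>j<d. g (b i) j v * t j (P v, Q v)))"
        using g3[OF U split_sections_hreg[OF sS]] by blast
      from bchoice[OF this] obtain t where t: "\<forall>i\<in>I. (\<forall>j<d. hreg (push_deg d (b i) j) U (t i j)) \<and>
          (\<forall>v\<in>cone (f -` U). \<Psi> (f -` U) s i v = (\<Sum>j<d. g (b i) j v * t i j (P v, Q v)))" by blast
      let ?\<sigma> = "\<lambda>x\<in>?J. \<lambda>w\<in>cone U. t (fst x) (snd x) w"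
      have "?\<sigma> \<in> split_sections ?J ?b U"
        by (rule split_sections_restrict) (use t in auto)
      moreover have "\<forall>i\<in>I. \<forall>v\<in>cone (f -` U). \<Psi> (f -` U) s i v = ev ?\<sigma> i v"
        using t cone_vimageD by (simp add: ev_def)
      ultimately show "\<exists>\<sigma>\<in>split_sections ?J ?b U. \<forall>i\<in>I. \<forall>v\<in>cone (f -` U). \<Psi> (f -` U) s i v = ev \<sigma> i v"
        by blast
    }
    {
      fix \<sigma> assume \<sigma>: "\<sigma> \<in> split_sections ?J ?b U"
      have "hreg (b i) (f -` U) (ev \<sigma> i)" if i: "i \<in> I" for i
        unfolding ev_def
      proof (rule hreg_sum)
        fix j assume j: "j \<in> {..<d}"
        then have "(i, j) \<in> ?J" using i by simp
        from split_sections_hreg[OF \<sigma> this] have "hreg (push_deg d (b i) j) U (\<sigma> (i, j))" by simp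
        from hreg_mult[OF hreg_Form[OF g1] hreg_compose[OF this], of j "b i"] j
        show "hreg (b i) (f -` U) (\<lambda>v. g (b i) j v * \<sigma> (i, j) (P v, Q v))" by simp
      qed
      then have m: "(\<lambda>i\<in>I. \<lambda>v\<in>cone (f -` U). ev \<sigma> i v) \<in> split_sections I b (f -` U)"
        by (rule split_sections_restrict)
      obtain s where s: "s \<in> carrier (sections E (f -` U))"
        "\<Psi> (f -` U) s = (\<lambda>i\<in>I. \<lambda>v\<in>cone (f -` U). ev \<sigma> i v)"
        using m bij_betw_imp_surj_on[OF bij] by (metis (no_types, lifting) imageE)
      then show "\<exists>s\<in>carrier (sections E (f -` U)). \<forall>i\<in>I. \<forall>v\<in>cone (f -` U). \<Psi> (f -` U) s i v = ev \<sigma> i v"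
        by (intro bexI[of _ s]) simp_all
    }
    {
      fix s \<sigma> \<tau> assume \<sigma>: "\<sigma> \<in> split_sections ?J ?b U" and \<tau>: "\<tau> \<in> split_sections ?J ?b U"
        and eq: "\<forall>i\<in>I. \<forall>v\<in>cone (f -` U). \<Psi> (f -` U) s i v = ev \<sigma> i v"
          "\<forall>i\<in>I. \<forall>v\<in>cone (f -` U). \<Psi> (f -` U) s i v = ev \<tau> i v"
      have e: "ev \<sigma> i v = ev \<tau> i v" if "i \<in> I" "v \<in> cone (f -` U)" for i v
        using eq that by simp
      show "\<sigma> = \<tau>"
        by (rule split_sections_eqI[OF \<sigma> \<tau>])
          (rule ev_unique[OF U split_sections_hreg[OF \<sigma>] split_sections_hreg[OF \<tau>] e])
    }
    {
      fix s t \<sigma> assume st: "s \<in> carrier (sections E (f -` U))" "t \<in> carrier (sections E (f -` U))"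
        and eq: "\<forall>i\<in>I. \<forall>v\<in>cone (f -` U). \<Psi> (f -` U) s i v = ev \<sigma> i v"
          "\<forall>i\<in>I. \<forall>v\<in>cone (f -` U). \<Psi> (f -` U) t i v = ev \<sigma> i v"
      have m: "\<Psi> (f -` U) s \<in> split_sections I b (f -` U)" "\<Psi> (f -` U) t \<in> split_sections I b (f -` U)"
        using bij_betwE[OF bij] st by blast+
      have "\<Psi> (f -` U) s = \<Psi> (f -` U) t"
        by (rule split_sections_eqI[OF m]) (use eq in simp)
      then show "s = t" using inj_onD[OF bij_betw_imp_inj_on[OF bij]] st by blast
    }
  qed
  then have "\<forall>U. \<exists>\<Phi>. open U \<longrightarrow> bij_betw \<Phi> (carrier (sections E (f -` U))) (split_sections ?J ?b U) \<and>
    (\<forall>s\<in>carrier (sections E (f -` U)). \<forall>i\<in>I. \<forall>v\<in>cone (f -` U). \<Psi> (f -` U) s i v = ev (\<Phi> s) i v)"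
    by simp
  from choice[OF this] obtain \<Phi> where "\<forall>U. open U \<longrightarrow>
    bij_betw (\<Phi> U) (carrier (sections E (f -` U))) (split_sections ?J ?b U) \<and>
    (\<forall>s\<in>carrier (sections E (f -` U)). \<forall>i\<in>I. \<forall>v\<in>cone (f -` U). \<Psi> (f -` U) s i v = ev (\<Phi> U s) i v)" ..
  then have \<Phi>: "\<And>U. open U \<Longrightarrow> bij_betw (\<Phi> U) (carrier (sections E (f -` U))) (split_sections ?J ?b U)"
    "\<And>U s i v. open U \<Longrightarrow> s \<in> carrier (sections E (f -` U)) \<Longrightarrow> i \<in> I \<Longrightarrow> v \<in> cone (f -` U) \<Longrightarrow>
      \<Psi> (f -` U) s i v = ev (\<Phi> U s) i v" by simp_all
  have \<Phi>h: "hreg (?b x) U (\<Phi> U s x)"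
    if "open U" "s \<in> carrier (sections E (f -` U))" "x \<in> ?J" for U s x
    using split_sections_hreg[OF _ that(3)] bij_betwE[OF \<Phi>(1)[OF that(1)]] that(2) by blast
  show ?thesis
    unfolding splits_def splitting_map_def direct_image_simps
  proof (intro exI[of _ \<Phi>] allI impI conjI ballI)
    fix U :: "'k proj1 set" assume U: "open U"
    note U' = open_vimage[OF U]
    show "bij_betw (\<Phi> U) (carrier (sections E (f -` U))) (split_sections ?J ?b U)" by (rule \<Phi>(1)[OF U])
    fix s assume s: "s \<in> carrier (sections E (f -` U))"
    {
      fix t x w assume t: "t \<in> carrier (sections E (f -` U))" and x: "x \<in> ?J" "w \<in> cone U"
      have st: "s \<oplus>\<^bsub>sections E (f -` U)\<^esub> t \<in> carrier (sections E (f -` U))" by (rule closed_presheaf_add[OF cl U' s t])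
      show "\<Phi> U (s \<oplus>\<^bsub>sections E (f -` U)\<^esub> t) x w = \<Phi> U s x w + \<Phi> U t x w"
      proof (rule ev_unique[OF U _ _ _ x, where \<tau> = "\<lambda>x w. \<Phi> U s x w + \<Phi> U t x w"])
        fix i v assume iv: "i \<in> I" "v \<in> cone (f -` U)"
        have "ev (\<Phi> U (s \<oplus>\<^bsub>sections E (f -` U)\<^esub> t)) i v = ev (\<Phi> U s) i v + ev (\<Phi> U t) i v"
          using splitting_map_add[OF \<Psi> U' s t iv] \<Phi>(2)[OF U st iv] \<Phi>(2)[OF U s iv] \<Phi>(2)[OF U t iv] by simp
        then show "ev (\<Phi> U (s \<oplus>\<^bsub>sections E (f -` U)\<^esub> t)) i v = ev (\<lambda>x w. \<Phi> U s x w + \<Phi> U t x w) i v"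
          by (simp add: ev_def sum.distrib distrib_left)
      next
        show "hreg (?b y) U (\<lambda>w. \<Phi> U s y w + \<Phi> U t y w)" if "y \<in> ?J" for y
          by (rule hreg_add[OF \<Phi>h[OF U s that] \<Phi>h[OF U t that]])
      qed (rule \<Phi>h[OF U st])
    }
    {
      fix V :: "'k proj1 set" and x w assume V: "open V" "V \<subseteq> U" and x: "x \<in> ?J" "w \<in> cone V"
      have sub: "f -` V \<subseteq> f -` U" using V(2) by blast
      have rs: "restr E (f -` U) (f -` V) s \<in> carrier (sections E (f -` V))"
        by (rule closed_presheaf_restr[OF cl U' open_vimage[OF V(1)] sub s])
      show "\<Phi> V (restr E (f -` U) (f -` V) s) x w = \<Phi> U s x w"
      proof (rule ev_unique[OF V(1) _ _ _ x])
        show "hreg (?b y) V (\<Phi> U s y)" if "y \<in> ?J" for y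
          by (rule hreg_mono[OF \<Phi>h[OF U s that] V(2)])
        fix i v assume iv: "i \<in> I" "v \<in> cone (f -` V)"
        have iv': "v \<in> cone (f -` U)" using iv(2) cone_mono[OF sub] by blast
        show "ev (\<Phi> V (restr E (f -` U) (f -` V) s)) i v = ev (\<Phi> U s) i v"
          using splitting_map_restr[OF \<Psi> U' open_vimage[OF V(1)] sub s iv]
            \<Phi>(2)[OF V(1) rs iv] \<Phi>(2)[OF U s iv(1) iv'] by simp
      qed (rule \<Phi>h[OF V(1) rs])
    }
  next
    fix U :: "'k proj1 set" and r s x w assume U: "open U" and r: "r \<in> carrier (structure_ring U)"
      and s: "s \<in> carrier (sections E (f -` U))" and x: "x \<in> ?J" "w \<in> cone U"
    note U' = open_vimage[OF U]
    let ?r = "\<lambda>p\<in>f -` U. r (f p)"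
    have r': "?r \<in> carrier (structure_ring (f -` U))" by (rule structure_ring_pullback[OF f U r])
    have rs: "?r \<odot>\<^bsub>sections E (f -` U)\<^esub> s \<in> carrier (sections E (f -` U))"
      by (rule closed_presheaf_smult[OF cl U' r' s])
    show "\<Phi> U (?r \<odot>\<^bsub>sections E (f -` U)\<^esub> s) x w = r (pt w) * \<Phi> U s x w"
    proof (rule ev_unique[OF U _ _ _ x, where \<tau> = "\<lambda>x w. r (pt w) * \<Phi> U s x w"])
      show "hreg (?b y) U (\<lambda>w. r (pt w) * \<Phi> U s y w)" if "y \<in> ?J" for y
        using hreg_mult[OF structure_ring_hreg[OF U r] \<Phi>h[OF U s that]] by simp
      fix i v assume iv: "i \<in> I" "v \<in> cone (f -` U)"
      have "?r (pt v) = r (pt (P v, Q v))" using iv(2) f_pt[of v] by (simp add: cone_def)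
      then have "ev (\<Phi> U (?r \<odot>\<^bsub>sections E (f -` U)\<^esub> s)) i v = r (pt (P v, Q v)) * ev (\<Phi> U s) i v"
        using splitting_map_smult[OF \<Psi> U' r' s iv] \<Phi>(2)[OF U rs iv] \<Phi>(2)[OF U s iv] by simp
      then show "ev (\<Phi> U (?r \<odot>\<^bsub>sections E (f -` U)\<^esub> s)) i v = ev (\<lambda>x w. r (pt w) * \<Phi> U s x w) i v"
        by (simp add: ev_def sum_distrib_left algebra_simps)
    qed (rule \<Phi>h[OF U rs])
  qed
qed

section \<open>Vector bundles split\<close>

text \<open>The complement lies in the zero set of a nonzero form: finitely many points of the
  affine line and possibly (1, 0).\<close>

lemma open_finite_complement:
  fixes U :: "'k::alg_closed_field proj1 set"
  assumes "open U" "U \<noteq> {}"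
  shows "finite (- U)"
proof -
  obtain v where v: "v \<in> cone U" using cone_nonempty[OF assms(2)] by blast
  obtain m F where F: "F \<in> Form m" "F v \<noteq> 0" "nonzero_locus F \<subseteq> U" using open_basic[OF assms(1) v] .
  have Fnz: "F \<noteq> (\<lambda>_. 0)" using F(2) by auto
  with F(1) obtain k where k: "F \<in> Form (int k)" by (meson Form_cases)
  obtain p where p: "\<And>x. F (x, 1) = poly p x" by (rule Form_poly[OF k]) (rule that)
  have "p \<noteq> 0"
  proof
    assume "p = 0"
    then have "F = (\<lambda>_. 0)" using Form_eq_zero[OF F(1)] p by simp
    then show False using Fnz by blast
  qed
  then have "finite {x. poly p x = 0}" by (rule poly_roots_finite)
  moreover have "- U \<subseteq> insert (pt (1, 0)) ((\<lambda>x. pt (x, 1)) ` {x. poly p x = 0})"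
  proof
    fix q assume q: "q \<in> - U"
    obtain w where w: "w \<noteq> (0, 0)" "q = pt w" by (rule pt_surj)
    obtain a b where ab: "w = (a, b)" by force
    have "w \<notin> cone (nonzero_locus F)" using q w F(3) by (auto simp: cone_def)
    then have Fw: "F w = 0" using cone_nonzero_locus[OF F(1)] w(1) by blast
    show "q \<in> insert (pt (1, 0)) ((\<lambda>x. pt (x, 1)) ` {x. poly p x = 0})"
    proof (cases "b = 0")
      case True
      then have "proj_rel (1, 0) w" using w(1) ab by (auto simp: proj_rel_def)
      then have "pt (1, 0) = pt w" using pt_eq_iff[of "(1, 0)" w] w(1) by simp
      then show ?thesis using w(2) by simp
    next
      case False
      then have r: "proj_rel w (a / b, 1)"
        unfolding proj_rel_def ab by (auto intro!: exI[of _ "1 / b"])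
      then have "pt w = pt (a / b, 1)" using pt_eq_iff[of w "(a / b, 1)"] w(1) by simp
      moreover have "poly p (a / b) = 0" using proj_rel_Form_zero[OF r F(1)] Fw p by simp
      ultimately show ?thesis using w(2) by blast
    qed
  qed
  ultimately show ?thesis by (meson finite_imageI finite_insert finite_subset)
qed

section \<open>Glueing and local coordinates\<close>

lemma sheaf_glue:
  assumes "is_module_sheaf E" "\<forall>U\<in>\<U>. open U \<and> s U \<in> carrier (sections E U)"
    "\<forall>U\<in>\<U>. \<forall>V\<in>\<U>. restr E U (U \<inter> V) (s U) = restr E V (U \<inter> V) (s V)"
  shows "\<exists>!t. t \<in> carrier (sections E (\<Union>\<U>)) \<and> (\<forall>U\<in>\<U>. restr E (\<Union>\<U>) U t = s U)"
proof -
  from assms(1) have "\<forall>\<U> s. (\<forall>U\<in>\<U>. open U \<and> s U \<in> carrier (sections E U)) \<longrightarrow>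
        (\<forall>U\<in>\<U>. \<forall>V\<in>\<U>. restr E U (U \<inter> V) (s U) = restr E V (U \<inter> V) (s V)) \<longrightarrow>
        (\<exists>!t. t \<in> carrier (sections E (\<Union>\<U>)) \<and> (\<forall>U\<in>\<U>. restr E (\<Union>\<U>) U t = s U))"
    unfolding is_module_sheaf_def by (rule conjunct2)
  then show ?thesis using assms(2,3) by simp
qed

text \<open>
  A trivialisation of \<open>E\<close> over \<open>U\<close> of rank \<open>n\<close>, written in coordinates: \<open>co V s i\<close> is the \<open>i\<close>-th
  coordinate of the section \<open>s\<close> over \<open>V\<close>, as a function on the cone over \<open>V\<close>.
\<close>

definition trivialisation :: "('k::alg_closed_field, 'm) module_presheaf \<Rightarrow> 'k proj1 set \<Rightarrow> nat \<Rightarrow>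
    ('k proj1 set \<Rightarrow> 'm \<Rightarrow> nat \<Rightarrow> 'k \<times> 'k \<Rightarrow> 'k) \<Rightarrow> bool" where
  "trivialisation E U n co \<longleftrightarrow> (\<forall>V. open V \<longrightarrow> V \<subseteq> U \<longrightarrow>
     (\<forall>s\<in>carrier (sections E V). \<forall>i<n. hreg 0 V (co V s i)) \<and>
     (\<forall>s\<in>carrier (sections E V). \<forall>t\<in>carrier (sections E V). \<forall>i<n. \<forall>v\<in>cone V.
        co V (s \<oplus>\<^bsub>sections E V\<^esub> t) i v = co V s i v + co V t i v) \<and>
     (\<forall>r\<in>carrier (structure_ring V). \<forall>s\<in>carrier (sections E V). \<forall>i<n. \<forall>v\<in>cone V.
        co V (r \<odot>\<^bsub>sections E V\<^esub> s) i v = r (pt v) * co V s i v) \<and>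
     (\<forall>W. open W \<longrightarrow> W \<subseteq> V \<longrightarrow> (\<forall>s\<in>carrier (sections E V). \<forall>i<n. \<forall>v\<in>cone W.
        co W (restr E V W s) i v = co V s i v)) \<and>
     (\<forall>s\<in>carrier (sections E V). \<forall>t\<in>carrier (sections E V).
        (\<forall>i<n. \<forall>v\<in>cone V. co V s i v = co V t i v) \<longrightarrow> s = t) \<and>
     (\<forall>h. (\<forall>i<n. hreg 0 V (h i)) \<longrightarrow> (\<exists>s\<in>carrier (sections E V). \<forall>i<n. \<forall>v\<in>cone V. co V s i v = h i v)))"

text \<open>The components of the image in the free sheaf are read as functions on the cone;
  injectivity and surjectivity of the isomorphism become the last two clauses.\<close>

lemma trivialisation_of_iso:
  fixes E :: "('k::alg_closed_field, 'm) module_presheaf"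
  assumes "isomorphic_on U E (free_sheaf n)"
  obtains co where "trivialisation E U n co"
proof -
  from assms obtain \<phi> where \<phi>: "\<forall>V. open V \<longrightarrow> V \<subseteq> U \<longrightarrow>
        \<phi> V \<in> iso (add_monoid (sections E V)) (add_monoid (sections (free_sheaf n) V)) \<and>
        (\<forall>r\<in>carrier (structure_ring V). \<forall>s\<in>carrier (sections E V).
           \<phi> V (r \<odot>\<^bsub>sections E V\<^esub> s) = r \<odot>\<^bsub>sections (free_sheaf n) V\<^esub> \<phi> V s)"
     "\<forall>V W. open V \<longrightarrow> open W \<longrightarrow> W \<subseteq> V \<longrightarrow> V \<subseteq> U \<longrightarrow>
        (\<forall>s\<in>carrier (sections E V). \<phi> W (restr E V W s) = restr (free_sheaf n) V W (\<phi> V s))"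
    unfolding isomorphic_on_def by (elim exE conjE)
  define co where "co V s i v = \<phi> V s i (pt v)" for V s i v
  have "trivialisation E U n co"
    unfolding trivialisation_def
  proof (rule allI, rule impI, rule impI)
    fix V :: "'k proj1 set" assume V: "open V" "V \<subseteq> U"
    note p = \<phi>(1)[rule_format, OF V]
    from p have iso: "\<phi> V \<in> iso (add_monoid (sections E V)) (add_monoid (sections (free_sheaf n) V))" by blast
    have bij: "bij_betw (\<phi> V) (carrier (sections E V)) ({..<n} \<rightarrow>\<^sub>E carrier (structure_ring V))"
      using iso by (simp add: iso_def free_sheaf_def)
    have mem: "\<phi> V s \<in> {..<n} \<rightarrow>\<^sub>E carrier (structure_ring V)" if "s \<in> carrier (sections E V)" for s
      using bij_betwE[OF bij] that by blast
    have add: "\<phi> V (s \<oplus>\<^bsub>sections E V\<^esub> t) = (\<lambda>i\<in>{..<n}. \<phi> V s i \<oplus>\<^bsub>structure_ring V\<^esub> \<phi> V t i)"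
      if "s \<in> carrier (sections E V)" "t \<in> carrier (sections E V)" for s t
      using iso that by (simp add: iso_def hom_def free_sheaf_def)
    have smult: "\<phi> V (r \<odot>\<^bsub>sections E V\<^esub> s) = (\<lambda>i\<in>{..<n}. r \<otimes>\<^bsub>structure_ring V\<^esub> \<phi> V s i)"
      if "r \<in> carrier (structure_ring V)" "s \<in> carrier (sections E V)" for r s
      using p that by (simp add: free_sheaf_def)
    have restr: "\<phi> W (restr E V W s) = (\<lambda>i\<in>{..<n}. restrict (\<phi> V s i) W)"
      if "open W" "W \<subseteq> V" "s \<in> carrier (sections E V)" for W s
      using \<phi>(2)[rule_format, OF V(1) that(1,2) V(2) that(3)] by (simp add: free_sheaf_def)
    have 1: "\<forall>s\<in>carrier (sections E V). \<forall>i<n. hreg 0 V (co V s i)"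
    proof (intro ballI allI impI)
      fix s i assume "s \<in> carrier (sections E V)" "i < n"
      then have "\<phi> V s i \<in> carrier (structure_ring V)" using mem by blast
      then show "hreg 0 V (co V s i)" unfolding co_def by (rule structure_ring_hreg[OF V(1)])
    qed
    have 2: "\<forall>s\<in>carrier (sections E V). \<forall>t\<in>carrier (sections E V). \<forall>i<n. \<forall>v\<in>cone V.
        co V (s \<oplus>\<^bsub>sections E V\<^esub> t) i v = co V s i v + co V t i v"
      by (simp add: co_def add structure_ring_def cone_def)
    have 3: "\<forall>r\<in>carrier (structure_ring V). \<forall>s\<in>carrier (sections E V). \<forall>i<n. \<forall>v\<in>cone V.
        co V (r \<odot>\<^bsub>sections E V\<^esub> s) i v = r (pt v) * co V s i v"
      by (simp add: co_def smult) (simp add: structure_ring_def cone_def)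
    have 4: "\<forall>W. open W \<longrightarrow> W \<subseteq> V \<longrightarrow> (\<forall>s\<in>carrier (sections E V). \<forall>i<n. \<forall>v\<in>cone W.
        co W (restr E V W s) i v = co V s i v)"
      by (simp add: co_def restr cone_def)
    have 5: "\<forall>s\<in>carrier (sections E V). \<forall>t\<in>carrier (sections E V).
        (\<forall>i<n. \<forall>v\<in>cone V. co V s i v = co V t i v) \<longrightarrow> s = t"
    proof (intro ballI impI)
      fix s t assume st: "s \<in> carrier (sections E V)" "t \<in> carrier (sections E V)"
        and eq: "\<forall>i<n. \<forall>v\<in>cone V. co V s i v = co V t i v"
      have "\<phi> V s = \<phi> V t"
      proof (rule PiE_ext[OF mem[OF st(1)] mem[OF st(2)]])
        fix i assume i: "i \<in> {..<n}"
        have "\<phi> V s i \<in> extensional V" "\<phi> V t i \<in> extensional V"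
          using PiE_mem[OF mem[OF st(1)] i] PiE_mem[OF mem[OF st(2)] i]
          by (simp_all add: carrier_structure_ring_iff)
        then show "\<phi> V s i = \<phi> V t i"
        proof (rule extensionalityI)
          fix x assume x: "x \<in> V"
          obtain v where v: "v \<noteq> (0, 0)" "x = pt v" by (rule pt_surj)
          then have "v \<in> cone V" using x by (simp add: cone_def)
          then show "\<phi> V s i x = \<phi> V t i x" using eq i v by (simp add: co_def)
        qed
      qed
      then show "s = t" using inj_onD[OF bij_betw_imp_inj_on[OF bij]] st by blast
    qed
    have 6: "\<forall>h. (\<forall>i<n. hreg 0 V (h i)) \<longrightarrow> (\<exists>s\<in>carrier (sections E V). \<forall>i<n. \<forall>v\<in>cone V. co V s i v = h i v)"
    proof (intro allI impI)
      fix h assume h: "\<forall>i<n. hreg 0 V (h i)"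
      have "(\<lambda>i\<in>{..<n}. desc V (h i)) \<in> {..<n} \<rightarrow>\<^sub>E carrier (structure_ring V)"
        using h desc_regular[OF V(1)] by (auto simp: carrier_structure_ring_iff)
      then obtain s where s: "s \<in> carrier (sections E V)" "\<phi> V s = (\<lambda>i\<in>{..<n}. desc V (h i))"
        using bij_betw_imp_surj_on[OF bij] by (metis (no_types, lifting) imageE)
      have "\<forall>i<n. \<forall>v\<in>cone V. co V s i v = h i v"
        using h by (simp add: co_def s(2) desc_pt)
      then show "\<exists>s\<in>carrier (sections E V). \<forall>i<n. \<forall>v\<in>cone V. co V s i v = h i v" using s(1) by blast
    qed
    show "(\<forall>s\<in>carrier (sections E V). \<forall>i<n. hreg 0 V (co V s i)) \<and>
     (\<forall>s\<in>carrier (sections E V). \<forall>t\<in>carrier (sections E V). \<forall>i<n. \<forall>v\<in>cone V.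
        co V (s \<oplus>\<^bsub>sections E V\<^esub> t) i v = co V s i v + co V t i v) \<and>
     (\<forall>r\<in>carrier (structure_ring V). \<forall>s\<in>carrier (sections E V). \<forall>i<n. \<forall>v\<in>cone V.
        co V (r \<odot>\<^bsub>sections E V\<^esub> s) i v = r (pt v) * co V s i v) \<and>
     (\<forall>W. open W \<longrightarrow> W \<subseteq> V \<longrightarrow> (\<forall>s\<in>carrier (sections E V). \<forall>i<n. \<forall>v\<in>cone W.
        co W (restr E V W s) i v = co V s i v)) \<and>
     (\<forall>s\<in>carrier (sections E V). \<forall>t\<in>carrier (sections E V).
        (\<forall>i<n. \<forall>v\<in>cone V. co V s i v = co V t i v) \<longrightarrow> s = t) \<and>
     (\<forall>h. (\<forall>i<n. hreg 0 V (h i)) \<longrightarrow> (\<exists>s\<in>carrier (sections E V). \<forall>i<n. \<forall>v\<in>cone V. co V s i v = h i v))"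
      by (intro conjI 1 2 3 4 5 6)
  qed
  then show thesis by (rule that)
qed

lemma trivialisation_hreg:
  "trivialisation E U n co \<Longrightarrow> open V \<Longrightarrow> V \<subseteq> U \<Longrightarrow> s \<in> carrier (sections E V) \<Longrightarrow> i < n \<Longrightarrow> hreg 0 V (co V s i)"
  by (simp add: trivialisation_def)

lemma trivialisation_add:
  "trivialisation E U n co \<Longrightarrow> open V \<Longrightarrow> V \<subseteq> U \<Longrightarrow> s \<in> carrier (sections E V) \<Longrightarrow> t \<in> carrier (sections E V) \<Longrightarrow>
    i < n \<Longrightarrow> v \<in> cone V \<Longrightarrow> co V (s \<oplus>\<^bsub>sections E V\<^esub> t) i v = co V s i v + co V t i v"
  by (simp add: trivialisation_def)

lemma trivialisation_smult:
  "trivialisation E U n co \<Longrightarrow> open V \<Longrightarrow> V \<subseteq> U \<Longrightarrow> r \<in> carrier (structure_ring V) \<Longrightarrow> s \<in> carrier (sections E V) \<Longrightarrow>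
    i < n \<Longrightarrow> v \<in> cone V \<Longrightarrow> co V (r \<odot>\<^bsub>sections E V\<^esub> s) i v = r (pt v) * co V s i v"
  by (simp add: trivialisation_def)

lemma trivialisation_restr:
  "trivialisation E U n co \<Longrightarrow> open V \<Longrightarrow> V \<subseteq> U \<Longrightarrow> open W \<Longrightarrow> W \<subseteq> V \<Longrightarrow> s \<in> carrier (sections E V) \<Longrightarrow>
    i < n \<Longrightarrow> v \<in> cone W \<Longrightarrow> co W (restr E V W s) i v = co V s i v"
  by (simp add: trivialisation_def)

lemma trivialisation_eqI:
  assumes "trivialisation E U n co" "open V" "V \<subseteq> U" "s \<in> carrier (sections E V)" "t \<in> carrier (sections E V)"
    "\<And>i v. i < n \<Longrightarrow> v \<in> cone V \<Longrightarrow> co V s i v = co V t i v"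
  shows "s = t"
  using assms unfolding trivialisation_def by simp

lemma trivialisation_section:
  assumes "trivialisation E U n co" "open V" "V \<subseteq> U" "\<And>i. i < n \<Longrightarrow> hreg 0 V (h i)"
  obtains s where "s \<in> carrier (sections E V)" "\<forall>i<n. \<forall>v\<in>cone V. co V s i v = h i v"
proof -
  have "\<forall>h. (\<forall>i<n. hreg 0 V (h i)) \<longrightarrow> (\<exists>s\<in>carrier (sections E V). \<forall>i<n. \<forall>v\<in>cone V. co V s i v = h i v)"
    using assms(1-3) by (simp add: trivialisation_def)
  then have "\<exists>s\<in>carrier (sections E V). \<forall>i<n. \<forall>v\<in>cone V. co V s i v = h i v"
    using assms(4) by simp
  then obtain s where "s \<in> carrier (sections E V)" "\<forall>i<n. \<forall>v\<in>cone V. co V s i v = h i v" ..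
  then show thesis by (rule that)
qed

text \<open>
  The combination of the basis sections \<open>\<beta> j\<close> of the second chart is built up one summand at a time.
\<close>

lemma trivialisation_change:
  assumes E: "is_module_presheaf E" and A: "trivialisation E U n co" and B: "trivialisation E U' n' co'"
    and V: "open V" "V \<subseteq> U \<inter> U'" and W: "open W" "W \<subseteq> V"
    and \<beta>: "\<And>j. j < n' \<Longrightarrow> \<beta> j \<in> carrier (sections E V)"
      "\<And>i j v. i < n' \<Longrightarrow> j < n' \<Longrightarrow> v \<in> cone V \<Longrightarrow> co' V (\<beta> j) i v = (if i = j then 1 else 0)"
    and s: "s \<in> carrier (sections E W)" and i: "i < n" and v: "v \<in> cone W"
  shows "co W s i v = (\<Sum>j<n'. co V (\<beta> j) i v * co' W s j v)"
proof -
  have sub: "V \<subseteq> U" "V \<subseteq> U'" "W \<subseteq> U" "W \<subseteq> U'" using V W by auto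
  have "\<exists>t\<in>carrier (sections E W). (\<forall>i<n. \<forall>v\<in>cone W. co W t i v = (\<Sum>j<m. co V (\<beta> j) i v * co' W s j v)) \<and>
      (\<forall>i<n'. \<forall>v\<in>cone W. co' W t i v = (if i < m then co' W s i v else 0))" if "m \<le> n'" for m
    using that
  proof (induction m)
    case 0
    have z: "desc W (\<lambda>_. 0) \<in> carrier (structure_ring W)"
      using desc_regular[OF W(1)] by (simp add: carrier_structure_ring_iff)
    have z0: "desc W (\<lambda>_. 0) (pt v) = 0" if "v \<in> cone W" for v using desc_pt[OF hreg_zero that] .
    have "desc W (\<lambda>_. 0) \<odot>\<^bsub>sections E W\<^esub> s \<in> carrier (sections E W)"
      by (rule presheaf_smult_closed[OF E W(1) z s])
    moreover have "\<forall>i<n. \<forall>v\<in>cone W. co W (desc W (\<lambda>_. 0) \<odot>\<^bsub>sections E W\<^esub> s) i v = 0"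
      using trivialisation_smult[OF A W(1) sub(3) z s] z0 by simp
    moreover have "\<forall>i<n'. \<forall>v\<in>cone W. co' W (desc W (\<lambda>_. 0) \<odot>\<^bsub>sections E W\<^esub> s) i v = 0"
      using trivialisation_smult[OF B W(1) sub(4) z s] z0 by simp
    ultimately show ?case by (intro bexI[of _ "desc W (\<lambda>_. 0) \<odot>\<^bsub>sections E W\<^esub> s"]) simp_all
  next
    case (Suc m)
    then have m: "m < n'" by simp
    from Suc obtain t where t: "t \<in> carrier (sections E W)"
      "\<forall>i<n. \<forall>v\<in>cone W. co W t i v = (\<Sum>j<m. co V (\<beta> j) i v * co' W s j v)"
      "\<forall>i<n'. \<forall>v\<in>cone W. co' W t i v = (if i < m then co' W s i v else 0)" by auto
    define h where "h = desc W (co' W s m)"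
    have hs: "hreg 0 W (co' W s m)" by (rule trivialisation_hreg[OF B W(1) sub(4) s m])
    have h: "h \<in> carrier (structure_ring W)"
      using desc_regular[OF W(1) hs] by (simp add: h_def carrier_structure_ring_iff)
    have hv: "h (pt v) = co' W s m v" if "v \<in> cone W" for v unfolding h_def by (rule desc_pt[OF hs that])
    let ?b = "restr E V W (\<beta> m)"
    have b: "?b \<in> carrier (sections E W)" by (rule presheaf_restr(1)[OF E V(1) W \<beta>(1)[OF m]])
    have hb: "h \<odot>\<^bsub>sections E W\<^esub> ?b \<in> carrier (sections E W)" by (rule presheaf_smult_closed[OF E W(1) h b])
    have t': "t \<oplus>\<^bsub>sections E W\<^esub> (h \<odot>\<^bsub>sections E W\<^esub> ?b) \<in> carrier (sections E W)"
      by (rule presheaf_add_closed[OF E W(1) t(1) hb])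
    have "co W (t \<oplus>\<^bsub>sections E W\<^esub> (h \<odot>\<^bsub>sections E W\<^esub> ?b)) i v = (\<Sum>j<Suc m. co V (\<beta> j) i v * co' W s j v)"
      if iv: "i < n" "v \<in> cone W" for i v
      using trivialisation_add[OF A W(1) sub(3) t(1) hb iv] trivialisation_smult[OF A W(1) sub(3) h b iv]
        trivialisation_restr[OF A V(1) sub(1) W \<beta>(1)[OF m] iv] t(2) iv hv[OF iv(2)] by simp
    moreover have "co' W (t \<oplus>\<^bsub>sections E W\<^esub> (h \<odot>\<^bsub>sections E W\<^esub> ?b)) i v = (if i < Suc m then co' W s i v else 0)"
      if iv: "i < n'" "v \<in> cone W" for i v
    proof -
      have "v \<in> cone V" using iv(2) cone_mono[OF W(2)] by blast
      then show ?thesis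
        using trivialisation_add[OF B W(1) sub(4) t(1) hb iv] trivialisation_smult[OF B W(1) sub(4) h b iv]
          trivialisation_restr[OF B V(1) sub(2) W \<beta>(1)[OF m] iv] \<beta>(2)[OF iv(1) m] t(3) iv hv[OF iv(2)]
        by (auto simp: less_Suc_eq)
    qed
    ultimately show ?case using t' by blast
  qed
  from this[OF order_refl] obtain t where t: "t \<in> carrier (sections E W)"
    "\<forall>i<n. \<forall>v\<in>cone W. co W t i v = (\<Sum>j<n'. co V (\<beta> j) i v * co' W s j v)"
    "\<forall>i<n'. \<forall>v\<in>cone W. co' W t i v = (if i < n' then co' W s i v else 0)" by blast
  have "t = s" by (rule trivialisation_eqI[OF B W(1) sub(4) t(1) s]) (use t(3) in simp)
  then show ?thesis using t(2) i v by simp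
qed

text \<open>The sheaf axiom speaks of a set of open sets, whereas different indices may share one.
  Compatibility makes their sections equal then, so an arbitrary choice of index is
  harmless.\<close>

lemma sheaf_glue_indexed:
  assumes E: "is_module_sheaf E" and X_open: "\<And>c. c \<in> C \<Longrightarrow> open (X c)"
    and sc: "\<And>c. c \<in> C \<Longrightarrow> sc c \<in> carrier (sections E (X c))"
    and compat: "\<And>c c'. c \<in> C \<Longrightarrow> c' \<in> C \<Longrightarrow>
      restr E (X c) (X c \<inter> X c') (sc c) = restr E (X c') (X c \<inter> X c') (sc c')"
  shows "\<exists>s\<in>carrier (sections E (\<Union>c\<in>C. X c)). \<forall>c\<in>C. restr E (\<Union>c\<in>C. X c) (X c) s = sc c"
proof -
  have pre: "is_module_presheaf E" using E by (simp add: is_module_sheaf_def)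
  define ch where "ch Y = (SOME c. c \<in> C \<and> Y = X c)" for Y
  have ch: "ch Y \<in> C" "Y = X (ch Y)" if "Y \<in> X ` C" for Y
  proof -
    have "\<exists>c. c \<in> C \<and> Y = X c" using that by blast
    then have "ch Y \<in> C \<and> Y = X (ch Y)" unfolding ch_def by (rule someI_ex)
    then show "ch Y \<in> C" "Y = X (ch Y)" by blast+
  qed
  have "\<exists>!t. t \<in> carrier (sections E (\<Union>(X ` C))) \<and> (\<forall>Y\<in>X ` C. restr E (\<Union>(X ` C)) Y t = sc (ch Y))"
  proof (rule sheaf_glue[OF E])
    show "\<forall>Y\<in>X ` C. open Y \<and> sc (ch Y) \<in> carrier (sections E Y)"
    proof
      fix Y assume Y: "Y \<in> X ` C"
      show "open Y \<and> sc (ch Y) \<in> carrier (sections E Y)"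
        using X_open[OF ch(1)[OF Y]] sc[OF ch(1)[OF Y]] ch(2)[OF Y] by simp
    qed
    show "\<forall>Y\<in>X ` C. \<forall>Z\<in>X ` C. restr E Y (Y \<inter> Z) (sc (ch Y)) = restr E Z (Y \<inter> Z) (sc (ch Z))"
    proof (intro ballI)
      fix Y Z assume Y: "Y \<in> X ` C" and Z: "Z \<in> X ` C"
      show "restr E Y (Y \<inter> Z) (sc (ch Y)) = restr E Z (Y \<inter> Z) (sc (ch Z))"
        using compat[OF ch(1)[OF Y] ch(1)[OF Z]] ch(2)[OF Y] ch(2)[OF Z] by simp
    qed
  qed
  then obtain t where t: "t \<in> carrier (sections E (\<Union>(X ` C)))"
    "\<forall>Y\<in>X ` C. restr E (\<Union>(X ` C)) Y t = sc (ch Y)" by blast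
  have "restr E (\<Union>(X ` C)) (X c) t = sc c" if c: "c \<in> C" for c
  proof -
    have Xc: "X c \<in> X ` C" using c by blast
    have eq: "X (ch (X c)) = X c" using ch(2)[OF Xc] by simp
    have "sc c = restr E (X c) (X c \<inter> X (ch (X c))) (sc c)"
      using presheaf_restr_self[OF pre X_open[OF c] sc[OF c]] eq by simp
    also have "\<dots> = restr E (X (ch (X c))) (X c \<inter> X (ch (X c))) (sc (ch (X c)))"
      by (rule compat[OF c ch(1)[OF Xc]])
    also have "\<dots> = sc (ch (X c))"
      using presheaf_restr_self[OF pre X_open[OF ch(1)[OF Xc]] sc[OF ch(1)[OF Xc]]] eq by simp
    finally show ?thesis using bspec[OF t(2) Xc] by simp
  qed
  then show ?thesis using t(1) by blast
qed

text \<open>The uniqueness half of the glueing axiom, for the family of restrictions of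
  \<open>s\<close>.\<close>

lemma sheaf_separated:
  assumes E: "is_module_sheaf E" and X: "\<And>c. c \<in> C \<Longrightarrow> open (X c)"
    and s: "s \<in> carrier (sections E (\<Union>c\<in>C. X c))" and t: "t \<in> carrier (sections E (\<Union>c\<in>C. X c))"
    and eq: "\<And>c. c \<in> C \<Longrightarrow> restr E (\<Union>c\<in>C. X c) (X c) s = restr E (\<Union>c\<in>C. X c) (X c) t"
  shows "s = t"
proof -
  let ?W = "\<Union>(X ` C)"
  have pre: "is_module_presheaf E" using E by (simp add: is_module_sheaf_def)
  have W: "open ?W" using X by (intro open_Union) blast
  have ex1: "\<exists>!u. u \<in> carrier (sections E ?W) \<and> (\<forall>Y\<in>X ` C. restr E ?W Y u = restr E ?W Y s)"
  proof (rule sheaf_glue[OF E])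
    show "\<forall>Y\<in>X ` C. open Y \<and> restr E ?W Y s \<in> carrier (sections E Y)"
    proof
      fix Y assume Y: "Y \<in> X ` C"
      then have "open Y" "Y \<subseteq> ?W" using X by blast+
      then show "open Y \<and> restr E ?W Y s \<in> carrier (sections E Y)"
        using presheaf_restr(1)[OF pre W _ _ s] by simp
    qed
    show "\<forall>Y\<in>X ` C. \<forall>Z\<in>X ` C. restr E Y (Y \<inter> Z) (restr E ?W Y s) = restr E Z (Y \<inter> Z) (restr E ?W Z s)"
    proof (intro ballI)
      fix Y Z assume Y: "Y \<in> X ` C" and Z: "Z \<in> X ` C"
      then have o: "open Y" "open Z" "Y \<subseteq> ?W" "Z \<subseteq> ?W" using X by blast+
      then have "open (Y \<inter> Z)" by blast
      then show "restr E Y (Y \<inter> Z) (restr E ?W Y s) = restr E Z (Y \<inter> Z) (restr E ?W Z s)"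
        using presheaf_restr_restr[OF pre W o(1) _ _ o(3) s, of "Y \<inter> Z"]
          presheaf_restr_restr[OF pre W o(2) _ _ o(4) s, of "Y \<inter> Z"] by simp
    qed
  qed
  have "\<forall>Y\<in>X ` C. restr E ?W Y t = restr E ?W Y s" using eq by simp
  then show ?thesis using ex1 s t by blast
qed

text \<open>Change of trivialisation yields a cocycle whose untwisted sections are the sections of
  \<open>E\<close>; an everywhere independent frame then provides global coordinates of degrees
  \<open>a j\<close>.\<close>

theorem vector_bundle_splits:
  fixes E :: "('k::alg_closed_field, 'm) module_presheaf"
  assumes "is_vector_bundle E"
  shows "\<exists>n a. splits E {..<n :: nat} a"
proof -
  have sh: "is_module_sheaf E" and loc: "\<forall>p. \<exists>U n. open U \<and> p \<in> U \<and> isomorphic_on U E (free_sheaf n)"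
    using assms by (simp_all add: is_vector_bundle_def)
  have pre: "is_module_presheaf E" using sh by (simp add: is_module_sheaf_def)
  have "\<forall>p. \<exists>x. open (fst x) \<and> p \<in> fst x \<and> trivialisation E (fst x) (fst (snd x)) (snd (snd x))"
  proof
    fix p
    from loc obtain U n where U: "open U" "p \<in> U" "isomorphic_on U E (free_sheaf n)" by blast
    obtain co where "trivialisation E U n co" by (rule trivialisation_of_iso[OF U(3)])
    then show "\<exists>x. open (fst x) \<and> p \<in> fst x \<and> trivialisation E (fst x) (fst (snd x)) (snd (snd x))"
      using U by (intro exI[of _ "(U, n, co)"]) simp
  qed
  from choice[OF this] obtain x where
    x: "\<forall>p. open (fst (x p)) \<and> p \<in> fst (x p) \<and> trivialisation E (fst (x p)) (fst (snd (x p))) (snd (snd (x p)))" ..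
  define U N co where "U p = fst (x p)" and "N p = fst (snd (x p))" and "co p = snd (snd (x p))" for p
  have U: "open (U p)" "p \<in> U p" and tr: "trivialisation E (U p) (N p) (co p)" for p
    using x by (simp_all add: U_def N_def co_def)
  define p0 where "p0 = pt (1, 0 :: 'k)"
  \<comment> \<open>One chart misses only finitely many points; one further chart for each of them
    completes a finite cover.\<close>
  define C where "C = insert p0 (- U p0)"
  have fin: "finite C"
    using open_finite_complement[OF U(1), of p0] U(2)[of p0] by (auto simp: C_def)
  have cover: "\<exists>c\<in>C. q \<in> U c" for q
  proof (cases "q \<in> U p0")
    case False
    then have "q \<in> C" by (simp add: C_def)
    then show ?thesis using U(2) by blast
  qed (simp add: C_def)
  have UU: "open (U c \<inter> U c')" for c c' using U(1) by blast
  \<comment> \<open>The j-th basis section of chart c' over the overlap; its coordinates in chart c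
    are the j-th column of the transition matrix \<open>g c c'\<close>.\<close>
  define \<beta> where "\<beta> c c' j = (SOME b. b \<in> carrier (sections E (U c \<inter> U c')) \<and>
    (\<forall>i<N c'. \<forall>v\<in>cone (U c \<inter> U c'). co c' (U c \<inter> U c') b i v = (if i = j then 1 else 0)))" for c c' j
  have \<beta>: "\<beta> c c' j \<in> carrier (sections E (U c \<inter> U c')) \<and>
    (\<forall>i<N c'. \<forall>v\<in>cone (U c \<inter> U c'). co c' (U c \<inter> U c') (\<beta> c c' j) i v = (if i = j then 1 else 0))" for c c' j
  proof -
    obtain b where "b \<in> carrier (sections E (U c \<inter> U c'))"
      "\<forall>i<N c'. \<forall>v\<in>cone (U c \<inter> U c'). co c' (U c \<inter> U c') b i v = (if i = j then 1 else 0)"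
      by (rule trivialisation_section[OF tr[of c'] UU Int_lower2, of c "\<lambda>i v. if i = j then 1 else 0"])
        (simp, rule that)
    then have "\<exists>b. b \<in> carrier (sections E (U c \<inter> U c')) \<and>
      (\<forall>i<N c'. \<forall>v\<in>cone (U c \<inter> U c'). co c' (U c \<inter> U c') b i v = (if i = j then 1 else 0))" by blast
    then show ?thesis unfolding \<beta>_def by (rule someI_ex)
  qed
  define g where "g c c' v i j = co c (U c \<inter> U c') (\<beta> c c' j) i v" for c c' v i j
  have change: "co c W s i v = (\<Sum>j<N c'. g c c' v i j * co c' W s j v)"
    if W: "open W" "W \<subseteq> U c \<inter> U c'" and s: "s \<in> carrier (sections E W)" and i: "i < N c" and v: "v \<in> cone W"
    for c c' W s i v
    unfolding g_def
    by (rule trivialisation_change[OF pre tr[of c] tr[of c'] UU order_refl W _ _ s i v]) (use \<beta>[of c c'] in simp_all)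
  have g_id: "g c c v i j = (if i = j then 1 else 0)" if "v \<in> cone (U c)" "i < N c" for c v i j
    using \<beta>[of c c j] that by (simp add: g_def)
  \<comment> \<open>Both sides are the c-coordinate of the j-th basis section of c'', computed
    through c' and directly.\<close>
  have g_coc: "(\<Sum>k<N c'. g c c' v i k * g c' c'' v k j) = g c c'' v i j"
    if v: "v \<in> cone (U c \<inter> U c' \<inter> U c'')" and i: "i < N c" and j: "j < N c''" for c c' c'' v i j
  proof -
    let ?W = "U c \<inter> U c' \<inter> U c''"
    have W: "open ?W" using U(1) by blast
    have sub: "?W \<subseteq> U c' \<inter> U c''" "?W \<subseteq> U c \<inter> U c'" "?W \<subseteq> U c \<inter> U c''" by blast+
    note b = \<beta>[of c' c'' j, THEN conjunct1]
    let ?s = "restr E (U c' \<inter> U c'') ?W (\<beta> c' c'' j)"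
    have s: "?s \<in> carrier (sections E ?W)" by (rule presheaf_restr(1)[OF pre UU W sub(1) b])
    have v': "v \<in> cone (U c' \<inter> U c'')" using v by (simp add: cone_Int)
    have 1: "co c' ?W ?s k v = g c' c'' v k j" if "k < N c'" for k
      using trivialisation_restr[OF tr[of c'] UU Int_lower1 W sub(1) b that v] by (simp add: g_def)
    have 2: "co c'' ?W ?s l v = (if l = j then 1 else 0)" if "l < N c''" for l
      using trivialisation_restr[OF tr[of c''] UU Int_lower2 W sub(1) b that v] \<beta>[of c' c'' j] v' that by simp
    have "co c ?W ?s i v = (\<Sum>k<N c'. g c c' v i k * g c' c'' v k j)"
      unfolding change[OF W sub(2) s i v] using 1 by (intro sum.cong) auto
    moreover have "co c ?W ?s i v = (\<Sum>l<N c''. if l = j then g c c'' v i l else 0)"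
      unfolding change[OF W sub(3) s i v] using 2 by (intro sum.cong) auto
    ultimately show ?thesis using j by simp
  qed
  \<comment> \<open>The product of \<open>g c c'\<close> and \<open>g c' c\<close> is the identity
    matrix of size N c, which bounds N c by N c'; by symmetry the ranks agree.\<close>
  have N_le: "N c \<le> N c'" for c c'
  proof -
    have "U c \<inter> U c' \<noteq> {}" using open_Int_nonempty[OF U(1) U(1), of c c'] U(2) by blast
    then obtain v where v: "v \<in> cone (U c \<inter> U c')" using cone_nonempty[of "U c \<inter> U c'"] by blast
    show ?thesis
    proof (rule left_inverse_size_le)
      fix i j assume ij: "i < N c" "j < N c"
      have "v \<in> cone (U c \<inter> U c' \<inter> U c)" "v \<in> cone (U c)" using v by (simp_all add: cone_Int)
      then show "(\<Sum>k<N c'. g c c' v i k * g c' c v k j) = (if i = j then 1 else 0)"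
        using g_coc[of v c c' c i j] g_id[of v c i j] ij by simp
    qed
  qed
  define n where "n = N p0"
  have N: "N c = n" for c unfolding n_def using N_le by (intro antisym)
  have co_n: "trivialisation E (U c) n (co c)" for c using tr[of c] N by simp
  interpret cocycle n C U g
  proof
    show "U c \<noteq> {}" for c using U(2) by blast
    show "hreg 0 (U c \<inter> U c') (\<lambda>v. g c c' v i j)" if "i < n" for c c' i j
      unfolding g_def by (rule trivialisation_hreg[OF co_n UU Int_lower1 _ that]) (use \<beta> in blast)
  qed (use fin U(1) cover g_id g_coc N in simp_all)
  obtain a e where e: "is_frame a e" and D: "\<forall>c\<in>C. \<forall>v\<in>cone (U c). detf n (e c v) \<noteq> 0"
    using splitting_frame_exists by blast
  \<comment> \<open>The family of local coordinates of \<open>s\<close>; \<open>T_twisted\<close>,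
    \<open>T_inj\<close> and \<open>T_surj\<close> identify the sections over W with the compatible
    families.\<close>
  define T where "T W s c v i = co c (W \<inter> U c) (restr E W (W \<inter> U c) s) i v" for W s c v i
  have WU: "open (W \<inter> U c)" if "open W" for W c using that U(1) by blast
  have rs: "restr E W (W \<inter> U c) s \<in> carrier (sections E (W \<inter> U c))"
    if "open W" "s \<in> carrier (sections E W)" for W s c
    by (rule presheaf_restr(1)[OF pre that(1) WU[OF that(1)] Int_lower1 that(2)])
  have T_restr: "T W s c v i = co c Y (restr E W Y s) i v"
    if W: "open W" and s: "s \<in> carrier (sections E W)" and Y: "open Y" "Y \<subseteq> W \<inter> U c" and i: "i < n" and v: "v \<in> cone Y"
    for W s c Y v i
    using trivialisation_restr[OF co_n WU[OF W] Int_lower2 Y rs[OF W s] i v]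
      presheaf_restr_restr[OF pre W WU[OF W] Y Int_lower1 s] by (simp add: T_def)
  have T_twisted: "twisted 0 W (T W s)" if W: "open W" and s: "s \<in> carrier (sections E W)" for W s
    unfolding twisted_def
  proof (intro conjI ballI allI impI)
    fix c i assume "i < n"
    then show "hreg 0 (W \<inter> U c) (\<lambda>v. T W s c v i)"
      unfolding T_def by (rule trivialisation_hreg[OF co_n WU[OF W] Int_lower2 rs[OF W s]])
  next
    fix c c' v i assume v: "v \<in> cone (W \<inter> U c \<inter> U c')" and i: "i < n"
    let ?Y = "W \<inter> U c \<inter> U c'"
    have Y: "open ?Y" "?Y \<subseteq> W \<inter> U c" "?Y \<subseteq> W \<inter> U c'" "?Y \<subseteq> U c \<inter> U c'" "?Y \<subseteq> W"
      using W U(1) by (blast, blast, blast, blast, blast)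
    have "T W s c v i = co c ?Y (restr E W ?Y s) i v" by (rule T_restr[OF W s Y(1,2) i v])
    also have "\<dots> = (\<Sum>j<n. g c c' v i j * co c' ?Y (restr E W ?Y s) j v)"
      using change[OF Y(1,4) presheaf_restr(1)[OF pre W Y(1,5) s] _ v] i N by simp
    also have "\<dots> = (\<Sum>j<n. g c c' v i j * T W s c' v j)"
      using T_restr[OF W s Y(1,3) _ v] by (intro sum.cong) auto
    finally show "T W s c v i = (\<Sum>j<n. g c c' v i j * T W s c' v j)" .
  qed
  have W_union: "(\<Union>c\<in>C. W \<inter> U c) = W" for W
  proof
    show "W \<subseteq> (\<Union>c\<in>C. W \<inter> U c)"
    proof
      fix q assume "q \<in> W"
      moreover obtain c where "c \<in> C" "q \<in> U c" using cover by blast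
      ultimately show "q \<in> (\<Union>c\<in>C. W \<inter> U c)" by blast
    qed
  qed blast
  have T_inj: "s = t" if W: "open W" and s: "s \<in> carrier (sections E W)" and t: "t \<in> carrier (sections E W)"
    and eq: "\<And>c v i. c \<in> C \<Longrightarrow> v \<in> cone (W \<inter> U c) \<Longrightarrow> i < n \<Longrightarrow> T W s c v i = T W t c v i" for W s t
  proof (rule sheaf_separated[OF sh, of C "\<lambda>c. W \<inter> U c", unfolded W_union])
    show "restr E W (W \<inter> U c) s = restr E W (W \<inter> U c) t" if "c \<in> C" for c
      using eq[OF that]
      by (intro trivialisation_eqI[OF co_n WU[OF W] Int_lower2 rs[OF W s] rs[OF W t]]) (simp add: T_def)
  qed (use WU[OF W] s t in simp_all)
  have T_surj: "\<exists>s\<in>carrier (sections E W). \<forall>c\<in>C. \<forall>v\<in>cone (W \<inter> U c). \<forall>i<n. T W s c v i = t c v i"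
    if W: "open W" and t: "twisted 0 W t" for W t
  proof -
    have "\<forall>c\<in>C. \<exists>s. s \<in> carrier (sections E (W \<inter> U c)) \<and>
        (\<forall>i<n. \<forall>v\<in>cone (W \<inter> U c). co c (W \<inter> U c) s i v = t c v i)"
    proof
      fix c assume c: "c \<in> C"
      obtain s where "s \<in> carrier (sections E (W \<inter> U c))"
        "\<forall>i<n. \<forall>v\<in>cone (W \<inter> U c). co c (W \<inter> U c) s i v = t c v i"
        by (rule trivialisation_section[OF co_n WU[OF W] Int_lower2, where h = "\<lambda>i v. t c v i"])
          (rule twisted_hreg[OF t c], assumption, rule that)
      then show "\<exists>s. s \<in> carrier (sections E (W \<inter> U c)) \<and>
        (\<forall>i<n. \<forall>v\<in>cone (W \<inter> U c). co c (W \<inter> U c) s i v = t c v i)" by blast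
    qed
    from bchoice[OF this] obtain sc where sc: "\<forall>c\<in>C. sc c \<in> carrier (sections E (W \<inter> U c)) \<and>
        (\<forall>i<n. \<forall>v\<in>cone (W \<inter> U c). co c (W \<inter> U c) (sc c) i v = t c v i)" ..
    have "\<exists>s\<in>carrier (sections E (\<Union>c\<in>C. W \<inter> U c)). \<forall>c\<in>C. restr E (\<Union>c\<in>C. W \<inter> U c) (W \<inter> U c) s = sc c"
    proof (rule sheaf_glue_indexed[OF sh WU[OF W]])
      show "sc c \<in> carrier (sections E (W \<inter> U c))" if "c \<in> C" for c using sc that by blast
      fix c c' assume c: "c \<in> C" "c' \<in> C"
      let ?Y = "(W \<inter> U c) \<inter> (W \<inter> U c')"
      have Y: "open ?Y" using WU[OF W] by blast
      have m: "sc c \<in> carrier (sections E (W \<inter> U c))" "sc c' \<in> carrier (sections E (W \<inter> U c'))"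
        using sc c by blast+
      have r: "restr E (W \<inter> U c) ?Y (sc c) \<in> carrier (sections E ?Y)"
        "restr E (W \<inter> U c') ?Y (sc c') \<in> carrier (sections E ?Y)"
        by (rule presheaf_restr(1)[OF pre WU[OF W] Y Int_lower1 m(1)],
            rule presheaf_restr(1)[OF pre WU[OF W] Y Int_lower2 m(2)])
      have YU: "?Y \<subseteq> U c" "?Y \<subseteq> U c \<inter> U c'" by blast+
      show "restr E (W \<inter> U c) ?Y (sc c) = restr E (W \<inter> U c') ?Y (sc c')"
      proof (rule trivialisation_eqI[OF co_n[of c] Y YU(1) r])
        fix i v assume i: "i < n" and v: "v \<in> cone ?Y"
        then have v': "v \<in> cone (W \<inter> U c)" "v \<in> cone (W \<inter> U c')" "v \<in> cone (W \<inter> U c \<inter> U c')"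
          by (simp_all add: cone_Int)
        have "co c ?Y (restr E (W \<inter> U c') ?Y (sc c')) i v =
            (\<Sum>j<n. g c c' v i j * co c' ?Y (restr E (W \<inter> U c') ?Y (sc c')) j v)"
          using change[OF Y YU(2) r(2) _ v] i N by simp
        also have "\<dots> = (\<Sum>j<n. g c c' v i j * t c' v j)"
          using trivialisation_restr[OF co_n[of c'] WU[OF W] Int_lower2 Y Int_lower2 m(2) _ v] sc c(2) v'(2)
          by (intro sum.cong) auto
        also have "\<dots> = t c v i" using twisted_compat[OF t c v'(3) i] by simp
        also have "\<dots> = co c ?Y (restr E (W \<inter> U c) ?Y (sc c)) i v"
          using trivialisation_restr[OF co_n[of c] WU[OF W] Int_lower2 Y Int_lower1 m(1) i v] sc c(1) v'(1) i by simp
        finally show "co c ?Y (restr E (W \<inter> U c) ?Y (sc c)) i v = co c ?Y (restr E (W \<inter> U c') ?Y (sc c')) i v" by simp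
      qed
    qed
    then obtain s where s: "s \<in> carrier (sections E W)" "\<forall>c\<in>C. restr E W (W \<inter> U c) s = sc c"
      unfolding W_union by blast
    then show ?thesis using sc by (intro bexI[OF _ s(1)]) (simp add: T_def)
  qed
  \<comment> \<open>The frame is invertible at every point, so identities between coordinates may be
    tested after applying it in a chart.\<close>
  have pointwise: "x k = y k" if v: "v \<in> cone W" and k: "k < n"
    and eq: "\<And>c i. c \<in> C \<Longrightarrow> v \<in> cone (W \<inter> U c) \<Longrightarrow> i < n \<Longrightarrow> (\<Sum>j<n. e c v i j * x j) = (\<Sum>j<n. e c v i j * y j)"
    for v W k x y
  proof -
    obtain c where c: "c \<in> C" "pt v \<in> U c" using cover by blast
    then have v': "v \<in> cone (W \<inter> U c)" "v \<in> cone (U c)" using v by (simp_all add: cone_def)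
    have "detf n (e c v) \<noteq> 0" using D c(1) v'(2) by blast
    then have "x k - y k = 0"
    proof (rule detf_solution_zero[where x = "\<lambda>k. x k - y k"])
      show "(\<Sum>j<n. e c v i j * (x j - y j)) = 0" if "i < n" for i
        using eq[OF c(1) v'(1) that] by (simp add: right_diff_distrib sum_subtractf)
    qed (rule k)
    then show ?thesis by simp
  qed
  let ?I = "{..<n}"
  have "\<exists>\<Psi>. bij_betw \<Psi> (carrier (sections E W)) (split_sections ?I a W) \<and>
    (\<forall>s\<in>carrier (sections E W). \<forall>c\<in>C. \<forall>v\<in>cone (W \<inter> U c). \<forall>i<n. T W s c v i = (\<Sum>j<n. e c v i j * \<Psi> s j v))"
    if W: "open W" for W
  proof (rule bij_betw_from_relation)
    fix s assume s: "s \<in> carrier (sections E W)"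
    obtain h where h: "\<And>j. j < n \<Longrightarrow> hreg (a j) W (h j)"
      "\<And>c v i. c \<in> C \<Longrightarrow> v \<in> cone (W \<inter> U c) \<Longrightarrow> i < n \<Longrightarrow> T W s c v i = (\<Sum>j<n. e c v i j * h j v)"
      by (rule splitting_frame_coordinates[OF e D W T_twisted[OF W s]]) (rule that, assumption+)
    have "(\<lambda>j\<in>?I. \<lambda>v\<in>cone W. h j v) \<in> split_sections ?I a W"
      by (rule split_sections_restrict) (use h(1) in simp)
    then show "\<exists>\<sigma>\<in>split_sections ?I a W. \<forall>c\<in>C. \<forall>v\<in>cone (W \<inter> U c). \<forall>i<n. T W s c v i = (\<Sum>j<n. e c v i j * \<sigma> j v)"
      using h(2) by (intro bexI[where x = "\<lambda>j\<in>?I. \<lambda>v\<in>cone W. h j v"]) (simp_all add: cone_Int)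
  next
    fix \<sigma> assume \<sigma>: "\<sigma> \<in> split_sections ?I a W"
    have "twisted 0 W (\<lambda>c v i. \<Sum>j<n. e c v i j * \<sigma> j v)"
      by (rule frame_combination_twisted[OF e]) (use split_sections_hreg[OF \<sigma>] in simp)
    from T_surj[OF W this]
    show "\<exists>s\<in>carrier (sections E W). \<forall>c\<in>C. \<forall>v\<in>cone (W \<inter> U c). \<forall>i<n. T W s c v i = (\<Sum>j<n. e c v i j * \<sigma> j v)" .
  next
    fix s \<sigma> \<tau> assume \<sigma>: "\<sigma> \<in> split_sections ?I a W" and \<tau>: "\<tau> \<in> split_sections ?I a W"
      and eq: "\<forall>c\<in>C. \<forall>v\<in>cone (W \<inter> U c). \<forall>i<n. T W s c v i = (\<Sum>j<n. e c v i j * \<sigma> j v)"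
        "\<forall>c\<in>C. \<forall>v\<in>cone (W \<inter> U c). \<forall>i<n. T W s c v i = (\<Sum>j<n. e c v i j * \<tau> j v)"
    show "\<sigma> = \<tau>"
    proof (rule split_sections_eqI[OF \<sigma> \<tau>])
      fix k v assume k: "k \<in> ?I" and v: "v \<in> cone W"
      show "\<sigma> k v = \<tau> k v"
        by (rule pointwise[OF v, of k "\<lambda>k. \<sigma> k v" "\<lambda>k. \<tau> k v"]) (use k eq in auto)
    qed
  next
    fix s t \<sigma> assume s: "s \<in> carrier (sections E W)" and t: "t \<in> carrier (sections E W)"
      and "\<forall>c\<in>C. \<forall>v\<in>cone (W \<inter> U c). \<forall>i<n. T W s c v i = (\<Sum>j<n. e c v i j * \<sigma> j v)"
        "\<forall>c\<in>C. \<forall>v\<in>cone (W \<inter> U c). \<forall>i<n. T W t c v i = (\<Sum>j<n. e c v i j * \<sigma> j v)"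
    then show "s = t" by (intro T_inj[OF W s t]) simp
  qed
  then have "\<forall>W. \<exists>\<Psi>. open W \<longrightarrow> bij_betw \<Psi> (carrier (sections E W)) (split_sections ?I a W) \<and>
    (\<forall>s\<in>carrier (sections E W). \<forall>c\<in>C. \<forall>v\<in>cone (W \<inter> U c). \<forall>i<n. T W s c v i = (\<Sum>j<n. e c v i j * \<Psi> s j v))"
    by simp
  from choice[OF this] obtain \<Psi> where "\<forall>W. open W \<longrightarrow> bij_betw (\<Psi> W) (carrier (sections E W)) (split_sections ?I a W) \<and>
    (\<forall>s\<in>carrier (sections E W). \<forall>c\<in>C. \<forall>v\<in>cone (W \<inter> U c). \<forall>i<n. T W s c v i = (\<Sum>j<n. e c v i j * \<Psi> W s j v))" ..
  then have \<Psi>: "\<And>W. open W \<Longrightarrow> bij_betw (\<Psi> W) (carrier (sections E W)) (split_sections ?I a W)"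
    "\<And>W s c v i. open W \<Longrightarrow> s \<in> carrier (sections E W) \<Longrightarrow> c \<in> C \<Longrightarrow> v \<in> cone (W \<inter> U c) \<Longrightarrow> i < n \<Longrightarrow>
      (\<Sum>j<n. e c v i j * \<Psi> W s j v) = T W s c v i" by simp_all
  have "splitting_map E ?I a \<Psi>"
    unfolding splitting_map_def
  proof (intro allI impI conjI ballI)
    fix W :: "'k proj1 set" assume W: "open W"
    show "bij_betw (\<Psi> W) (carrier (sections E W)) (split_sections ?I a W)" by (rule \<Psi>(1)[OF W])
    fix s assume s: "s \<in> carrier (sections E W)"
    {
      fix t k v assume t: "t \<in> carrier (sections E W)" and k: "k \<in> ?I" and v: "v \<in> cone W"
      have st: "s \<oplus>\<^bsub>sections E W\<^esub> t \<in> carrier (sections E W)" by (rule presheaf_add_closed[OF pre W s t])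
      have kn: "k < n" using k by simp
      show "\<Psi> W (s \<oplus>\<^bsub>sections E W\<^esub> t) k v = \<Psi> W s k v + \<Psi> W t k v"
      proof (rule pointwise[OF v kn, where x = "\<lambda>k. \<Psi> W (s \<oplus>\<^bsub>sections E W\<^esub> t) k v" and y = "\<lambda>k. \<Psi> W s k v + \<Psi> W t k v"])
        fix c i assume c: "c \<in> C" and v': "v \<in> cone (W \<inter> U c)" and i: "i < n"
        have "T W (s \<oplus>\<^bsub>sections E W\<^esub> t) c v i = T W s c v i + T W t c v i"
          unfolding T_def presheaf_restr(2)[OF pre W WU[OF W] Int_lower1 s t]
          by (rule trivialisation_add[OF co_n WU[OF W] Int_lower2 rs[OF W s] rs[OF W t] i v'])
        then show "(\<Sum>j<n. e c v i j * \<Psi> W (s \<oplus>\<^bsub>sections E W\<^esub> t) j v) = (\<Sum>j<n. e c v i j * (\<Psi> W s j v + \<Psi> W t j v))"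
          using \<Psi>(2)[OF W st c v' i] \<Psi>(2)[OF W s c v' i] \<Psi>(2)[OF W t c v' i]
          by (simp add: distrib_left sum.distrib)
      qed
    }
    {
      fix Y :: "'k proj1 set" and k v assume Y: "open Y" "Y \<subseteq> W" and k: "k \<in> ?I" and v: "v \<in> cone Y"
      have rY: "restr E W Y s \<in> carrier (sections E Y)" by (rule presheaf_restr(1)[OF pre W Y s])
      have kn: "k < n" using k by simp
      show "\<Psi> Y (restr E W Y s) k v = \<Psi> W s k v"
      proof (rule pointwise[OF v kn, where x = "\<lambda>k. \<Psi> Y (restr E W Y s) k v" and y = "\<lambda>k. \<Psi> W s k v"])
        fix c i assume c: "c \<in> C" and v': "v \<in> cone (Y \<inter> U c)" and i: "i < n"
        have vW: "v \<in> cone (W \<inter> U c)" using v' Y(2) by (auto simp: cone_def)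
        have sub: "Y \<inter> U c \<subseteq> W \<inter> U c" using Y(2) by blast
        have "T Y (restr E W Y s) c v i = co c (Y \<inter> U c) (restr E W (Y \<inter> U c) s) i v"
          unfolding T_def presheaf_restr_restr[OF pre W Y(1) WU[OF Y(1)] Int_lower1 Y(2) s] ..
        also have "\<dots> = T W s c v i" by (rule T_restr[OF W s WU[OF Y(1)] sub i v', symmetric])
        finally show "(\<Sum>j<n. e c v i j * \<Psi> Y (restr E W Y s) j v) = (\<Sum>j<n. e c v i j * \<Psi> W s j v)"
          using \<Psi>(2)[OF Y(1) rY c v' i] \<Psi>(2)[OF W s c vW i] by simp
      qed
    }
  next
    fix W :: "'k proj1 set" and r s k v
    assume W: "open W" and r: "r \<in> carrier (structure_ring W)" and s: "s \<in> carrier (sections E W)"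
      and k: "k \<in> ?I" and v: "v \<in> cone W"
    have m: "r \<odot>\<^bsub>sections E W\<^esub> s \<in> carrier (sections E W)" by (rule presheaf_smult_closed[OF pre W r s])
    have kn: "k < n" using k by simp
    show "\<Psi> W (r \<odot>\<^bsub>sections E W\<^esub> s) k v = r (pt v) * \<Psi> W s k v"
    proof (rule pointwise[OF v kn, where x = "\<lambda>k. \<Psi> W (r \<odot>\<^bsub>sections E W\<^esub> s) k v" and y = "\<lambda>k. r (pt v) * \<Psi> W s k v"])
      fix c i assume c: "c \<in> C" and v': "v \<in> cone (W \<inter> U c)" and i: "i < n"
      have "hreg 0 (W \<inter> U c) (\<lambda>v. r (pt v))" by (rule hreg_mono[OF structure_ring_hreg[OF W r] Int_lower1])
      then have "hreg 0 (W \<inter> U c) (\<lambda>v. restrict r (W \<inter> U c) (pt v))"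
        using hreg_cong[of "W \<inter> U c" "\<lambda>v. restrict r (W \<inter> U c) (pt v)" "\<lambda>v. r (pt v)"] by (simp add: cone_def)
      then have r': "restrict r (W \<inter> U c) \<in> carrier (structure_ring (W \<inter> U c))"
        using regular_on_iff_hreg[OF WU[OF W]] by (simp add: carrier_structure_ring_iff)
      have "T W (r \<odot>\<^bsub>sections E W\<^esub> s) c v i = r (pt v) * T W s c v i"
        unfolding T_def presheaf_restr(3)[OF pre W WU[OF W] Int_lower1 s r]
        using trivialisation_smult[OF co_n WU[OF W] Int_lower2 r' rs[OF W s] i v'] v' by (simp add: cone_def)
      then show "(\<Sum>j<n. e c v i j * \<Psi> W (r \<odot>\<^bsub>sections E W\<^esub> s) j v) = (\<Sum>j<n. e c v i j * (r (pt v) * \<Psi> W s j v))"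
        using \<Psi>(2)[OF W m c v' i, symmetric] \<Psi>(2)[OF W s c v' i, symmetric]
        by (simp add: sum_distrib_left algebra_simps)
    qed
  qed
  then show ?thesis unfolding splits_def by blast
qed

theorem mainTheorem3:
  fixes f f' :: "'k::alg_closed_field proj1 \<Rightarrow> 'k proj1"
    and E :: "('k, 'm) module_presheaf"
  assumes "is_morphism f" and "surj f"
    and "is_morphism f'" and "surj f'"
    and "morphism_degree f = morphism_degree f'"
    and "is_vector_bundle E"
  shows "isomorphic (direct_image f E) (direct_image f' E)"
proof -
  obtain P Q d where f: "proj_map f P Q d" by (rule morphism_proj_map[OF assms(1,2)])
  obtain P' Q' d' where f': "proj_map f' P' Q' d'" by (rule morphism_proj_map[OF assms(3,4)])
  \<comment> \<open>The degree of the forms is intrinsic, and the splitting type of a direct image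
    depends only on it and on \<open>a\<close>.\<close>
  have d: "d' = d" using assms(5) proj_map.degree_eq[OF f] proj_map.degree_eq[OF f'] by simp
  have "is_module_presheaf E" using assms(6) by (simp add: is_vector_bundle_def is_module_sheaf_def)
  then have cl: "closed_presheaf E" by (rule module_presheaf_closed)
  obtain n a where E: "splits E {..<n :: nat} a" using vector_bundle_splits[OF assms(6)] by blast
  show ?thesis
    by (rule splits_isomorphic[OF closed_presheaf_direct_image[OF assms(1) cl]
          closed_presheaf_direct_image[OF assms(3) cl]
          proj_map.splits_direct_image[OF f assms(1) cl E]
          proj_map.splits_direct_image[OF f'[unfolded d] assms(3) cl E]])
qed

end
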